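(* For every $(t_0,p_0)\in[0,T]\times\Delta(I)$, $$\mathbf V(t_0,p_0)=\inf_{\mathbf P\in \mathbf M(t_0,p_0)}\mathbf E_{\mathbf P}\left[\int_{t_0}^T H(s,\mathbf p(s))\,ds\right].$$
   Context: Data. $I\ge 2$ is an integer, $T>0$, $U$ and $V$ are compact subsets of finite-dimensional spaces, and $\ell_i:[0,T]\times U\times V\to\mathbb R$ ($i=1,\dots,I$) are continuous. $\Delta(I)=\{p\in\mathbb R^I: p_i\ge 0,\ \sum_i p_i=1\}$, and $e_1,\dots,e_I$ is the canonical basis of $\mathbb R^I$. Isaacs' condition is assumed: for all $(t,p)\in[0,T]\times\Delta(I)$, $$H(t,p):=\min_{u\in U}\max_{v\in V}\sum_{i=1}^I p_i\ell_i(t,u,v)=\max_{v\in V}\min_{u\in U}\sum_{i=1}^I p_i\ell_i(t,u,v).$$ The game and its value. For $t_0<T$, $\mathcal U(t_0)$ (resp. $\mathcal V(t_0)$) is the set of Lebesgue measurable maps $[t_0,T]\to U$ (resp. $[t_0,T]\to V$), with the $L^1$-distance and its Borel $\sigma$-field. Fix a non-trivial set $\mathcal E$ of probability spaces, stable by product. A random strategy for Player 1 is a pair $((\Omega_\alpha,\mathcal F_\alpha,\mathbf P_\alpha),\alpha)$ with $(\Omega_\alpha,\mathcal F_\alpha,\mathbf P_\alpha)\in\mathcal E$ and $\alpha:\Omega_\alpha\times\mathcal V(t_0)\to\mathcal U(t_0)$ measurable, such that there is a partition $t_0<t_1<\dots<t_k=T$ with: for all $\omega$, all $v_1,v_2$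 and all $i\in\{0,\dots,k-1\}$, if $v_1=v_2$ a.e. on $[t_0,t_i]$ then $\alpha(\omega,v_1)=\alpha(\omega,v_2)$ a.e. on $[t_0,t_{i+1}]$. The set of these is $\mathcal A_r(t_0)$. Random strategies $\beta:\Omega_\beta\times\mathcal U(t_0)\to\mathcal V(t_0)$ of Player 2 are defined symmetrically; their set is $\mathcal B_r(t_0)$. For $(\alpha,\beta)\in\mathcal A_r(t_0)\times\mathcal B_r(t_0)$ and $\omega=(\omega_1,\omega_2)\in\Omega_\alpha\times\Omega_\beta$ there is a unique pair $(u_\omega,v_\omega)\in\mathcal U(t_0)\times\mathcal V(t_0)$ with $\alpha(\omega_1,v_\omega)=u_\omega$, $\beta(\omega_2,u_\omega)=v_\omega$, and it depends measurably on $\omega$; one sets $\mathbf E_{\alpha\beta}\big[\int_{t_0}^T\ell_i(s,\alpha(s),\beta(s))ds\big]=\int_{\Omega_\alpha\times\Omega_\beta}\int_{t_0}^T\ell_i(s,u_\omega(s),v_\omega(s))\,ds\,d(\mathbf P_\alpha\otimes\mathbf P_\beta)(\omega)$. The value is $$\mathbf V(t_0,p)=\inf_{(\alpha_i)\in\mathcal A_r(t_0)^I}\sup_{\beta\in\mathcal B_r(t_0)}\sum_{i=1}^I p_i\mathbf E_{\alpha_i\beta}\Big[\int_{t_0}^T\ell_i(s,\alpha_i(s),\beta(s))ds\Big]=\sup_{\beta\in\mathcal B_r(t_0)}\inf_{(\alpha_i)\in\mathcal A_r(t_0)^I}\sum_{i=1}^I p_i\mathbf E_{\alpha_i\beta}\Big[\int_{t_0}^T\ell_i(s,\alpha_i(s),\beta(s))ds\Big]$$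 (when $U$ and $V$ are compact subsets of finite-dimensional spaces, the $\ell_i$ are continuous on $[0,T]\times U\times V$, and Isaacs' condition $\min_{u\in U}\max_{v\in V}\sum_{i} p_i\ell_i(t,u,v)=\max_{v\in V}\min_{u\in U}\sum_{i} p_i\ell_i(t,u,v)$ holds for all $(t,p)\in[0,T]\times\Delta(I)$, the two expressions are known to coincide and not to depend on $\mathcal E$), with $\mathbf V(T,p)=0$. Martingale measures. $\mathbf D(t_0)$ is the set of càdlàg functions $\mathbb R\to\Delta(I)$ that are constant on $(-\infty,t_0)$ and on $[T,+\infty)$; $t\mapsto\mathbf p(t)$ is the coordinate process on $\mathbf D(t_0)$ and $(\mathcal G_t)$ the filtration it generates. $\mathbf M(t_0,p_0)$ is the set of probability measures $\mathbf P$ on $\mathbf D(t_0)$ under which $(\mathbf p(t))_{t\in\mathbb R}$ is a martingale and, $\mathbf P$-a.s., $\mathbf p(t)=p_0$ for $t<t_0$ and $\mathbf p(t)\in\{e_1,\dots,e_I\}$ for $t\ge T$. $\mathbf E_{\mathbf P}$ is expectation under $\mathbf P$. *)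

theory Defs
  imports "HOL-Probability.Probability"
begin

section \<open>The simplex and the Hamiltonian\<close>

text \<open>The index set \<open>{1,\<dots>,I}\<close> is the finite type \<open>'i\<close>; the basis vector \<open>e\<^sub>i\<close> is \<open>axis i 1\<close>.\<close>

definition prob_simplex :: "(real ^ 'i::finite) set" where
  "prob_simplex = {p. (\<forall>i. 0 \<le> p $ i) \<and> (\<Sum>i\<in>UNIV. p $ i) = 1}"

text \<open>For nonempty compact \<open>U\<close>, \<open>V\<close>, continuous \<open>l i\<close> and \<open>t \<in> [0,T]\<close>, all the infima and
  suprema below are attained, so that they are the minima and maxima of the min-max and max-min.\<close>

definition hamiltonian ::
  "'u set \<Rightarrow> 'v set \<Rightarrow> ('i::finite \<Rightarrow> real \<times> 'u \<times> 'v \<Rightarrow> real) \<Rightarrow> real \<Rightarrow> real ^ 'i \<Rightarrow> real" where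
  "hamiltonian U V l t p = (INF u\<in>U. SUP v\<in>V. \<Sum>i\<in>UNIV. p $ i * l i (t, u, v))"

definition isaacs_condition ::
  "real \<Rightarrow> 'u set \<Rightarrow> 'v set \<Rightarrow> ('i::finite \<Rightarrow> real \<times> 'u \<times> 'v \<Rightarrow> real) \<Rightarrow> bool" where
  "isaacs_condition T U V l \<longleftrightarrow>
     (\<forall>t\<in>{0..T}. \<forall>p\<in>prob_simplex.
        (INF u\<in>U. SUP v\<in>V. \<Sum>i\<in>UNIV. p $ i * l i (t, u, v)) =
        (SUP v\<in>V. INF u\<in>U. \<Sum>i\<in>UNIV. p $ i * l i (t, u, v)))"

section \<open>Controls\<close>

definition controls :: "real \<Rightarrow> real \<Rightarrow> 'a::euclidean_space set \<Rightarrow> (real \<Rightarrow> 'a) set" where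
  "controls t0 T U = {f \<in> {t0..T} \<rightarrow>\<^sub>E U. f \<in> borel_measurable (lebesgue_on {t0..T})}"

definition L1_dist :: "real \<Rightarrow> real \<Rightarrow> (real \<Rightarrow> 'a::euclidean_space) \<Rightarrow> (real \<Rightarrow> 'a) \<Rightarrow> real" where
  "L1_dist t0 T f g = (LINT s|lebesgue_on {t0..T}. norm (f s - g s))"

text \<open>Controls are kept as functions, not as classes modulo almost everywhere equality, so
  \<open>L1_dist\<close> is a pseudo-distance. Its Borel \<open>\<sigma>\<close>-field consists of the preimages of the Borel sets
  of the quotient. Random strategies (below) respect almost everywhere equality, by the last step
  of the partition, so that working with representatives is the same as working with classes.\<close>

definition control_space :: "real \<Rightarrow> real \<Rightarrow> 'a::euclidean_space set \<Rightarrow> (real \<Rightarrow> 'a) measure" where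
  "control_space t0 T U =
     sigma (controls t0 T U)
       {A. A \<subseteq> controls t0 T U \<and>
           (\<forall>f\<in>A. \<exists>e>0. \<forall>g\<in>controls t0 T U. L1_dist t0 T f g < e \<longrightarrow> g \<in> A)}"

section \<open>Families of probability spaces\<close>

definition measure_isomorphic :: "'a measure \<Rightarrow> 'b measure \<Rightarrow> bool" where
  "measure_isomorphic M N \<longleftrightarrow>
     (\<exists>f g. f \<in> M \<rightarrow>\<^sub>M N \<and> g \<in> N \<rightarrow>\<^sub>M M \<and>
        (\<forall>x\<in>space M. g (f x) = x) \<and> (\<forall>y\<in>space N. f (g y) = y) \<and> distr M N f = N)"

text \<open>All spaces of the family live on one carrier type \<open>'w\<close>, while the product of two of them
  lives on \<open>'w \<times> 'w\<close>; stability by product is therefore understood up to isomorphism of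
  probability spaces. Non-trivial means that some space of the family has an event of probability
  strictly between 0 and 1: without one, only deterministic strategies would be available.\<close>

definition admissible_family :: "'w measure set \<Rightarrow> bool" where
  "admissible_family E \<longleftrightarrow>
     (\<forall>M\<in>E. prob_space M) \<and>
     (\<exists>M\<in>E. \<exists>A\<in>sets M. 0 < measure M A \<and> measure M A < 1) \<and>
     (\<forall>M\<in>E. \<forall>N\<in>E. \<exists>K\<in>E. measure_isomorphic (M \<Otimes>\<^sub>M N) K)"

section \<open>Random strategies, payoff and value\<close>

text \<open>\<open>random_strategies E t0 T V U\<close> is the set of random strategies answering \<open>V\<close>-valued controls
  by \<open>U\<close>-valued ones. Thus \<open>\<A>\<^sub>r(t0)\<close> is \<open>random_strategies E t0 T V U\<close> and \<open>\<B>\<^sub>r(t0)\<close> is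
  \<open>random_strategies E t0 T U V\<close>.\<close>

type_synonym ('w, 'b, 'a) strategy = "'w measure \<times> ('w \<times> (real \<Rightarrow> 'b) \<Rightarrow> (real \<Rightarrow> 'a))"

definition random_strategies ::
  "'w measure set \<Rightarrow> real \<Rightarrow> real \<Rightarrow> 'b::euclidean_space set \<Rightarrow> 'a::euclidean_space set \<Rightarrow>
   ('w, 'b, 'a) strategy set" where
  "random_strategies E t0 T V U =
     {(M, \<alpha>). M \<in> E \<and> \<alpha> \<in> M \<Otimes>\<^sub>M control_space t0 T V \<rightarrow>\<^sub>M control_space t0 T U \<and>
        (\<exists>(k::nat) \<tau>. \<tau> 0 = t0 \<and> \<tau> k = T \<and> (\<forall>j<k. \<tau> j < \<tau> (Suc j)) \<and>
           (\<forall>\<omega>\<in>space M. \<forall>v1\<in>controls t0 T V. \<forall>v2\<in>controls t0 T V. \<forall>j<k.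
              (AE s in lebesgue_on {t0..\<tau> j}. v1 s = v2 s) \<longrightarrow>
              (AE s in lebesgue_on {t0..\<tau> (Suc j)}. \<alpha> (\<omega>, v1) s = \<alpha> (\<omega>, v2) s)))}"

text \<open>The pair of controls generated by two strategies; it is unique only up to almost everywhere
  equality, which does not affect the payoff.\<close>

definition play ::
  "real \<Rightarrow> real \<Rightarrow> 'u::euclidean_space set \<Rightarrow> 'v::euclidean_space set \<Rightarrow>
   ('w \<times> (real \<Rightarrow> 'v) \<Rightarrow> (real \<Rightarrow> 'u)) \<Rightarrow> ('w \<times> (real \<Rightarrow> 'u) \<Rightarrow> (real \<Rightarrow> 'v)) \<Rightarrow>
   'w \<times> 'w \<Rightarrow> (real \<Rightarrow> 'u) \<times> (real \<Rightarrow> 'v)" where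
  "play t0 T U V \<alpha> \<beta> \<omega> =
     (SOME (u, v). u \<in> controls t0 T U \<and> v \<in> controls t0 T V \<and>
        (AE s in lebesgue_on {t0..T}. \<alpha> (fst \<omega>, v) s = u s) \<and>
        (AE s in lebesgue_on {t0..T}. \<beta> (snd \<omega>, u) s = v s))"

definition expected_payoff ::
  "real \<Rightarrow> real \<Rightarrow> 'u::euclidean_space set \<Rightarrow> 'v::euclidean_space set \<Rightarrow>
   (real \<times> 'u \<times> 'v \<Rightarrow> real) \<Rightarrow> ('w, 'v, 'u) strategy \<Rightarrow> ('w, 'u, 'v) strategy \<Rightarrow> real" where
  "expected_payoff t0 T U V f a b =
     (LINT \<omega>|(fst a \<Otimes>\<^sub>M fst b).
        (case play t0 T U V (snd a) (snd b) \<omega> of (u, v) \<Rightarrow>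
           LINT s|lebesgue_on {t0..T}. f (s, u s, v s)))"

text \<open>The value is given by its inf-sup expression. Under Isaacs' condition it is known to coincide
  with the sup-inf expression. All payoffs are bounded, so the infimum and supremum are
  those of nonempty bounded sets of reals.\<close>

definition game_value ::
  "'w measure set \<Rightarrow> real \<Rightarrow> 'u::euclidean_space set \<Rightarrow> 'v::euclidean_space set \<Rightarrow>
   ('i::finite \<Rightarrow> real \<times> 'u \<times> 'v \<Rightarrow> real) \<Rightarrow> real \<Rightarrow> real ^ 'i \<Rightarrow> real" where
  "game_value E T U V l t0 p =
     (if t0 < T then
        (INF a\<in>{a. \<forall>i. a i \<in> random_strategies E t0 T V U}.
         SUP b\<in>random_strategies E t0 T U V.
           \<Sum>i\<in>UNIV. p $ i * expected_payoff t0 T U V (l i) (a i) b)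
      else 0)"

section \<open>Martingale measures\<close>

definition cadlag :: "(real \<Rightarrow> 'a::topological_space) \<Rightarrow> bool" where
  "cadlag f \<longleftrightarrow> (\<forall>t. (f \<longlongrightarrow> f t) (at_right t) \<and> (\<exists>x. (f \<longlongrightarrow> x) (at_left t)))"

definition paths :: "real \<Rightarrow> real \<Rightarrow> (real \<Rightarrow> real ^ 'i::finite) set" where
  "paths T t0 = {w. cadlag w \<and> range w \<subseteq> prob_simplex \<and>
     (\<forall>s t. s < t0 \<longrightarrow> t < t0 \<longrightarrow> w s = w t) \<and> (\<forall>s t. T \<le> s \<longrightarrow> T \<le> t \<longrightarrow> w s = w t)}"

definition path_space :: "real \<Rightarrow> real \<Rightarrow> (real \<Rightarrow> real ^ 'i::finite) measure" where
  "path_space T t0 = sigma (paths T t0) {{w \<in> paths T t0. w s \<in> A} |s A. A \<in> sets borel}"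

definition path_filtration :: "real \<Rightarrow> real \<Rightarrow> real \<Rightarrow> (real \<Rightarrow> real ^ 'i::finite) measure" where
  "path_filtration T t0 t =
     sigma (paths T t0) {{w \<in> paths T t0. w s \<in> A} |s A. s \<le> t \<and> A \<in> sets borel}"

definition martingale ::
  "'w measure \<Rightarrow> (real \<Rightarrow> 'w measure) \<Rightarrow> (real \<Rightarrow> 'w \<Rightarrow> real ^ 'i::finite) \<Rightarrow> bool" where
  "martingale M F X \<longleftrightarrow>
     (\<forall>t. X t \<in> borel_measurable (F t)) \<and> (\<forall>t. integrable M (X t)) \<and>
     (\<forall>s t i. s \<le> t \<longrightarrow> (AE w in M. real_cond_exp M (F s) (\<lambda>w. X t w $ i) w = X s w $ i))"

definition martingale_measures ::
  "real \<Rightarrow> real \<Rightarrow> real ^ 'i::finite \<Rightarrow> (real \<Rightarrow> real ^ 'i) measure set" where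
  "martingale_measures T t0 p0 =
     {P. prob_space P \<and> sets P = sets (path_space T t0) \<and>
         martingale P (path_filtration T t0) (\<lambda>t w. w t) \<and>
         (AE w in P. (\<forall>t<t0. w t = p0) \<and> (\<forall>t\<ge>T. w t \<in> range (\<lambda>i. axis i 1)))}"

end

theory Submission
  imports Defs
begin

text \<open>The game value lies below the cost of every martingale measure \<open>P\<close>: the informed player of type \<open>i\<close>
  draws, under \<open>P\<close> conditioned on the terminal value \<open>e\<^sub>i\<close>, a discretized path of beliefs and plays
  against it an open-loop control that is optimal in the Hamiltonian. The reply on a cell of the time
  grid depends only on the beliefs already revealed, so by the martingale property the payoff of the
  true type may be replaced by its average under the current belief.

  Conversely, the infimum \<open>W t p\<close> over martingale measures is convex in \<open>p\<close> and satisfies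
  \<open>W t p \<le> \<integral> H s p ds + W t' p\<close>. An affine minorant of \<open>W t0\<close>, nearly exact at \<open>p0\<close>, is a vector of
  payoffs that the uninformed player can guarantee up to a small error without randomizing and without
  computing posteriors, by an approachability argument: the potential
  \<open>sup\<^sub>q (x \<bullet> q - W t q - \<delta> |q|\<^sup>2)\<close> of the vector \<open>x\<close> of payoffs still to be guaranteed increases on
  each cell of the grid only by a term of second order, if the uninformed player answers the maximizing \<open>q\<close>.\<close>

section \<open>Integrals over intervals\<close>

text \<open>The family \<open>E\<close> is only assumed non-trivial, so the law of a signal cannot
  be prescribed exactly. Products of a space carrying one event of probability strictly between 0
  and 1 have arbitrarily fine partitions, and these reproduce a law on a finite set up to a small
  total variation error. Hence the beliefs shown by the informed player are rounded to finitely many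
  values on a finite grid. The estimates use the joint weights E[1_{signal = c} p_i(T)], which enter
  the payoff linearly.

  Measurability shapes the other half. The uninformed player reacts to a rounded payoff vector, so
  that the choice of an action runs over countably many cases. The operator \<open>play\<close> is a
  bare choice; a version measurable in the random outcome comes from iterating the composed response
  a fixed number of times.

  The quadratic term of the potential is what makes approachability work: without it a step of
  length D could cost a first-order error, and N such errors need not vanish. With coefficient
  \<delta> the error of a cell is of order D^2/\<delta>, which sums to order 1/N.\<close>

abbreviation LI :: "real \<Rightarrow> real \<Rightarrow> (real \<Rightarrow> real) \<Rightarrow> real" where
  "LI a b f \<equiv> LINT s|lebesgue_on {a..b}. f s"

lemma finite_measure_interval: "finite_measure (lebesgue_on {a..b::real})"
  by (rule finite_measureI) (cases "a \<le> b", simp_all add: emeasure_restrict_space)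

lemma AE_interval_iff:
  "(AE s in lebesgue_on {a..b::real}. P s) \<longleftrightarrow> (AE s in lebesgue. s \<in> {a..b} \<longrightarrow> P s)"
  by (subst AE_restrict_space_iff) auto

lemma AE_interval_subset:
  fixes a b c d :: real
  assumes "AE s in lebesgue_on {a..b}. P s" "a \<le> c" "d \<le> b"
  shows "AE s in lebesgue_on {c..d}. P s"
  using assms(1) unfolding AE_interval_iff by eventually_elim (use assms(2,3) in auto)

lemma AE_interval_singleton: "AE s in lebesgue_on {a..a::real}. P s"
proof -
  have "AE s in lebesgue. s \<notin> {a}"
    by (intro AE_not_in) (simp add: null_sets_def)
  then show ?thesis
    unfolding AE_interval_iff by eventually_elim auto
qed

lemma AE_interval_neq: "AE s in lebesgue_on {a..b::real}. s \<noteq> c"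
proof -
  have "AE s in lebesgue. s \<notin> {c}"
    by (intro AE_not_in) (simp add: null_sets_def)
  then show ?thesis
    unfolding AE_interval_iff by eventually_elim auto
qed

lemma measurable_subinterval:
  fixes a b c d :: real
  assumes "f \<in> lebesgue_on {a..b} \<rightarrow>\<^sub>M M" "a \<le> c" "d \<le> b"
  shows "f \<in> lebesgue_on {c..d} \<rightarrow>\<^sub>M M"
proof -
  have "f \<in> restrict_space (lebesgue_on {a..b}) {c..d} \<rightarrow>\<^sub>M M"
    by (rule measurable_restrict_space1[OF assms(1)])
  moreover have "restrict_space (lebesgue_on {a..b}) {c..d} = lebesgue_on {c..d}"
    using assms(2,3) by (subst restrict_restrict_space) (auto simp: Int_absorb1)
  ultimately show ?thesis by simp
qed

lemma integrable_interval:
  fixes f :: "real \<Rightarrow> real"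
  assumes "f \<in> borel_measurable (lebesgue_on {a..b})" "\<And>s. s \<in> {a..b} \<Longrightarrow> \<bar>f s\<bar> \<le> C"
  shows "integrable (lebesgue_on {a..b}) f"
  by (rule finite_measure.integrable_const_bound[OF finite_measure_interval, where B=C])
    (use assms in \<open>auto intro!: AE_I2\<close>)

lemma integrable_subinterval:
  fixes f :: "real \<Rightarrow> real"
  assumes "integrable (lebesgue_on {a..b}) f" "a \<le> c" "d \<le> b"
  shows "integrable (lebesgue_on {c..d}) f"
proof -
  have "set_integrable lebesgue {a..b} f"
    using assms(1) by (simp add: set_integrable_def integrable_restrict_space)
  then have "set_integrable lebesgue {c..d} f"
    by (rule set_integrable_subset) (use assms in auto)
  then show ?thesis
    by (simp add: set_integrable_def integrable_restrict_space)
qed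

lemma measure_interval: "a \<le> b \<Longrightarrow> measure (lebesgue_on {a..b::real}) {a..b} = b - a"
  by (simp add: measure_restrict_space)

lemma LI_const: "a \<le> b \<Longrightarrow> LI a b (\<lambda>_. c) = c * (b - a)"
  by (simp add: measure_interval)

lemma LI_mono:
  assumes "integrable (lebesgue_on {a..b}) f" "integrable (lebesgue_on {a..b}) g"
    "\<And>s. s \<in> {a..b} \<Longrightarrow> f s \<le> g s"
  shows "LI a b f \<le> LI a b g"
  by (rule integral_mono) (use assms in auto)

lemma LI_abs_le:
  assumes "a \<le> b" "\<And>s. s \<in> {a..b} \<Longrightarrow> \<bar>f s\<bar> \<le> C"
  shows "\<bar>LI a b f\<bar> \<le> C * (b - a)"
proof (cases "integrable (lebesgue_on {a..b}) f")
  case True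
  interpret finite_measure "lebesgue_on {a..b}" by (rule finite_measure_interval)
  have "LI a b f \<le> LI a b (\<lambda>_. C)" by (rule LI_mono) (use True assms(2) in fastforce)+
  moreover have "LI a b (\<lambda>_. - C) \<le> LI a b f" by (rule LI_mono) (use True assms(2) in fastforce)+
  ultimately show ?thesis using LI_const[OF assms(1), of C] LI_const[OF assms(1), of "- C"] by linarith
next
  case False
  \<comment> \<open>A non-integrable function has integral 0 by convention, so here only the sign of
    \<open>C\<close> matters.\<close>
  have "0 \<le> C" using assms(2)[of a] assms(1) by auto
  then show ?thesis using False assms(1) by (simp add: not_integrable_integral_eq)
qed

lemma LI_cong_AE:
  assumes "f \<in> borel_measurable (lebesgue_on {a..b})" "g \<in> borel_measurable (lebesgue_on {a..b})"
    "AE s in lebesgue_on {a..b}. f s = g s"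
  shows "LI a b f = LI a b g"
  using assms by (intro integral_cong_AE)

lemma LI_split:
  assumes "integrable (lebesgue_on {a..c}) f" "a \<le> b" "b \<le> c"
  shows "LI a c f = LI a b f + LI b c f"
proof -
  have 1: "integrable (lebesgue_on {a..b}) f" "integrable (lebesgue_on {b..c}) f"
    using assms by (auto intro: integrable_subinterval)
  \<comment> \<open>Additivity comes from the Henstock-Kurzweil integral, which agrees with the
    Lebesgue integral on integrable functions.\<close>
  have "integral {a..b} f + integral {b..c} f = integral {a..c} f"
    using assms by (intro Henstock_Kurzweil_Integration.integral_combine)
      (auto intro: integrable_on_lebesgue_on)
  then show ?thesis
    using 1 assms(1) by (simp add: lebesgue_integral_eq_integral)
qed

section \<open>Uniform grids\<close>

definition grid :: "real \<Rightarrow> real \<Rightarrow> nat \<Rightarrow> nat \<Rightarrow> real" where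
  "grid a b N k = a + real k * ((b - a) / real N)"

text \<open>The last cell is closed on the right.\<close>

definition cell :: "real \<Rightarrow> real \<Rightarrow> nat \<Rightarrow> real \<Rightarrow> nat" where
  "cell a b N s = min (N - 1) (nat \<lfloor>(s - a) * real N / (b - a)\<rfloor>)"

lemma grid_0 [simp]: "grid a b N 0 = a"
  by (simp add: grid_def)

lemma grid_N [simp]: "0 < N \<Longrightarrow> grid a b N N = b"
  by (simp add: grid_def)

lemma grid_Suc: "grid a b N (Suc k) = grid a b N k + (b - a) / real N"
  unfolding grid_def of_nat_Suc by (simp only: ring_distribs)

lemma grid_mono: "a \<le> b \<Longrightarrow> j \<le> k \<Longrightarrow> grid a b N j \<le> grid a b N k"
  unfolding grid_def by (intro add_left_mono mult_right_mono divide_nonneg_nonneg) auto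

lemma grid_strict_mono: "a < b \<Longrightarrow> 0 < N \<Longrightarrow> j < k \<Longrightarrow> grid a b N j < grid a b N k"
  unfolding grid_def by (intro add_strict_left_mono mult_strict_right_mono divide_pos_pos) auto

lemma grid_bounds:
  assumes "a \<le> b" "0 < N" "k \<le> N"
  shows "a \<le> grid a b N k" "grid a b N k \<le> b"
  using grid_mono[OF assms(1), of 0 k N] grid_mono[OF assms(1), of k N N] assms by auto

lemma cell_less: "0 < N \<Longrightarrow> cell a b N s < N"
  by (auto simp: cell_def min_def)

lemma cell_bounds:
  assumes "a < b" "0 < N" "a \<le> s" "s < b"
  shows "grid a b N (cell a b N s) \<le> s" "s < grid a b N (Suc (cell a b N s))"
proof -
  define x where "x = (s - a) * real N / (b - a)"
  have x0: "0 \<le> x" using assms by (auto simp: x_def)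
  have xN: "x < real N" using assms by (auto simp: x_def field_simps)
  have "nat \<lfloor>x\<rfloor> < N" using x0 xN by linarith
  then have c: "cell a b N s = nat \<lfloor>x\<rfloor>" by (auto simp: cell_def x_def[symmetric])
  have s: "s = a + x * ((b - a) / real N)" using assms by (auto simp: x_def)
  have "real (nat \<lfloor>x\<rfloor>) \<le> x" using x0 by linarith
  moreover have "x < real (Suc (nat \<lfloor>x\<rfloor>))" using x0 by linarith
  ultimately show "grid a b N (cell a b N s) \<le> s" "s < grid a b N (Suc (cell a b N s))"
    unfolding c grid_def using assms
    by (subst s, auto intro!: divide_right_mono mult_right_mono)
       (subst s, auto intro!: divide_strict_right_mono mult_strict_right_mono simp del: of_nat_Suc)
qed

lemma cell_eq:
  assumes "a < b" "0 < N" "k < N" "grid a b N k \<le> s" "s < grid a b N (Suc k)"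
  shows "cell a b N s = k"
proof -
  have "a \<le> s" "s < b"
    using grid_bounds[of a b N k] grid_bounds[of a b N "Suc k"] assms by auto
  note c = cell_bounds[OF assms(1,2) this]
  have "cell a b N s < Suc k"
    using grid_mono[of a b "Suc k" "cell a b N s" N] assms c by (force simp: not_less[symmetric])
  moreover have "k < Suc (cell a b N s)"
    using grid_mono[of a b "Suc (cell a b N s)" k N] assms c by (force simp: not_less[symmetric])
  ultimately show ?thesis by auto
qed

lemma cell_measurable [measurable]: "cell a b N \<in> lebesgue_on A \<rightarrow>\<^sub>M count_space UNIV"
proof -
  have "cell a b N \<in> borel \<rightarrow>\<^sub>M count_space UNIV"
    unfolding cell_def by measurable
  then show ?thesis
    by (intro measurable_restrict_space1 measurable_completion) simp
qed

lemma LI_grid: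
  assumes "integrable (lebesgue_on {a..b}) f" "a \<le> b" "0 < N" "m \<le> N"
  shows "LI a (grid a b N m) f = (\<Sum>k<m. LI (grid a b N k) (grid a b N (Suc k)) f)"
  using assms(4)
proof (induction m)
  case 0
  show ?case
    using integral_cong_AE[of f "lebesgue_on {a..a}" "\<lambda>_. 0"] AE_interval_singleton
      integrable_subinterval[OF assms(1), of a a] assms(2) by auto
next
  case (Suc m)
  have "LI a (grid a b N (Suc m)) f =
      LI a (grid a b N m) f + LI (grid a b N m) (grid a b N (Suc m)) f"
    by (rule LI_split) (use Suc assms grid_bounds[of a b N] grid_mono[of a b m "Suc m" N]
        in \<open>auto intro: integrable_subinterval\<close>)
  with Suc show ?case by simp
qed

section \<open>Discretization of the state space\<close>

definition dense_seq :: "nat \<Rightarrow> 'a::euclidean_space" where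
  "dense_seq = from_nat_into (SOME D. countable D \<and> (\<forall>X. open X \<longrightarrow> X \<noteq> {} \<longrightarrow> (\<exists>d\<in>D. d \<in> X)))"

lemma dense_seq:
  assumes "0 < e"
  shows "\<exists>n. dist (x::'a::euclidean_space) (dense_seq n) < e"
proof -
  let ?P = "\<lambda>D::'a set. countable D \<and> (\<forall>X. open X \<longrightarrow> X \<noteq> {} \<longrightarrow> (\<exists>d\<in>D. d \<in> X))"
  define D where "D = Eps ?P"
  have "\<exists>D. ?P D" using countable_dense_exists by metis
  then have D: "countable D" "\<And>X. open X \<Longrightarrow> X \<noteq> {} \<Longrightarrow> \<exists>d\<in>D. d \<in> X"
    unfolding D_def using someI_ex[of ?P] by blast+
  obtain d where d: "d \<in> D" "d \<in> ball x e"
    using D(2)[of "ball x e"] assms by auto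
  obtain n where "d = from_nat_into D n"
    using D(1) d(1) by (metis from_nat_into_surj)
  with d(2) show ?thesis unfolding dense_seq_def D_def by auto
qed

text \<open>A Borel rounding map with countably many values:
  \<open>dense_seq (net_index e x)\<close> is the point to which \<open>x\<close> is rounded. It
  turns beliefs into signals and the tracked payoff vector into a countable state.\<close>

definition net_index :: "real \<Rightarrow> 'a::euclidean_space \<Rightarrow> nat" where
  "net_index e x = (LEAST n. dist x (dense_seq n) < e)"

lemma net_index: "0 < e \<Longrightarrow> dist x (dense_seq (net_index e x)) < e"
  unfolding net_index_def by (rule LeastI_ex) (rule dense_seq)

lemma net_index_measurable [measurable]: "net_index e \<in> borel \<rightarrow>\<^sub>M count_space UNIV"
  unfolding net_index_def by measurable

text \<open>Compactness leaves finitely many roundings; applied to the simplex, it makes the set of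
  signals finite.\<close>

lemma net_index_bounded:
  fixes S :: "'a::euclidean_space set"
  assumes "compact S" "0 < e"
  obtains m where "\<And>x. x \<in> S \<Longrightarrow> net_index e x < m"
proof -
  have "S \<subseteq> (\<Union>n. ball (dense_seq n) e)"
    using dense_seq[OF assms(2)] by (auto simp: dist_commute)
  then obtain F where F: "finite F" "S \<subseteq> (\<Union>n\<in>F. ball (dense_seq n) e)"
    using compactE_image[OF assms(1), of UNIV "\<lambda>n. ball (dense_seq n) e"] by auto
  obtain m where m: "\<And>n. n \<in> F \<Longrightarrow> n < m"
    using F(1) finite_nat_set_iff_bounded by auto
  show ?thesis
  proof (rule that)
    fix x assume "x \<in> S"
    then obtain n where "n \<in> F" "dist x (dense_seq n) < e"
      using F(2) by (auto simp: dist_commute)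
    then show "net_index e x < m"
      unfolding net_index_def using m by (meson Least_le le_less_trans)
  qed
qed

section \<open>The Hamiltonian\<close>

text \<open>The payoffs and the Hamiltonian are continuous on a closed set only; their extension by
  zero is Borel.\<close>

lemma measurable_continuous_on_closed:
  fixes f :: "'a::topological_space \<Rightarrow> 'b::{topological_space, zero}"
  assumes "closed K" "continuous_on K f" "g \<in> borel_measurable M" "\<And>x. x \<in> space M \<Longrightarrow> g x \<in> K"
  shows "(\<lambda>x. f (g x)) \<in> borel_measurable M"
proof -
  have "(\<lambda>x. if x \<in> K then f x else 0) \<in> borel_measurable borel"
    by (rule borel_measurable_continuous_on_if) (use assms in \<open>auto intro: continuous_on_const\<close>)
  from measurable_compose[OF assms(3) this] show ?thesis
    by (rule measurable_cong[THEN iffD1, rotated]) (use assms(4) in auto)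
qed

lemma prob_simplex_nonneg: "p \<in> prob_simplex \<Longrightarrow> 0 \<le> p $ i"
  by (simp add: prob_simplex_def)

lemma prob_simplex_sum: "p \<in> prob_simplex \<Longrightarrow> (\<Sum>i\<in>UNIV. p $ i) = 1"
  by (simp add: prob_simplex_def)

lemma prob_simplex_le_1: "p \<in> prob_simplex \<Longrightarrow> p $ i \<le> 1"
  using member_le_sum[of i UNIV "\<lambda>i. p $ i"] by (auto simp: prob_simplex_def)

lemma prob_simplex_norm:
  assumes "p \<in> prob_simplex"
  shows "norm p \<le> 1"
  using norm_le_l1_cart[of p] assms by (simp add: prob_simplex_def)

lemma convex_prob_simplex: "convex prob_simplex"
  unfolding convex_def prob_simplex_def
  by (auto simp: sum.distrib sum_distrib_left[symmetric])

lemma closed_prob_simplex: "closed (prob_simplex :: (real^'i::finite) set)"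
proof -
  have "prob_simplex = (\<Inter>i. {p::real^'i. 0 \<le> p $ i}) \<inter> {p. (\<Sum>i\<in>UNIV. p $ i) = 1}"
    by (auto simp: prob_simplex_def)
  moreover have "closed {p::real^'i. (\<Sum>i\<in>UNIV. p $ i) = 1}"
    by (intro closed_Collect_eq continuous_intros)
  moreover have "closed {p::real^'i. 0 \<le> p $ i}" for i
    by (intro closed_Collect_le continuous_intros)
  ultimately show ?thesis using closed_Int closed_INT by (smt (verit) UNIV_I)
qed

lemma compact_prob_simplex: "compact (prob_simplex :: (real^'i::finite) set)"
  using closed_prob_simplex prob_simplex_norm
  by (auto simp: compact_eq_bounded_closed bounded_iff)

lemma axis_in_prob_simplex: "axis i 1 \<in> prob_simplex"
  by (auto simp: prob_simplex_def axis_def if_distrib)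

text \<open>\<open>Lip\<close> is a Lipschitz constant in the belief, since every coordinate of
  \<open>p - q\<close> is at most its Euclidean norm. The same number bounds, through the l1 norm,
  the Euclidean norm of the payoff vector collected per unit of time.\<close>

locale payoff_data =
  fixes T :: real and U :: "'u::euclidean_space set" and V :: "'v::euclidean_space set"
    and l :: "'i::finite \<Rightarrow> real \<times> 'u \<times> 'v \<Rightarrow> real" and C Lip :: real
  assumes T_pos: "0 < T"
    and compact_U: "compact U" and U_ne: "U \<noteq> {}"
    and compact_V: "compact V" and V_ne: "V \<noteq> {}"
    and l_cont: "\<And>i. continuous_on ({0..T} \<times> U \<times> V) (l i)"
    and l_bound: "\<And>i s u v. s \<in> {0..T} \<Longrightarrow> u \<in> U \<Longrightarrow> v \<in> V \<Longrightarrow> \<bar>l i (s, u, v)\<bar> \<le> C"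
    and Lip_eq: "Lip = C * real CARD('i)"
begin

lemma C_nonneg: "0 \<le> C"
proof -
  obtain u v where "u \<in> U" "v \<in> V" using U_ne V_ne by auto
  then show ?thesis using l_bound[of 0 u v undefined] T_pos by auto
qed

definition mean :: "real^'i \<Rightarrow> real \<Rightarrow> 'u \<Rightarrow> 'v \<Rightarrow> real" where
  "mean p s u v = (\<Sum>i\<in>UNIV. p $ i * l i (s, u, v))"

abbreviation H :: "real \<Rightarrow> real^'i \<Rightarrow> real" where
  "H \<equiv> hamiltonian U V l"

lemma Lip_nonneg: "0 \<le> Lip"
  by (simp add: Lip_eq C_nonneg)

lemma weighted_diff_le:
  assumes "p \<in> prob_simplex" "\<And>i. \<bar>f i - g i\<bar> \<le> e"
  shows "\<bar>(\<Sum>i\<in>UNIV. p $ i * f i) - (\<Sum>i\<in>UNIV. p $ i * g i)\<bar> \<le> e"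
proof -
  have "\<bar>\<Sum>i\<in>UNIV. p $ i * (f i - g i)\<bar> \<le> (\<Sum>i\<in>UNIV. p $ i * e)"
    by (rule order_trans[OF sum_abs], rule sum_mono)
      (auto simp: abs_mult prob_simplex_nonneg[OF assms(1)] intro!: mult_left_mono assms(2))
  also have "\<dots> = e"
    by (simp add: sum_distrib_right[symmetric] prob_simplex_sum[OF assms(1)])
  finally show ?thesis
    by (simp add: right_diff_distrib sum_subtractf)
qed

lemma mean_abs_le:
  assumes "p \<in> prob_simplex" "s \<in> {0..T}" "u \<in> U" "v \<in> V"
  shows "\<bar>mean p s u v\<bar> \<le> C"
  using weighted_diff_le[OF assms(1), of "\<lambda>i. l i (s, u, v)" "\<lambda>_. 0" C] l_bound assms
  by (simp add: mean_def)

lemma mean_diff_le: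
  assumes "s \<in> {0..T}" "u \<in> U" "v \<in> V"
  shows "\<bar>mean p s u v - mean q s u v\<bar> \<le> Lip * norm (p - q)"
proof -
  have "\<bar>\<Sum>i\<in>UNIV. (p $ i - q $ i) * l i (s, u, v)\<bar> \<le> (\<Sum>i\<in>(UNIV::'i set). norm (p - q) * C)"
    using component_le_norm_cart[of "p - q"]
    by (intro order_trans[OF sum_abs] sum_mono)
      (auto simp: abs_mult intro!: mult_mono l_bound assms)
  then show ?thesis
    by (simp add: mean_def Lip_eq algebra_simps sum_subtractf)
qed

text \<open>A modulus of continuity in time, uniform in type and actions. On a grid of mesh below
  \<open>d\<close>, the time in the running payoff may be frozen on each cell at the price
  \<open>e\<close>.\<close>

definition time_step :: "real \<Rightarrow> real \<Rightarrow> bool" where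
  "time_step e d \<longleftrightarrow> 0 < d \<and> (\<forall>i. \<forall>s\<in>{0..T}. \<forall>t\<in>{0..T}. \<forall>u\<in>U. \<forall>v\<in>V.
    \<bar>s - t\<bar> < d \<longrightarrow> \<bar>l i (s, u, v) - l i (t, u, v)\<bar> \<le> e)"

lemma time_step_exists:
  assumes "0 < e"
  obtains d where "time_step e d"
proof -
  have "\<exists>d>0. \<forall>x\<in>{0..T} \<times> U \<times> V. \<forall>y\<in>{0..T} \<times> U \<times> V. dist y x < d \<longrightarrow> dist (l i y) (l i x) < e" for i
    using compact_uniformly_continuous[OF l_cont[of i]] compact_U compact_V assms
    by (auto simp: uniformly_continuous_on_def compact_Times)
  then obtain d where d: "\<And>i. 0 < d i" "\<And>i x y. x \<in> {0..T} \<times> U \<times> V \<Longrightarrow> y \<in> {0..T} \<times> U \<times> V \<Longrightarrow>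
      dist y x < d i \<Longrightarrow> dist (l i y) (l i x) < e"
    by metis
  have "\<bar>l i (s, u, v) - l i (t, u, v)\<bar> \<le> e"
    if "s \<in> {0..T}" "t \<in> {0..T}" "u \<in> U" "v \<in> V" "\<bar>s - t\<bar> < Min (range d)" for i s t u v
  proof -
    have "dist (s, u, v) (t, u, v) < d i" using that by (simp add: dist_Pair_Pair dist_real_def)
    then have "dist (l i (s, u, v)) (l i (t, u, v)) < e" using that by (intro d(2)) auto
    then show ?thesis by (simp add: dist_real_def)
  qed
  then show ?thesis using d(1) by (intro that[of "Min (range d)"]) (simp add: time_step_def)
qed

lemma H_eq: "H s p = (INF u\<in>U. SUP v\<in>V. mean p s u v)"
  by (simp add: hamiltonian_def mean_def)

context
  fixes p :: "real^'i" and s :: real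
  assumes ps: "p \<in> prob_simplex" "s \<in> {0..T}"
begin

lemma SUP_mean_bounds:
  assumes "u \<in> U"
  shows "bdd_above ((\<lambda>v. mean p s u v) ` V)" "- C \<le> (SUP v\<in>V. mean p s u v)"
    "(SUP v\<in>V. mean p s u v) \<le> C"
proof -
  show b: "bdd_above ((\<lambda>v. mean p s u v) ` V)"
    using mean_abs_le[OF ps assms] by (intro bdd_aboveI2[where M=C]) fastforce
  obtain v where "v \<in> V" using V_ne by auto
  then show "- C \<le> (SUP v\<in>V. mean p s u v)"
    using mean_abs_le[OF ps assms, of v] by (intro cSUP_upper2[OF b]) auto
  show "(SUP v\<in>V. mean p s u v) \<le> C"
    using mean_abs_le[OF ps assms] V_ne by (intro cSUP_least) fastforce+
qed

lemma INF_mean_bounds: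
  assumes "v \<in> V"
  shows "bdd_below ((\<lambda>u. mean p s u v) ` U)" "(INF u\<in>U. mean p s u v) \<le> C"
proof -
  show b: "bdd_below ((\<lambda>u. mean p s u v) ` U)"
    using mean_abs_le[OF ps _ assms] by (intro bdd_belowI2[where m="- C"]) fastforce
  obtain u where "u \<in> U" using U_ne by auto
  then show "(INF u\<in>U. mean p s u v) \<le> C"
    using mean_abs_le[OF ps _ assms, of u] by (intro cINF_lower2[OF b]) auto
qed

lemma bdd_below_SUP_mean: "bdd_below ((\<lambda>u. SUP v\<in>V. mean p s u v) ` U)"
  using SUP_mean_bounds by (intro bdd_belowI2[where m="- C"])

lemma H_abs_le: "\<bar>H s p\<bar> \<le> C"
proof -
  obtain u where "u \<in> U" using U_ne by auto
  have "- C \<le> H s p" unfolding H_eq using SUP_mean_bounds U_ne by (intro cINF_greatest)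
  moreover have "H s p \<le> C" unfolding H_eq
    using SUP_mean_bounds \<open>u \<in> U\<close> by (intro cINF_lower2[OF bdd_below_SUP_mean])
  ultimately show ?thesis by auto
qed

lemma H_near_optimal_u:
  assumes "0 < e"
  shows "\<exists>u\<in>U. \<forall>v\<in>V. mean p s u v \<le> H s p + e"
proof -
  obtain u where u: "u \<in> U" "(SUP v\<in>V. mean p s u v) < H s p + e"
    using assms cINF_less_iff[OF U_ne bdd_below_SUP_mean, of "H s p + e"] unfolding H_eq by auto
  then show ?thesis
    by (meson cSUP_upper SUP_mean_bounds(1) less_imp_le order_trans)
qed

text \<open>Isaacs' condition enters here: the max-min form of the Hamiltonian gives the uninformed
  player an action that is good against every \<open>u\<close> simultaneously.\<close>

lemma H_near_optimal_v:
  assumes "isaacs_condition T U V l" "0 < e"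
  shows "\<exists>v\<in>V. \<forall>u\<in>U. H s p - e \<le> mean p s u v"
proof -
  have eq: "H s p = (SUP v\<in>V. INF u\<in>U. mean p s u v)"
    using assms(1) ps by (auto simp: isaacs_condition_def hamiltonian_def mean_def)
  have "bdd_above ((\<lambda>v. INF u\<in>U. mean p s u v) ` V)"
    using INF_mean_bounds by (intro bdd_aboveI2[where M=C])
  then obtain v where "v \<in> V" "H s p - e < (INF u\<in>U. mean p s u v)"
    using assms less_cSUP_iff[OF V_ne, of "\<lambda>v. INF u\<in>U. mean p s u v" "H s p - e"]
    unfolding eq[symmetric] by auto
  moreover have "(INF u\<in>U. mean p s u v) \<le> mean p s u v" if "u \<in> U" for u
    by (rule cINF_lower[OF INF_mean_bounds(1)[OF \<open>v \<in> V\<close>] that])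
  ultimately show ?thesis by (meson less_imp_le order_trans)
qed

end

text \<open>A uniform inequality between averaged payoffs passes through the inf-sup. Regularity of
  the Hamiltonian in belief and in time both follow from it.\<close>

lemma H_le_add:
  assumes "p \<in> prob_simplex" "q \<in> prob_simplex" "s \<in> {0..T}" "t \<in> {0..T}"
    "\<And>u v. u \<in> U \<Longrightarrow> v \<in> V \<Longrightarrow> mean p s u v \<le> mean q t u v + e"
  shows "H s p \<le> H t q + e"
proof (rule field_le_epsilon)
  fix e' :: real assume "0 < e'"
  then obtain u where u: "u \<in> U" "\<And>v. v \<in> V \<Longrightarrow> mean q t u v \<le> H t q + e'"
    using H_near_optimal_u[OF assms(2,4)] by blast
  have "H s p \<le> (SUP v\<in>V. mean p s u v)"
    unfolding H_eq by (rule cINF_lower[OF bdd_below_SUP_mean[OF assms(1,3)] u(1)])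
  also have "\<dots> \<le> H t q + e + e'"
    using u assms(5)[OF u(1)] V_ne by (intro cSUP_least) fastforce+
  finally show "H s p \<le> H t q + e + e'" .
qed

lemma H_Lipschitz:
  assumes "p \<in> prob_simplex" "q \<in> prob_simplex" "s \<in> {0..T}"
  shows "\<bar>H s p - H s q\<bar> \<le> Lip * norm (p - q)"
proof -
  have "H s p \<le> H s q + Lip * norm (p - q)"
    using mean_diff_le[OF assms(3), of _ _ p q] by (intro H_le_add assms) fastforce
  moreover have "H s q \<le> H s p + Lip * norm (p - q)"
    using mean_diff_le[OF assms(3), of _ _ p q] by (intro H_le_add assms) fastforce
  ultimately show ?thesis by auto
qed

lemma time_step_mean:
  assumes "time_step e d" "p \<in> prob_simplex" "s \<in> {0..T}" "t \<in> {0..T}" "\<bar>s - t\<bar> < d" "u \<in> U" "v \<in> V"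
  shows "\<bar>mean p s u v - mean p t u v\<bar> \<le> e"
  unfolding mean_def by (rule weighted_diff_le) (use assms in \<open>auto simp: time_step_def\<close>)

lemma time_step_H:
  assumes "time_step e d" "p \<in> prob_simplex" "s \<in> {0..T}" "t \<in> {0..T}" "\<bar>s - t\<bar> < d"
  shows "\<bar>H s p - H t p\<bar> \<le> e"
proof -
  have "H s p \<le> H t p + e" using time_step_mean[OF assms] by (intro H_le_add assms) fastforce
  moreover have "H t p \<le> H s p + e" using time_step_mean[OF assms] by (intro H_le_add assms) fastforce
  ultimately show ?thesis by auto
qed

lemma H_continuous: "continuous_on ({0..T} \<times> prob_simplex) (\<lambda>(s, p). H s p)"
  unfolding continuous_on_iff
proof (safe, simp only: split_beta fst_conv snd_conv)
  fix s and p :: "real^'i" and e :: real assume sp: "s \<in> {0..T}" "p \<in> prob_simplex" and "0 < e"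
  obtain d where d: "time_step (e / 3) d" using time_step_exists[of "e / 3"] \<open>0 < e\<close> by auto
  then have d0: "0 < d" by (simp add: time_step_def)
  \<comment> \<open>Time and belief each account for at most \<open>e / 3\<close>;
    \<open>Lip + 1\<close> replaces \<open>Lip\<close> to avoid a division by zero.\<close>
  define d' where "d' = min d (e / (3 * (Lip + 1)))"
  show "\<exists>d>0. \<forall>x\<in>{0..T} \<times> prob_simplex. dist x (s, p) < d \<longrightarrow> dist (H (fst x) (snd x)) (H s p) < e"
  proof (intro exI[of _ d'] conjI ballI impI)
    show "0 < d'" using d0 \<open>0 < e\<close> Lip_nonneg by (simp add: d'_def)
    fix x :: "real \<times> (real^'i)" assume x: "x \<in> {0..T} \<times> prob_simplex" "dist x (s, p) < d'"
    have 1: "\<bar>fst x - s\<bar> < d'" "norm (snd x - p) < d'"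
      using x(2) dist_fst_le[of x "(s, p)"] dist_snd_le[of x "(s, p)"] by (auto simp: dist_norm)
    have "\<bar>H (fst x) (snd x) - H s (snd x)\<bar> \<le> e / 3"
      using 1 x(1) sp by (intro time_step_H[OF d]) (auto simp: d'_def)
    moreover have "\<bar>H s (snd x) - H s p\<bar> \<le> Lip * norm (snd x - p)"
      using x(1) sp by (intro H_Lipschitz) auto
    moreover have "Lip * norm (snd x - p) \<le> (Lip + 1) * (e / (3 * (Lip + 1)))"
      using 1(2) Lip_nonneg by (intro mult_mono) (auto simp: d'_def)
    moreover have "(Lip + 1) * (e / (3 * (Lip + 1))) = e / 3"
    proof -
      have "c * (e / (3 * c)) = e / 3" if "c \<noteq> 0" for c :: real using that by simp
      then show ?thesis using Lip_nonneg by (metis add_nonneg_pos less_numeral_extra(1,3))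
    qed
    ultimately show "dist (H (fst x) (snd x)) (H s p) < e"
      using \<open>0 < e\<close> unfolding dist_real_def by linarith
  qed
qed

section \<open>Measurability and integrability along paths and controls\<close>

lemma H_path_measurable:
  assumes "w \<in> borel_measurable (lebesgue_on {a..b})" "\<And>s. s \<in> {a..b} \<Longrightarrow> w s \<in> prob_simplex" "0 \<le> a" "b \<le> T"
  shows "(\<lambda>s. H s (w s)) \<in> borel_measurable (lebesgue_on {a..b})"
proof -
  have "(\<lambda>s. s) \<in> borel_measurable (lebesgue_on {a..b})"
    by (intro measurable_restrict_space1 measurable_completion) simp
  then have "(\<lambda>s. (s, w s)) \<in> borel_measurable (lebesgue_on {a..b})"
    using assms(1) by (intro borel_measurable_Pair)
  from measurable_continuous_on_closed[OF _ H_continuous this] show ?thesis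
    using assms(2-4) by (auto simp: closed_Times closed_prob_simplex)
qed

lemma H_path_integrable:
  assumes "w \<in> borel_measurable (lebesgue_on {a..b})" "\<And>s. s \<in> {a..b} \<Longrightarrow> w s \<in> prob_simplex" "0 \<le> a" "b \<le> T"
  shows "integrable (lebesgue_on {a..b}) (\<lambda>s. H s (w s))"
  by (rule integrable_interval[where C=C])
    (use H_path_measurable[OF assms] H_abs_le assms(2-4) in auto)

lemma l_measurable:
  assumes "u \<in> borel_measurable (lebesgue_on {a..b})" "\<And>s. s \<in> {a..b} \<Longrightarrow> u s \<in> U"
    "v \<in> borel_measurable (lebesgue_on {a..b})" "\<And>s. s \<in> {a..b} \<Longrightarrow> v s \<in> V" "0 \<le> a" "b \<le> T"
  shows "(\<lambda>s. l i (s, u s, v s)) \<in> borel_measurable (lebesgue_on {a..b})"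
proof -
  have "(\<lambda>s. s) \<in> borel_measurable (lebesgue_on {a..b})"
    by (intro measurable_restrict_space1 measurable_completion) simp
  then have "(\<lambda>s. (s, u s, v s)) \<in> borel_measurable (lebesgue_on {a..b})"
    using assms by (intro borel_measurable_Pair)
  moreover have "closed ({0..T} \<times> U \<times> V)"
    using compact_U compact_V by (intro closed_Times compact_imp_closed) auto
  ultimately show ?thesis
    using measurable_continuous_on_closed[OF _ l_cont[of i], of "\<lambda>s. (s, u s, v s)"] assms by auto
qed

lemma l_integrable:
  assumes "u \<in> borel_measurable (lebesgue_on {a..b})" "\<And>s. s \<in> {a..b} \<Longrightarrow> u s \<in> U"
    "v \<in> borel_measurable (lebesgue_on {a..b})" "\<And>s. s \<in> {a..b} \<Longrightarrow> v s \<in> V" "0 \<le> a" "b \<le> T"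
  shows "integrable (lebesgue_on {a..b}) (\<lambda>s. l i (s, u s, v s))"
  by (rule integrable_interval[where C=C]) (use l_measurable[OF assms] l_bound assms in auto)

end

section \<open>Paths\<close>

text \<open>Time is rounded up to the next multiple of \<open>1 / (n + 1)\<close> strictly above it.
  Composing with the rounding gives functions with countably many pieces, and right continuity makes
  them converge.\<close>

lemma right_continuous_borel_measurable:
  fixes w :: "real \<Rightarrow> 'a::metric_space"
  assumes "\<And>t. (w \<longlongrightarrow> w t) (at_right t)"
  shows "w \<in> borel_measurable borel"
proof -
  define r where "r n s = (of_int \<lfloor>real (Suc n) * s\<rfloor> + 1) / real (Suc n)" for n s
  have r_gt: "s < r n s" for n s
    unfolding r_def by (simp add: pos_less_divide_eq mult.commute del: of_nat_Suc)
  have r_le: "r n s \<le> s + 1 / real (Suc n)" for n s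
    unfolding r_def by (simp add: field_simps del: of_nat_Suc)
  have r_lim: "(\<lambda>n. r n s) \<longlonglongrightarrow> s" for s
  proof (rule tendsto_sandwich[of "\<lambda>_. s" _ _ "\<lambda>n. s + 1 / real (Suc n)"])
    show "(\<lambda>n. s + 1 / real (Suc n)) \<longlonglongrightarrow> s"
      using tendsto_add[OF tendsto_const LIMSEQ_inverse_real_of_nat, of s] by (simp add: inverse_eq_divide)
  qed (use less_imp_le[OF r_gt] r_le in \<open>auto simp del: of_nat_Suc\<close>)
  have "filterlim (\<lambda>n. r n s) (at_right s) sequentially" for s
    unfolding filterlim_at using less_imp_neq[OF r_gt, symmetric] r_gt r_lim by auto
  then have "(\<lambda>n. w (r n s)) \<longlonglongrightarrow> w s" for s
    by (rule filterlim_compose[OF assms])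
  moreover have "(\<lambda>s. w (r n s)) \<in> borel_measurable borel" for n
  proof -
    have "(\<lambda>s::real. \<lfloor>real (Suc n) * s\<rfloor>) \<in> borel \<rightarrow>\<^sub>M count_space UNIV" by measurable
    then show ?thesis unfolding r_def by (rule measurable_compose) simp
  qed
  ultimately show ?thesis by (rule borel_measurable_LIMSEQ_metric[rotated])
qed

lemma paths_measurable:
  assumes "w \<in> paths T t0"
  shows "w \<in> borel_measurable (lebesgue_on A)"
  by (intro measurable_restrict_space1 measurable_completion)
    (use assms right_continuous_borel_measurable[of w] in \<open>auto simp: paths_def cadlag_def\<close>)

lemma paths_simplex: "w \<in> paths T t0 \<Longrightarrow> w s \<in> prob_simplex"
  by (auto simp: paths_def)

lemma space_path_space [simp]: "space (path_space T t0) = paths T t0"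
  unfolding path_space_def by (rule space_measure_of) auto

lemma space_path_filtration [simp]: "space (path_filtration T t0 t) = paths T t0"
  unfolding path_filtration_def by (rule space_measure_of) auto

lemma path_filtration_eval: "s \<le> t \<Longrightarrow> (\<lambda>w. w s) \<in> path_filtration T t0 t \<rightarrow>\<^sub>M borel"
proof (rule measurableI)
  fix A :: "(real^'a) set" assume "s \<le> t" "A \<in> sets borel"
  then show "(\<lambda>w. w s) -` A \<inter> space (path_filtration T t0 t) \<in> sets (path_filtration T t0 t)"
    unfolding space_path_filtration unfolding path_filtration_def
    by (subst sets_measure_of) (auto intro!: sigma_sets.Basic exI[of _ s] exI[of _ A])
qed auto

lemma sets_path_filtration_subset: "sets (path_filtration T t0 t) \<subseteq> sets (path_space T t0)"
  unfolding path_filtration_def path_space_def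
  by (subst (1 2) sets_measure_of) (auto intro!: sigma_sets_mono')

lemma subalgebra_path_filtration:
  assumes "sets P = sets (path_space T t0)"
  shows "subalgebra P (path_filtration T t0 t)"
  using sets_path_filtration_subset sets_eq_imp_space_eq[OF assms] assms by (auto simp: subalgebra_def)

lemma path_space_eval [measurable]: "(\<lambda>w. w s) \<in> path_space T t0 \<rightarrow>\<^sub>M borel"
  using path_filtration_eval[of s s T t0] sets_path_filtration_subset[of T t0 s]
  by (auto simp: measurable_def)

context payoff_data
begin

definition hint :: "real \<Rightarrow> (real \<Rightarrow> real^'i) \<Rightarrow> real" where
  "hint a w = LI a T (\<lambda>s. H s (w s))"

text \<open>On each cell the belief is frozen at its value at the right end. Right ends suit
  right-continuous paths, and they match an informed player who draws the whole path beforehand and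
  shows on a cell the belief at its end.\<close>

definition hsum :: "real \<Rightarrow> nat \<Rightarrow> (real \<Rightarrow> real^'i) \<Rightarrow> real" where
  "hsum a N w = (\<Sum>k<N. LI (grid a T N k) (grid a T N (Suc k)) (\<lambda>s. H s (w (grid a T N (Suc k)))))"

lemma hint_abs_le:
  assumes "w \<in> paths T t0" "0 \<le> a" "a \<le> T"
  shows "\<bar>hint a w\<bar> \<le> C * (T - a)"
  unfolding hint_def
  by (rule LI_abs_le) (use assms in \<open>auto intro!: H_abs_le simp: paths_simplex[OF assms(1)]\<close>)

lemma hsum_abs_le:
  assumes "w \<in> paths T t0" "0 \<le> a" "a \<le> T" "0 < N"
  shows "\<bar>hsum a N w\<bar> \<le> C * (T - a)"
proof -
  have "\<bar>hsum a N w\<bar> \<le> (\<Sum>k<N. C * (grid a T N (Suc k) - grid a T N k))"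
    unfolding hsum_def
  proof (rule order_trans[OF sum_abs], rule sum_mono)
    fix k assume k: "k \<in> {..<N}"
    show "\<bar>LI (grid a T N k) (grid a T N (Suc k)) (\<lambda>s. H s (w (grid a T N (Suc k))))\<bar>
        \<le> C * (grid a T N (Suc k) - grid a T N k)"
      using k assms grid_bounds[of a T N k] grid_bounds[of a T N "Suc k"] grid_mono[of a T k "Suc k"]
      by (intro LI_abs_le H_abs_le) (auto simp: paths_simplex[OF assms(1)])
  qed
  also have "\<dots> = C * (T - a)"
    using assms(4) by (simp add: sum_distrib_left[symmetric] sum_lessThan_telescope)
  finally show ?thesis .
qed

lemma hsum_eq:
  assumes "w \<in> paths T t0" "0 \<le> a" "a < T" "0 < N"
  shows "hsum a N w = LI a T (\<lambda>s. H s (w (grid a T N (Suc (cell a T N s)))))"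
    "integrable (lebesgue_on {a..T}) (\<lambda>s. H s (w (grid a T N (Suc (cell a T N s)))))"
proof -
  have m: "(\<lambda>s. w (grid a T N (Suc (cell a T N s)))) \<in> borel_measurable (lebesgue_on {a..T})"
    by (rule measurable_compose[OF cell_measurable]) simp
  show i: "integrable (lebesgue_on {a..T}) (\<lambda>s. H s (w (grid a T N (Suc (cell a T N s)))))"
    by (rule H_path_integrable[OF m]) (use assms in \<open>auto simp: paths_simplex\<close>)
  have "LI a T (\<lambda>s. H s (w (grid a T N (Suc (cell a T N s))))) =
    (\<Sum>k<N. LI (grid a T N k) (grid a T N (Suc k)) (\<lambda>s. H s (w (grid a T N (Suc (cell a T N s))))))"
    using LI_grid[OF i, of N N] assms by auto
  also have "\<dots> = hsum a N w"
    unfolding hsum_def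
  proof (rule sum.cong[OF refl], rule LI_cong_AE)
    fix k assume k: "k \<in> {..<N}"
    note b = k assms grid_bounds[of a T N k] grid_bounds[of a T N "Suc k"] grid_mono[of a T k "Suc k"]
    show "(\<lambda>s. H s (w (grid a T N (Suc (cell a T N s))))) \<in> borel_measurable (lebesgue_on {grid a T N k..grid a T N (Suc k)})"
      by (rule measurable_subinterval[of _ a T]) (use i b in auto)
    show "(\<lambda>s. H s (w (grid a T N (Suc k)))) \<in> borel_measurable (lebesgue_on {grid a T N k..grid a T N (Suc k)})"
      by (rule H_path_measurable) (use b in \<open>auto simp: paths_simplex\<close>)
    show "AE s in lebesgue_on {grid a T N k..grid a T N (Suc k)}.
        H s (w (grid a T N (Suc (cell a T N s)))) = H s (w (grid a T N (Suc k)))"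
      using AE_interval_neq[of "grid a T N (Suc k)" "grid a T N k" "grid a T N (Suc k)"] unfolding AE_interval_iff
    proof eventually_elim
      case (elim s)
      show ?case
      proof
        assume "s \<in> {grid a T N k..grid a T N (Suc k)}"
        with elim have "grid a T N k \<le> s" "s < grid a T N (Suc k)" by auto
        then have "cell a T N s = k" using k assms by (intro cell_eq) auto
        then show "H s (w (grid a T N (Suc (cell a T N s)))) = H s (w (grid a T N (Suc k)))" by simp
      qed
    qed
  qed
  finally show "hsum a N w = LI a T (\<lambda>s. H s (w (grid a T N (Suc (cell a T N s)))))" by simp
qed

text \<open>For \<open>s < T\<close> the right end of the cell of \<open>s\<close> tends to
  \<open>s\<close> strictly from above, so right continuity gives pointwise convergence of the
  beliefs. The point \<open>T\<close> is null, and the bound \<open>C\<close> dominates.\<close>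

lemma hsum_tendsto:
  assumes w: "w \<in> paths T t0" and a: "0 \<le> a" "a < T"
  shows "(\<lambda>N. hsum a (Suc N) w) \<longlonglongrightarrow> hint a w"
proof -
  define g where "g N s = grid a T (Suc N) (Suc (cell a T (Suc N) s))" for N s
  have lim: "(\<lambda>N. w (g N s)) \<longlonglongrightarrow> w s" if s: "s \<in> {a..<T}" for s
  proof -
    have 1: "s < g N s" "g N s \<le> s + (T - a) / real (Suc N)" for N
      using cell_bounds[of a T "Suc N" s] s a  unfolding g_def grid_Suc by auto
    have "(\<lambda>N. (T - a) / real (Suc N)) \<longlonglongrightarrow> 0"
      using tendsto_mult[OF tendsto_const LIMSEQ_inverse_real_of_nat, of "T - a"] by (simp add: divide_inverse)
    then have "(\<lambda>N. s + (T - a) / real (Suc N)) \<longlonglongrightarrow> s"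
      using tendsto_add[OF tendsto_const, of "\<lambda>N. (T - a) / real (Suc N)" 0 _ s] by simp
    then have "(\<lambda>N. g N s) \<longlonglongrightarrow> s"
      by (rule tendsto_sandwich[of "\<lambda>_. s", rotated 3]) (use less_imp_le[OF 1(1)] 1(2) in \<open>auto simp del: of_nat_Suc\<close>)
    then have "filterlim (\<lambda>N. g N s) (at_right s) sequentially"
      unfolding filterlim_at using less_imp_neq[OF 1(1), symmetric] 1(1) by auto
    moreover have "(w \<longlongrightarrow> w s) (at_right s)" using w by (auto simp: paths_def cadlag_def)
    ultimately show ?thesis by (rule filterlim_compose[rotated])
  qed
  have "(\<lambda>N. LI a T (\<lambda>s. H s (w (g N s)))) \<longlonglongrightarrow> hint a w"
    unfolding hint_def
  proof (rule integral_dominated_convergence[where w="\<lambda>_. C"])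
    show "(\<lambda>s. H s (w s)) \<in> borel_measurable (lebesgue_on {a..T})"
      by (rule H_path_measurable) (use w a paths_measurable in \<open>auto simp: paths_simplex\<close>)
    show "(\<lambda>s. H s (w (g N s))) \<in> borel_measurable (lebesgue_on {a..T})" for N
      using hsum_eq(2)[OF w a, of "Suc N"] by (auto simp: g_def)
    show "integrable (lebesgue_on {a..T}) (\<lambda>_. C)"
      using integrable_interval[of "\<lambda>_. C" a T "\<bar>C\<bar>"] by auto
    show "AE s in lebesgue_on {a..T}. norm (H s (w (g N s))) \<le> C" for N
      by (rule AE_I2) (use w a in \<open>auto intro!: H_abs_le simp: paths_simplex\<close>)
    show "AE s in lebesgue_on {a..T}. (\<lambda>N. H s (w (g N s))) \<longlonglongrightarrow> H s (w s)"
      using AE_interval_neq[of T a T] unfolding AE_interval_iff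
    proof eventually_elim
      case (elim s)
      show ?case
      proof
        assume s: "s \<in> {a..T}"
        with elim have "(\<lambda>N. w (g N s)) \<longlonglongrightarrow> w s" by (intro lim) auto
        moreover have "continuous_on prob_simplex (H s)"
          by (rule lipschitz_on_continuous_on[of Lip], rule lipschitz_onI)
            (use H_Lipschitz Lip_nonneg s a in \<open>auto simp: dist_real_def dist_norm\<close>)
        ultimately show "(\<lambda>N. H s (w (g N s))) \<longlonglongrightarrow> H s (w s)"
          using continuous_on_tendsto_compose[of prob_simplex "H s" "\<lambda>N. w (g N s)" "w s"] w
          by (auto simp: paths_simplex)
      qed
    qed
  qed
  then show ?thesis using hsum_eq(1)[OF w a] by (simp add: g_def)
qed

lemma hsum_measurable:
  assumes "0 \<le> a" "a \<le> T" "0 < N"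
  shows "hsum a N \<in> borel_measurable (path_space T t0)"
  unfolding hsum_def
proof (rule borel_measurable_sum)
  fix k assume k: "k \<in> {..<N}"
  let ?x = "grid a T N k" and ?y = "grid a T N (Suc k)"
  have b: "0 \<le> ?x" "?x \<le> ?y" "?y \<le> T"
    using k assms grid_bounds[of a T N k] grid_bounds[of a T N "Suc k"] grid_mono[of a T k "Suc k"] by auto
  have i: "integrable (lebesgue_on {?x..?y}) (\<lambda>s. H s p)" if "p \<in> prob_simplex" for p
    by (rule H_path_integrable) (use that b in auto)
  have "continuous_on prob_simplex (\<lambda>p. LI ?x ?y (\<lambda>s. H s p))"
  proof (rule lipschitz_on_continuous_on, rule lipschitz_onI)
    fix p q :: "real^'i" assume pq: "p \<in> prob_simplex" "q \<in> prob_simplex"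
    have "LI ?x ?y (\<lambda>s. H s p) - LI ?x ?y (\<lambda>s. H s q) = LI ?x ?y (\<lambda>s. H s p - H s q)"
      using i pq by simp
    also have "\<bar>\<dots>\<bar> \<le> Lip * norm (p - q) * (?y - ?x)"
      by (rule LI_abs_le) (use b pq in \<open>auto intro!: H_Lipschitz\<close>)
    finally show "dist (LI ?x ?y (\<lambda>s. H s p)) (LI ?x ?y (\<lambda>s. H s q)) \<le> (Lip * (?y - ?x)) * dist p q"
      by (simp add: dist_real_def dist_norm algebra_simps)
  qed (use Lip_nonneg b in auto)
  from measurable_continuous_on_closed[OF closed_prob_simplex this path_space_eval[of ?y T t0]]
  show "(\<lambda>w. LI ?x ?y (\<lambda>s. H s (w ?y))) \<in> borel_measurable (path_space T t0)"
    by (auto simp: paths_simplex)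
qed

text \<open>The path integral is a pointwise limit of functionals of finitely many coordinates of
  the path.\<close>

lemma hint_measurable:
  assumes "0 \<le> a" "a \<le> T"
  shows "hint a \<in> borel_measurable (path_space T t0)"
proof (cases "a < T")
  case True
  show ?thesis
    by (rule borel_measurable_LIMSEQ_metric[of "\<lambda>N. hsum a (Suc N)"])
      (use hsum_measurable[of a "Suc _" t0] hsum_tendsto[of _ t0 a] assms True in simp_all)
next
  case False
  then have "a = T" using assms by auto
  then have "hint a w = 0" if "w \<in> paths T t0" for w
    using hint_abs_le[OF that, of a] T_pos by auto
  then show ?thesis using measurable_cong[of "path_space T t0" "hint a" "\<lambda>_. 0"] by auto
qed

end

section \<open>Martingale measures\<close>

lemma borel_measurable_vec_nth:
  fixes f :: "'a \<Rightarrow> real^'i::finite"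
  assumes "f \<in> borel_measurable M"
  shows "(\<lambda>x. f x $ i) \<in> borel_measurable M"
  by (rule borel_measurable_continuous_on[OF _ assms]) (intro continuous_intros)

lemma paths_before: "w \<in> paths T t0 \<Longrightarrow> s < t0 \<Longrightarrow> r < t0 \<Longrightarrow> w s = w r"
  unfolding paths_def by blast

lemma paths_after: "w \<in> paths T t0 \<Longrightarrow> T \<le> s \<Longrightarrow> T \<le> r \<Longrightarrow> w s = w r"
  unfolding paths_def by blast

text \<open>Conditions at uncountably many times reduce to the two coordinates at
  \<open>t0 - 1\<close> and \<open>T\<close>, hence to a measurable event; \<open>t0 - 1\<close>
  stands for any time before \<open>t0\<close>.\<close>

lemma paths_terminal_iff:
  assumes "w \<in> paths T t0"
  shows "(\<forall>t<t0. w t = p0) \<and> (\<forall>t\<ge>T. w t \<in> range (\<lambda>i. axis i 1)) \<longleftrightarrow>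
    w (t0 - 1) = p0 \<and> w T \<in> range (\<lambda>i. axis i 1)"
proof -
  have "w t = w (t0 - 1)" if "t < t0" for t using paths_before[OF assms, of t "t0 - 1"] that by simp
  moreover have "w t = w T" if "T \<le> t" for t using paths_after[OF assms, of t T] that by simp
  ultimately show ?thesis by (metis diff_less_eq less_add_one order_refl)
qed

locale path_measure = prob_space P for P :: "(real \<Rightarrow> real^'i::finite) measure" +
  fixes T t0 :: real
  assumes sets_P: "sets P = sets (path_space T t0)"
begin

lemma space_P: "space P = paths T t0"
  using sets_eq_imp_space_eq[OF sets_P] by simp

lemma measurable_P: "f \<in> path_space T t0 \<rightarrow>\<^sub>M N \<Longrightarrow> f \<in> P \<rightarrow>\<^sub>M N"
  using measurable_cong_sets[OF sets_P refl, of N] by simp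

lemma eval_measurable [measurable]: "(\<lambda>w. w s) \<in> borel_measurable P"
  by (rule measurable_P) measurable

lemma coord_measurable [measurable]: "(\<lambda>w. w s $ i) \<in> borel_measurable P"
  by (rule borel_measurable_vec_nth) measurable

lemma integrable_bounded:
  fixes f :: "_ \<Rightarrow> real"
  assumes "f \<in> borel_measurable P" "\<And>w. w \<in> paths T t0 \<Longrightarrow> \<bar>f w\<bar> \<le> B"
  shows "integrable P f"
  by (rule integrable_const_bound[where B=B]) (use assms in \<open>auto intro!: AE_I2 simp: space_P\<close>)

lemma integrable_eval: "integrable P (\<lambda>w. w s)"
  by (rule integrable_const_bound[where B=1])
    (auto intro!: AE_I2 prob_simplex_norm simp: space_P paths_simplex)

lemma coord_bounds: "w \<in> paths T t0 \<Longrightarrow> 0 \<le> w s $ i" "w \<in> paths T t0 \<Longrightarrow> w s $ i \<le> 1"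
  by (auto intro!: prob_simplex_nonneg prob_simplex_le_1 simp: paths_simplex)

lemma integrable_coord: "integrable P (\<lambda>w. w s $ i)"
  using coord_bounds by (intro integrable_bounded[where B=1]) fastforce+

lemma coord_abs: "w \<in> paths T t0 \<Longrightarrow> \<bar>w s $ i\<bar> \<le> 1"
  using coord_bounds by fastforce

lemma sigma_finite_subalgebra: "sigma_finite_subalgebra P (path_filtration T t0 s)"
  by (intro finite_measure_subalgebra_is_sigma_finite finite_measure_subalgebra.intro
      finite_measure_subalgebra_axioms.intro)
    (auto intro: finite_measure_axioms subalgebra_path_filtration[OF sets_P])

lemma AE_path_cong: "(\<And>w. w \<in> paths T t0 \<Longrightarrow> A w \<longleftrightarrow> B w) \<Longrightarrow> (AE w in P. A w) \<longleftrightarrow> (AE w in P. B w)"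
  by (rule AE_cong) (simp add: space_P)

text \<open>Conditional expectations are replaced by integrals over events of the filtration. In
  this form the property is linear in the measure, so it survives mixtures, and it applies directly
  to events described by signals.\<close>

lemma martingale_measures_iff:
  "P \<in> martingale_measures T t0 p0 \<longleftrightarrow>
    (\<forall>s t i A. s \<le> t \<longrightarrow> A \<in> sets (path_filtration T t0 s) \<longrightarrow>
      (\<integral>w. indicator A w * w t $ i \<partial>P) = (\<integral>w. indicator A w * w s $ i \<partial>P)) \<and>
    (AE w in P. w (t0 - 1) = p0 \<and> w T \<in> range (\<lambda>i. axis i 1))"
  (is "_ \<longleftrightarrow> ?mart \<and> ?term")
proof -
  have 1: "?term \<longleftrightarrow> (AE w in P. (\<forall>t<t0. w t = p0) \<and> (\<forall>t\<ge>T. w t \<in> range (\<lambda>i. axis i 1)))"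
    by (rule AE_path_cong) (simp add: paths_terminal_iff)
  have 2: "(AE w in P. real_cond_exp P (path_filtration T t0 s) (\<lambda>w. w t $ i) w = w s $ i) \<longleftrightarrow>
     (\<forall>A\<in>sets (path_filtration T t0 s). (\<integral>w. indicator A w * w t $ i \<partial>P) = (\<integral>w. indicator A w * w s $ i \<partial>P))"
     (is "?ce \<longleftrightarrow> ?int") for s t i
  proof -
    interpret sigma_finite_subalgebra P "path_filtration T t0 s" by (rule sigma_finite_subalgebra)
    have m: "(\<lambda>w. w s $ i) \<in> borel_measurable (path_filtration T t0 s)"
      by (intro borel_measurable_vec_nth path_filtration_eval order_refl)
    show ?thesis
    proof
      assume ce: ?ce
      show ?int
      proof
        fix A :: "(real \<Rightarrow> real^'i) set" assume A: "A \<in> sets (path_filtration T t0 s)"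
        have A': "A \<in> sets P" using A subalg by (auto simp: subalgebra_def)
        have "(\<integral>w. indicator A w * w t $ i \<partial>P) = (\<integral>w. indicator A w * real_cond_exp P (path_filtration T t0 s) (\<lambda>w. w t $ i) w \<partial>P)"
          using real_cond_exp_intA[OF integrable_coord A] by (simp add: set_lebesgue_integral_def)
        also have "\<dots> = (\<integral>w. indicator A w * w s $ i \<partial>P)"
          by (rule integral_cong_AE) (use A' ce borel_measurable_cond_exp2 in \<open>auto intro!: borel_measurable_times\<close>)
        finally show "(\<integral>w. indicator A w * w t $ i \<partial>P) = (\<integral>w. indicator A w * w s $ i \<partial>P)" .
      qed
    next
      assume ?int
      then show ?ce
        by (intro real_cond_exp_charact integrable_coord m) (simp add: set_lebesgue_integral_def)
    qed
  qed
  have 3: "(\<lambda>w::real \<Rightarrow> real^'i. w s) \<in> borel_measurable (path_filtration T t0 s)" for s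
    by (rule path_filtration_eval) simp
  show ?thesis
    unfolding martingale_measures_def martingale_def mem_Collect_eq 2 1
    using prob_space_axioms sets_P 3 integrable_eval by meson
qed

end

lemma martingale_measures_path_measure:
  "P \<in> martingale_measures T t0 p0 \<Longrightarrow> path_measure P T t0"
  by (auto simp: martingale_measures_def path_measure_def path_measure_axioms_def)

lemma martingale_measures_indicator:
  assumes "P \<in> martingale_measures T t0 p0" "s \<le> t" "A \<in> sets (path_filtration T t0 s)"
  shows "(\<integral>w. indicator A w * w t $ i \<partial>P) = (\<integral>w. indicator A w * w s $ i \<partial>P)"
  using path_measure.martingale_measures_iff[OF martingale_measures_path_measure[OF assms(1)]] assms by blast

lemma martingale_measures_AE:
  assumes "P \<in> martingale_measures T t0 p0"
  shows "AE w in P. w (t0 - 1) = p0" "AE w in P. w T \<in> range (\<lambda>i. axis i 1)"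
  using path_measure.martingale_measures_iff[OF martingale_measures_path_measure[OF assms]] assms by auto

lemma martingale_measures_mean:
  assumes P: "P \<in> martingale_measures T t0 p0"
  shows "(\<integral>w. w t $ i \<partial>P) = p0 $ i"
proof -
  interpret path_measure P T t0 by (rule martingale_measures_path_measure[OF P])
  \<comment> \<open>A time below \<open>t\<close> that also precedes \<open>t0\<close>, where the
    path almost surely sits at \<open>p0\<close>.\<close>
  define s where "s = min t (t0 - 1)"
  have "paths T t0 \<in> sets (path_filtration T t0 s)"
    using sets.top[of "path_filtration T t0 s"] by simp
  from martingale_measures_indicator[OF P _ this, of t i]
  have "(\<integral>w. w t $ i \<partial>P) = (\<integral>w. w s $ i \<partial>P)"
    by (simp add: s_def space_P[symmetric] cong: Bochner_Integration.integral_cong)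
  also have "\<dots> = (\<integral>w. p0 $ i \<partial>P)"
  proof (rule integral_cong_AE)
    show "AE w in P. w s $ i = p0 $ i"
      using martingale_measures_AE(1)[OF P] AE_space
    proof eventually_elim
      case (elim w)
      then have "w s = w (t0 - 1)" by (intro paths_before[of w T t0]) (auto simp: space_P s_def)
      with elim show ?case by simp
    qed
  qed auto
  finally show ?thesis by (simp add: prob_space)
qed

section \<open>Replacing the past of a path by a constant\<close>

lemma cadlag_const_before:
  assumes "cadlag w"
  shows "cadlag (\<lambda>s. if s < t then p else w s)"
  unfolding cadlag_def
proof
  fix s
  let ?m = "\<lambda>s. if s < t then p else w s"
  consider "s < t" | "s = t" | "t < s" by linarith
  then show "(?m \<longlongrightarrow> ?m s) (at_right s) \<and> (\<exists>x. (?m \<longlongrightarrow> x) (at_left s))"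
  proof cases
    case 1
    then have "\<forall>\<^sub>F x in nhds s. x < t" using eventually_nhds_in_open[of "{..<t}" s] by auto
    then have "\<forall>\<^sub>F x in nhds s. ?m x = p" by eventually_elim auto
    then have *: "(?m \<longlongrightarrow> p) (nhds s)" by (rule tendsto_eventually)
    show ?thesis using 1
      by (auto intro!: exI[of _ p] intro: tendsto_mono[OF _ *] simp: at_within_def)
  next
    case 2
    have "\<forall>\<^sub>F x in at_right s. w x = ?m x" using eventually_at_right_less[of s] by eventually_elim (use 2 in auto)
    moreover have "(w \<longlongrightarrow> w s) (at_right s)" using assms by (auto simp: cadlag_def)
    ultimately have "(?m \<longlongrightarrow> w s) (at_right s)" by (rule Lim_transform_eventually[rotated])
    moreover have "\<forall>\<^sub>F x in at_left s. ?m x = p"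
      using eventually_at_left_field[of "\<lambda>x. ?m x = p" s] 2 by (auto intro!: exI[of _ "s - 1"])
    then have "(?m \<longlongrightarrow> p) (at_left s)" by (rule tendsto_eventually)
    ultimately show ?thesis using 2 by auto
  next
    case 3
    then have "\<forall>\<^sub>F x in nhds s. t < x" using eventually_nhds_in_open[of "{t<..}" s] by auto
    then have "\<forall>\<^sub>F x in nhds s. w x = ?m x" by eventually_elim auto
    then have e: "\<forall>\<^sub>F x in at s within A. w x = ?m x" for A
      by (rule filter_leD[OF at_within_le_nhds])
    obtain x where "(w \<longlongrightarrow> x) (at_left s)" "(w \<longlongrightarrow> w s) (at_right s)"
      using assms by (auto simp: cadlag_def)
    then have "(?m \<longlongrightarrow> x) (at_left s)" "(?m \<longlongrightarrow> w s) (at_right s)"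
      by (auto intro: Lim_transform_eventually[OF _ e])
    then show ?thesis using 3 by auto
  qed
qed

lemma paths_const_before:
  assumes "w \<in> paths T t'" "t \<le> t'" "t' \<le> T" "p \<in> prob_simplex"
  shows "(\<lambda>s. if s < t then p else w s) \<in> paths T t"
  unfolding paths_def
proof (intro CollectI conjI allI impI)
  show "cadlag (\<lambda>s. if s < t then p else w s)"
    using assms by (intro cadlag_const_before) (simp add: paths_def)
  show "range (\<lambda>s. if s < t then p else w s) \<subseteq> prob_simplex"
    using assms(4) paths_simplex[OF assms(1)] by auto
  show "(if s < t then p else w s) = (if r < t then p else w r)" if "T \<le> s" "T \<le> r" for s r
    using paths_after[OF assms(1) that] assms(2,3) that by auto
qed auto

lemma measurable_const_before:
  fixes p :: "real^'i::finite"
  assumes "t \<le> t'" "t' \<le> T" "p \<in> prob_simplex"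
  shows "(\<lambda>w s. if s < t then p else w s) \<in> path_filtration T t' r \<rightarrow>\<^sub>M path_filtration T t r"
    (is "?m \<in> _")
    "(\<lambda>w s. if s < t then p else w s) \<in> path_space T t' \<rightarrow>\<^sub>M path_space T t"
proof -
  have m: "?m w \<in> paths T t" if "w \<in> paths T t'" for w :: "real \<Rightarrow> real^'i"
    using paths_const_before[OF that assms] .
  show "?m \<in> path_filtration T t' r \<rightarrow>\<^sub>M path_filtration T t r"
    unfolding path_filtration_def[of T t]
  proof (rule measurable_measure_of)
    fix Y :: "(real \<Rightarrow> real^'i) set" assume "Y \<in> {{w \<in> paths T t. w s \<in> A} |s A. s \<le> r \<and> A \<in> sets borel}"
    then obtain s A where Y: "Y = {w \<in> paths T t. w s \<in> A}" "s \<le> r" "A \<in> sets borel" by auto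
    have [measurable]: "(\<lambda>w. w s) \<in> path_filtration T t' r \<rightarrow>\<^sub>M borel" by (rule path_filtration_eval[OF Y(2)])
    have "?m -` Y \<inter> space (path_filtration T t' r) = {w \<in> space (path_filtration T t' r). (if s < t then p else w s) \<in> A}"
      using m Y by auto
    also have "\<dots> \<in> sets (path_filtration T t' r)" using Y(3) by measurable
    finally show "?m -` Y \<inter> space (path_filtration T t' r) \<in> sets (path_filtration T t' r)" .
  qed (use m in auto)
  show "?m \<in> path_space T t' \<rightarrow>\<^sub>M path_space T t"
    unfolding path_space_def[of T t]
  proof (rule measurable_measure_of)
    fix Y :: "(real \<Rightarrow> real^'i) set" assume "Y \<in> {{w \<in> paths T t. w s \<in> A} |s A. A \<in> sets borel}"
    then obtain s A where Y: "Y = {w \<in> paths T t. w s \<in> A}" "A \<in> sets borel" by auto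
    have "?m -` Y \<inter> space (path_space T t') = {w \<in> space (path_space T t'). (if s < t then p else w s) \<in> A}"
      using m Y by auto
    also have "\<dots> \<in> sets (path_space T t')" using Y(2) by measurable
    finally show "?m -` Y \<inter> space (path_space T t') \<in> sets (path_space T t')" .
  qed (use m in auto)
qed

text \<open>All modified paths coincide before \<open>t\<close>, so an event known at
  \<open>s < t\<close> cannot separate them. Formally, the modification is measurable from the
  trivial sigma-field, in which a preimage is empty or everything.\<close>

lemma path_filtration_before:
  fixes p :: "real^'i::finite"
  assumes "A \<in> sets (path_filtration T t s)" "s < t" "t \<le> t'" "t' \<le> T" "p \<in> prob_simplex"
  shows "(\<forall>w\<in>paths T t'. (\<lambda>s. if s < t then p else w s) \<in> A) \<or>
    (\<forall>w\<in>paths T t'. (\<lambda>s. if s < t then p else w s) \<notin> A)"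
proof -
  let ?m = "\<lambda>w s. if s < t then p else w s"
  have m: "?m w \<in> paths T t" if "w \<in> paths T t'" for w :: "real \<Rightarrow> real^'i"
    using paths_const_before[OF that assms(3-5)] .
  have "?m \<in> sigma (paths T t') {} \<rightarrow>\<^sub>M path_filtration T t s"
    unfolding path_filtration_def
  proof (rule measurable_measure_of)
    fix Y :: "(real \<Rightarrow> real^'i) set" assume "Y \<in> {{w \<in> paths T t. w r \<in> A} |r A. r \<le> s \<and> A \<in> sets borel}"
    then obtain r A where Y: "Y = {w \<in> paths T t. w r \<in> A}" "r \<le> s" "A \<in> sets borel" by auto
    have "?m -` Y \<inter> paths T t' = (if p \<in> A then paths T t' else {})"
      using m Y assms(2) by auto
    then show "?m -` Y \<inter> space (sigma (paths T t') {}) \<in> sets (sigma (paths T t') {})"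
      by (auto simp: space_measure_of_conv sigma_sets_top sigma_sets.Empty)
  qed (use m in \<open>auto simp: space_measure_of_conv\<close>)
  from measurable_sets[OF this assms(1)] have "?m -` A \<inter> paths T t' \<in> {{}, paths T t'}"
    by (simp add: space_measure_of_conv sigma_sets_empty_eq)
  then show ?thesis by auto
qed

text \<open>Splitting of beliefs: an index \<open>j\<close> is drawn by \<pi>, the path jumps at
  \<open>t\<close> from \<open>p\<close> to \<open>q j\<close>, stays there until \<open>t'\<close>
  and then follows \<open>K j\<close>. Between times after \<open>t\<close> the martingale property
  is that of each \<open>K j\<close>; before \<open>t\<close> the path is constant. Across
  \<open>t\<close>, an earlier event is trivial on the modified paths, and the jump has mean zero
  because \<open>p\<close> is the barycentre of the \<open>q j\<close>.\<close>

lemma martingale_measures_mixture: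
  fixes \<pi> :: "'j::finite pmf" and q :: "'j \<Rightarrow> real^'i::finite"
  assumes t: "t \<le> t'" "t' \<le> T" and K: "\<And>j. K j \<in> martingale_measures T t' (q j)"
    and p: "p \<in> prob_simplex" "\<And>i. p $ i = (\<Sum>j\<in>UNIV. pmf \<pi> j * q j $ i)"
  obtains P where "P \<in> martingale_measures T t p"
    "\<And>f B. f \<in> borel_measurable (path_space T t) \<Longrightarrow> (\<And>w. w \<in> paths T t \<Longrightarrow> \<bar>f w\<bar> \<le> B) \<Longrightarrow>
      (\<integral>w. f w \<partial>P) = (\<Sum>j\<in>UNIV. pmf \<pi> j * (\<integral>w. f (\<lambda>s. if s < t then p else w s) \<partial>K j) :: real)"
proof -
  define m :: "(real \<Rightarrow> real^'i) \<Rightarrow> real \<Rightarrow> real^'i" where "m = (\<lambda>w s. if s < t then p else w s)"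
  have K': "path_measure (K j) T t'" for j by (rule martingale_measures_path_measure[OF K])
  note pK = K'[THEN path_measure.axioms(1)]
  have spK: "space (K j) = paths T t'" for j by (rule path_measure.space_P[OF K'])
  have m_meas: "m \<in> path_space T t' \<rightarrow>\<^sub>M path_space T t"
    unfolding m_def by (rule measurable_const_before(2)[OF t p(1)])
  have mK: "m \<in> K j \<rightarrow>\<^sub>M path_space T t" for j
    by (rule path_measure.measurable_P[OF K' m_meas])
  have m_paths: "m w \<in> paths T t" if "w \<in> paths T t'" for w
    using measurable_space[OF m_meas] that by simp
  define N where "N j = distr (K j) (path_space T t) m" for j
  have pN: "prob_space (N j)" for j
    unfolding N_def by (rule prob_space.prob_space_distr[OF pK mK])
  have N_meas: "N \<in> measure_pmf \<pi> \<rightarrow>\<^sub>M subprob_algebra (path_space T t)"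
    using pN by (auto simp: measurable_def space_subprob_algebra N_def intro: prob_space_imp_subprob_space)
  define P where "P = measure_pmf \<pi> \<bind> N"
  have sets_P: "sets P = sets (path_space T t)"
    unfolding P_def by (rule sets_bind) (auto simp: N_def)
  have prob_P: "prob_space P"
    unfolding P_def using measure_pmf.prob_space_bind[OF _ N_meas] pN by auto
  interpret P: path_measure P T t
    using prob_P sets_P by (simp add: path_measure_def path_measure_axioms_def)
  have int: "(\<integral>w. f w \<partial>P) = (\<Sum>j\<in>UNIV. pmf \<pi> j * (\<integral>w. f (m w) \<partial>K j))"
    if f: "f \<in> borel_measurable (path_space T t)" "\<And>w. w \<in> paths T t \<Longrightarrow> \<bar>f w\<bar> \<le> B"
    for f :: "_ \<Rightarrow> real" and B
  proof -
    have "(\<integral>w. f w \<partial>P) = (\<integral>j. (\<integral>w. f w \<partial>N j) \<partial>measure_pmf \<pi>)"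
      unfolding P_def
      by (rule integral_bind[where K="path_space T t" and B=B and B'=1])
        (use f N_meas pN in \<open>auto intro!: measure_pmf.finite_measure_axioms
          simp: prob_space.emeasure_space_1 path_measure.measurable_P subprob_space.emeasure_space_le_1 prob_space_imp_subprob_space\<close>)
    also have "\<dots> = (\<Sum>j\<in>UNIV. pmf \<pi> j * (\<integral>w. f w \<partial>N j))"
      by (subst integral_measure_pmf[of UNIV]) auto
    also have "\<dots> = (\<Sum>j\<in>UNIV. pmf \<pi> j * (\<integral>w. f (m w) \<partial>K j))"
      unfolding N_def using integral_distr[OF mK f(1)] by simp
    finally show ?thesis .
  qed
  have coord: "(\<lambda>w. w s $ i) \<in> borel_measurable (path_space T t)" for s and i :: 'i
    by (intro borel_measurable_vec_nth path_space_eval)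
  have "P \<in> martingale_measures T t p"
    unfolding P.martingale_measures_iff
  proof (intro conjI allI impI)
    fix s r i and A :: "(real \<Rightarrow> real^'i) set" assume sr: "s \<le> r" and A: "A \<in> sets (path_filtration T t s)"
    have A': "A \<in> sets (path_space T t)" using A sets_path_filtration_subset by blast
    have int': "(\<integral>w. indicator A w * w x $ i \<partial>P) = (\<Sum>j\<in>UNIV. pmf \<pi> j * (\<integral>w. indicator A (m w) * m w x $ i \<partial>K j))" for x
      by (rule int[of _ 1]) (use A' coord P.coord_abs in \<open>auto simp: indicator_def abs_mult intro!: borel_measurable_times\<close>)
    consider "t \<le> s" | "r < t" | "s < t" "t \<le> r" using sr by linarith
    then show "(\<integral>w. indicator A w * w r $ i \<partial>P) = (\<integral>w. indicator A w * w s $ i \<partial>P)"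
    proof cases
      case 1
      have B: "m -` A \<inter> paths T t' \<in> sets (path_filtration T t' s)"
        using measurable_sets[OF measurable_const_before(1)[OF t p(1)] A] by (simp add: m_def)
      have "(\<integral>w. indicator A (m w) * m w x $ i \<partial>K j) = (\<integral>w. indicator (m -` A \<inter> paths T t') w * w x $ i \<partial>K j)"
        if "t \<le> x" for x j
        by (rule Bochner_Integration.integral_cong) (use that in \<open>auto simp: spK indicator_def m_def\<close>)
      then show ?thesis
        unfolding int' using 1 sr martingale_measures_indicator[OF K sr B] by simp
    next
      case 2
      then show ?thesis unfolding int' m_def using sr by simp
    next
      case 3
      have "\<exists>c::real. \<forall>w\<in>paths T t'. indicator A (m w) = c"
        using path_filtration_before[OF A 3(1) t p(1)] unfolding m_def indicator_def
        by (elim disjE) (auto intro: exI[of _ 0] exI[of _ 1])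
      then obtain c :: real where c: "\<And>w. w \<in> paths T t' \<Longrightarrow> indicator A (m w) = c" by blast
      have "(\<integral>w. indicator A w * w r $ i \<partial>P) = (\<Sum>j\<in>UNIV. pmf \<pi> j * (\<integral>w. c * w r $ i \<partial>K j))"
        unfolding int' using 3 c
        by (intro sum.cong refl arg_cong2[where f="(*)"] Bochner_Integration.integral_cong) (auto simp: spK m_def)
      also have "\<dots> = c * (\<Sum>j\<in>UNIV. pmf \<pi> j * q j $ i)"
        by (simp add: martingale_measures_mean[OF K] sum_distrib_left algebra_simps)
      also have "\<dots> = (\<Sum>j\<in>UNIV. pmf \<pi> j * (\<integral>w. c * p $ i \<partial>K j))"
        using prob_space.prob_space[OF pK] sum_pmf_eq_1[of UNIV \<pi>]
        by (simp add: p(2)[symmetric] sum_distrib_right[symmetric])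
      also have "\<dots> = (\<integral>w. indicator A w * w s $ i \<partial>P)"
        unfolding int' using 3 c
        by (intro sum.cong refl arg_cong2[where f="(*)"] Bochner_Integration.integral_cong) (auto simp: spK m_def)
      finally show ?thesis .
    qed
  next
    have meas: "Measurable.pred (path_space T t) (\<lambda>w. w (t - 1) = p \<and> w T \<in> range (\<lambda>i. axis i 1))"
    proof -
      have "range (\<lambda>i. axis i 1) \<in> sets (borel :: (real^'i) measure)"
        by (intro borel_closed finite_imp_closed) auto
      then show ?thesis by measurable
    qed
    have "AE w in N j. w (t - 1) = p \<and> w T \<in> range (\<lambda>i. axis i 1)" for j
      unfolding N_def AE_distr_iff[OF mK meas[unfolded pred_def]]
      using martingale_measures_AE(2)[OF K[of j]]
      by eventually_elim (use t in \<open>auto simp: m_def\<close>)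
    then show "AE w in P. w (t - 1) = p \<and> w T \<in> range (\<lambda>i. axis i 1)"
      unfolding P_def by (subst AE_bind[OF N_meas meas]) auto
  qed
  from that[OF this] int show ?thesis unfolding m_def by blast
qed

lemma martingale_measures_vertex: "return (path_space T T) (\<lambda>_. axis i 1) \<in> martingale_measures T T (axis i 1)"
proof -
  let ?P = "return (path_space T T) (\<lambda>_::real. axis i 1 :: real^'a)"
  have w: "(\<lambda>_::real. axis i 1 :: real^'a) \<in> paths T T"
    by (auto simp: paths_def cadlag_def axis_in_prob_simplex)
  then interpret path_measure ?P T T
    by (auto simp: path_measure_def path_measure_axioms_def intro!: prob_space_return)
  have coord: "(\<lambda>w. w s $ i) \<in> borel_measurable (path_space T T)" for s and i :: 'a
    by (intro borel_measurable_vec_nth path_space_eval)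
  show ?thesis
    unfolding martingale_measures_iff
  proof (intro conjI allI impI)
    fix s t j A assume "A \<in> sets (path_filtration T T s :: (real \<Rightarrow> real^'a) measure)"
    then have A: "A \<in> sets (path_space T T)" using sets_path_filtration_subset by blast
    have "(\<integral>w. indicator A w * w r $ j \<partial>?P) = indicator A (\<lambda>_. axis i 1) * axis i 1 $ j" for r
      by (subst integral_return) (use w A coord in \<open>auto intro!: borel_measurable_times\<close>)
    then show "(\<integral>w. indicator A w * w t $ j \<partial>?P) = (\<integral>w. indicator A w * w s $ j \<partial>?P)" by simp
  next
    have "{w \<in> space (path_space T T). w (T - 1) = axis i 1 \<and> w T \<in> range (\<lambda>i. axis i (1::real) :: real^'a)} \<in> sets (path_space T T)"
    proof -
      have [measurable]: "range (\<lambda>i. axis i 1) \<in> sets (borel :: (real^'a) measure)"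
        by (intro borel_closed finite_imp_closed) auto
      show ?thesis by measurable
    qed
    then show "AE w in ?P. w (T - 1) = axis i 1 \<and> w T \<in> range (\<lambda>i. axis i 1)"
      by (subst AE_return) (use w in \<open>auto simp: pred_def\<close>)
  qed
qed

lemma finite_type_pmf:
  fixes c :: "'j::finite \<Rightarrow> real"
  assumes "\<And>j. 0 \<le> c j" "(\<Sum>j\<in>UNIV. c j) = 1"
  obtains \<pi> where "\<And>j. pmf \<pi> j = c j"
proof -
  have "(\<integral>\<^sup>+ j. ennreal (c j) \<partial>count_space UNIV) = ennreal (\<Sum>j\<in>UNIV. c j)"
    using assms(1) by (simp add: nn_integral_count_space_finite sum_ennreal)
  then have "pmf (embed_pmf c) j = c j" for j
    using assms by (intro pmf_embed_pmf) auto
  then show ?thesis by (rule that)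
qed

text \<open>Full revelation: the vertex is drawn with law \<open>p\<close> and shown at time
  \<open>t\<close>.\<close>

lemma martingale_measures_nonempty:
  assumes "p \<in> prob_simplex" "t \<le> T"
  shows "martingale_measures T t p \<noteq> {}"
proof -
  obtain \<pi> where \<pi>: "\<And>j. pmf \<pi> j = p $ j"
    using finite_type_pmf[of "\<lambda>j. p $ j"] assms(1) by (auto simp: prob_simplex_def)
  have *: "p $ i = (\<Sum>j\<in>UNIV. pmf \<pi> j * axis j 1 $ i)" for i
    by (simp add: \<pi> axis_def if_distrib[of "\<lambda>x. _ * x"] sum.delta' cong: if_cong)
  show ?thesis
    by (rule martingale_measures_mixture[OF assms(2) order_refl martingale_measures_vertex assms(1) *]) auto
qed

section \<open>The minimal martingale cost\<close>

context payoff_data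
begin

definition W :: "real \<Rightarrow> real^'i \<Rightarrow> real" where
  "W t p = (INF P\<in>martingale_measures T t p. \<integral>w. hint t w \<partial>P)"

lemma hint_integrable:
  assumes "P \<in> martingale_measures T t p" "0 \<le> t" "t \<le> T"
  shows "integrable P (hint t)" "\<bar>\<integral>w. hint t w \<partial>P\<bar> \<le> C * (T - t)"
proof -
  interpret path_measure P T t by (rule martingale_measures_path_measure[OF assms(1)])
  show i: "integrable P (hint t)"
    by (rule integrable_bounded[where B="C * (T - t)"])
      (use measurable_P hint_measurable hint_abs_le assms in auto)
  have "\<bar>\<integral>w. hint t w \<partial>P\<bar> \<le> (\<integral>w. \<bar>hint t w\<bar> \<partial>P)" by (rule integral_abs_bound)
  also have "\<dots> \<le> (\<integral>w. C * (T - t) \<partial>P)"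
    by (rule integral_mono) (use i hint_abs_le assms in \<open>auto simp: space_P\<close>)
  also have "\<dots> = C * (T - t)" by (simp add: prob_space)
  finally show "\<bar>\<integral>w. hint t w \<partial>P\<bar> \<le> C * (T - t)" .
qed

lemma W_bdd_below:
  assumes "0 \<le> t" "t \<le> T"
  shows "bdd_below ((\<lambda>P. \<integral>w. hint t w \<partial>P) ` martingale_measures T t p)"
  using hint_integrable(2)[OF _ assms] by (intro bdd_belowI2[where m="- (C * (T - t))"]) fastforce

lemma W_le:
  assumes "0 \<le> t" "t \<le> T" "P \<in> martingale_measures T t p"
  shows "W t p \<le> (\<integral>w. hint t w \<partial>P)"
  unfolding W_def by (rule cINF_lower[OF W_bdd_below]) (use assms in auto)

lemma W_near:
  assumes "0 \<le> t" "t \<le> T" "p \<in> prob_simplex" "0 < e"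
  obtains P where "P \<in> martingale_measures T t p" "(\<integral>w. hint t w \<partial>P) < W t p + e"
  using cINF_less_iff[OF martingale_measures_nonempty[OF assms(3,2)] W_bdd_below[OF assms(1,2)], of "W t p + e"] assms(4)
    that unfolding W_def[symmetric] by auto

lemma W_abs_le:
  assumes "0 \<le> t" "t \<le> T" "p \<in> prob_simplex"
  shows "\<bar>W t p\<bar> \<le> C * (T - t)"
proof -
  obtain P where P: "P \<in> martingale_measures T t p" using martingale_measures_nonempty[OF assms(3,2)] by auto
  have "W t p \<le> C * (T - t)" using W_le[OF assms(1,2) P] hint_integrable(2)[OF P assms(1,2)] by linarith
  moreover have "- (C * (T - t)) \<le> W t p"
    unfolding W_def using hint_integrable(2)[OF _ assms(1,2)] martingale_measures_nonempty[OF assms(3,2)]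
    by (intro cINF_greatest) fastforce+
  ultimately show ?thesis by auto
qed

lemma W_terminal: "p \<in> prob_simplex \<Longrightarrow> W T p = 0"
  using W_abs_le[of T p] T_pos by auto

text \<open>One candidate in the infimum at time \<open>t\<close> is to split \<open>p\<close> into
  the \<open>q j\<close>, keep the belief frozen until \<open>t'\<close>, and continue with a nearly
  optimal measure. Subdynamic programming and convexity are its two special cases.\<close>

lemma W_mixture:
  fixes \<pi> :: "'j::finite pmf"
  assumes t: "0 \<le> t" "t \<le> t'" "t' \<le> T" and q: "\<And>j. q j \<in> prob_simplex"
    and p: "p \<in> prob_simplex" "\<And>i. p $ i = (\<Sum>j\<in>UNIV. pmf \<pi> j * q j $ i)"
  shows "W t p \<le> (\<Sum>j\<in>UNIV. pmf \<pi> j * (LI t t' (\<lambda>s. H s (q j)) + W t' (q j)))"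
proof (rule field_le_epsilon)
  fix e :: real assume "0 < e"
  have "\<exists>P. P \<in> martingale_measures T t' (q j) \<and> (\<integral>w. hint t' w \<partial>P) < W t' (q j) + e" for j
    using W_near[of t' "q j" e] q t \<open>0 < e\<close> by (metis order_trans)
  then obtain K where K: "\<And>j. K j \<in> martingale_measures T t' (q j)"
    "\<And>j. (\<integral>w. hint t' w \<partial>K j) < W t' (q j) + e" by metis
  have tT: "t \<le> T" "0 \<le> t'" using t by auto
  obtain P where P: "P \<in> martingale_measures T t p"
    "\<And>f B. f \<in> borel_measurable (path_space T t) \<Longrightarrow> (\<And>w. w \<in> paths T t \<Longrightarrow> \<bar>f w\<bar> \<le> B) \<Longrightarrow>
      (\<integral>w. f w \<partial>P) = (\<Sum>j\<in>UNIV. pmf \<pi> j * (\<integral>w. f (\<lambda>s. if s < t then p else w s) \<partial>K j) :: real)"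
    by (rule martingale_measures_mixture[OF t(2,3) K(1) p]) blast
  have split: "(\<integral>w. hint t (\<lambda>s. if s < t then p else w s) \<partial>K j) = LI t t' (\<lambda>s. H s (q j)) + (\<integral>w. hint t' w \<partial>K j)" for j
  proof -
    interpret K: path_measure "K j" T t' by (rule martingale_measures_path_measure[OF K(1)])
    have "(\<integral>w. hint t (\<lambda>s. if s < t then p else w s) \<partial>K j) = (\<integral>w. LI t t' (\<lambda>s. H s (q j)) + hint t' w \<partial>K j)"
    proof (rule integral_cong_AE)
      have "(\<lambda>w. hint t (\<lambda>s. if s < t then p else w s)) \<in> borel_measurable (path_space T t')"
        by (rule measurable_compose[OF measurable_const_before(2)[OF t(2,3) p(1)] hint_measurable[OF t(1) tT(1)]])
      then show "(\<lambda>w. hint t (\<lambda>s. if s < t then p else w s)) \<in> borel_measurable (K j)"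
        by (rule K.measurable_P)
      show "(\<lambda>w. LI t t' (\<lambda>s. H s (q j)) + hint t' w) \<in> borel_measurable (K j)"
        using K.measurable_P[OF hint_measurable[OF tT(2) t(3)]] by simp
      show "AE w in K j. hint t (\<lambda>s. if s < t then p else w s) = LI t t' (\<lambda>s. H s (q j)) + hint t' w"
        using martingale_measures_AE(1)[OF K(1)[of j]] AE_space
      proof eventually_elim
        case (elim w)
        then have w': "w \<in> paths T t'" "w (t' - 1) = q j" by (simp_all add: K.space_P)
        \<comment> \<open>Almost every path under \<open>K j\<close> sits at \<open>q j\<close>
          until \<open>t'\<close>, so its cost before \<open>t'\<close> is deterministic.\<close>
        have "w s = q j" if "s < t'" for s
          using paths_before[OF w'(1) that, of "t' - 1"] w'(2) by simp
        note w = w'(1) this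
        have i: "integrable (lebesgue_on {t..T}) (\<lambda>s. H s (w s))"
          by (rule H_path_integrable) (use w t paths_measurable in \<open>auto simp: paths_simplex\<close>)
        have "hint t (\<lambda>s. if s < t then p else w s) = LI t T (\<lambda>s. H s (w s))"
          unfolding hint_def by (rule Bochner_Integration.integral_cong) auto
        also have "\<dots> = LI t t' (\<lambda>s. H s (w s)) + hint t' w"
          unfolding hint_def by (rule LI_split[OF i t(2,3)])
        also have "LI t t' (\<lambda>s. H s (w s)) = LI t t' (\<lambda>s. H s (q j))"
        proof (rule LI_cong_AE)
          show "(\<lambda>s. H s (w s)) \<in> borel_measurable (lebesgue_on {t..t'})"
            using integrable_subinterval[OF i order_refl t(3)] by auto
          show "(\<lambda>s. H s (q j)) \<in> borel_measurable (lebesgue_on {t..t'})"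
            by (rule H_path_measurable) (use q t in auto)
          show "AE s in lebesgue_on {t..t'}. H s (w s) = H s (q j)"
            using AE_interval_neq[of t' t t'] unfolding AE_interval_iff
            by eventually_elim (auto simp: w(2))
        qed
        finally show ?case .
      qed
    qed
    also have "\<dots> = LI t t' (\<lambda>s. H s (q j)) + (\<integral>w. hint t' w \<partial>K j)"
      using hint_integrable(1)[OF K(1) tT(2) t(3)] by (simp add: K.prob_space)
    finally show ?thesis .
  qed
  have "W t p \<le> (\<integral>w. hint t w \<partial>P)" by (rule W_le[OF t(1) tT(1) P(1)])
  also have "\<dots> = (\<Sum>j\<in>UNIV. pmf \<pi> j * (LI t t' (\<lambda>s. H s (q j)) + (\<integral>w. hint t' w \<partial>K j)))"
    using P(2)[OF hint_measurable[OF t(1) tT(1)] hint_abs_le[OF _ t(1) tT(1)]] by (simp add: split)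
  also have "\<dots> \<le> (\<Sum>j\<in>UNIV. pmf \<pi> j * (LI t t' (\<lambda>s. H s (q j)) + W t' (q j) + e))"
    using less_imp_le[OF K(2)] by (intro sum_mono mult_left_mono) (auto simp: add.assoc)
  also have "\<dots> = (\<Sum>j\<in>UNIV. pmf \<pi> j * (LI t t' (\<lambda>s. H s (q j)) + W t' (q j))) + e"
    using sum_pmf_eq_1[of UNIV \<pi>]
    by (simp add: distrib_left[of _ _ e] sum.distrib sum_distrib_right[symmetric])
  finally show "W t p \<le> (\<Sum>j\<in>UNIV. pmf \<pi> j * (LI t t' (\<lambda>s. H s (q j)) + W t' (q j))) + e" .
qed

lemma W_step:
  assumes "0 \<le> t" "t \<le> t'" "t' \<le> T" "p \<in> prob_simplex"
  shows "W t p \<le> LI t t' (\<lambda>s. H s p) + W t' p"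
  using W_mixture[OF assms(1-3), of "\<lambda>_::unit. p" p "return_pmf ()"] assms(4)
  by (simp add: UNIV_unit)

lemma W_convex:
  assumes "0 \<le> t" "t \<le> T"
  shows "convex_on prob_simplex (W t)"
proof (rule convex_onI)
  fix c :: real and p q :: "real^'i"
  assume c: "0 < c" "c < 1" and pq: "p \<in> prob_simplex" "q \<in> prob_simplex"
  have "(1 - c) *\<^sub>R p + c *\<^sub>R q \<in> prob_simplex"
    using convexD_alt[OF convex_prob_simplex pq, of c] c by auto
  \<comment> \<open>Convexity is the splitting at \<open>t' = t\<close>: it takes no time, so the
    running term vanishes.\<close>
  moreover have "LI t t f = 0" for f using LI_abs_le[of t t f "\<bar>f t\<bar>"] by auto
  ultimately show "W t ((1 - c) *\<^sub>R p + c *\<^sub>R q) \<le> (1 - c) * W t p + c * W t q"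
    using W_mixture[OF assms(1) order_refl assms(2), of "\<lambda>b. if b then q else p" _ "bernoulli_pmf c"] c pq
    by (simp add: UNIV_bool add.commute)
qed (rule convex_prob_simplex)

end

section \<open>Simulating finite laws\<close>

text \<open>Greedy filling: elements are added as long as they fit below \<open>x\<close>. The first
  one that does not fit shows that less than \<open>h\<close> is missing.\<close>

lemma subset_of_weight:
  fixes w :: "nat \<Rightarrow> real"
  assumes "finite A" "\<And>a. a \<in> A \<Longrightarrow> 0 \<le> w a" "\<And>a. a \<in> A \<Longrightarrow> w a \<le> h" "0 \<le> x"
  shows "\<exists>B\<subseteq>A. sum w B \<le> x \<and> (x - h \<le> sum w B \<or> B = A)"
  using assms(1-3)
proof (induction A)
  case empty
  then show ?case using assms(4) by auto
next
  case (insert a A)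
  then obtain B where B: "B \<subseteq> A" "sum w B \<le> x" "x - h \<le> sum w B \<or> B = A" by auto
  show ?case
  proof (cases "x - h \<le> sum w B")
    case True
    then show ?thesis using B by auto
  next
    case False
    then have "B = A" using B by auto
    show ?thesis
    proof (cases "w a + sum w A \<le> x")
      case True
      then show ?thesis using insert.hyps by (intro exI[of _ "insert a A"]) auto
    next
      case f: False
      then have "x - h \<le> sum w A" using insert.prems(2)[of a] by auto
      with False \<open>B = A\<close> show ?thesis by auto
    qed
  qed
qed

text \<open>The targets are filled one after the other. No set exceeds its target, so enough weight
  always remains for the targets still to come.\<close>

lemma subsets_of_weights:
  fixes w :: "nat \<Rightarrow> real" and x :: "'c \<Rightarrow> real"
  assumes "finite S" "finite A" "\<And>a. a \<in> A \<Longrightarrow> 0 \<le> w a" "\<And>a. a \<in> A \<Longrightarrow> w a \<le> h"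
    "\<And>c. c \<in> S \<Longrightarrow> 0 \<le> x c" "sum x S \<le> sum w A" "0 \<le> h"
  shows "\<exists>B. (\<forall>c\<in>S. B c \<subseteq> A \<and> sum w (B c) \<le> x c \<and> x c - h \<le> sum w (B c)) \<and> disjoint_family_on B S"
  using assms(1-6)
proof (induction S arbitrary: A)
  case empty
  then show ?case by (auto simp: disjoint_family_on_def)
next
  case (insert c S)
  obtain B where B: "B \<subseteq> A" "sum w B \<le> x c" "x c - h \<le> sum w B \<or> B = A"
    using subset_of_weight[of A w h "x c"] insert.prems by auto
  have S: "0 \<le> sum x S" using insert.prems by (intro sum_nonneg) auto
  have "x c - h \<le> sum w B"
    using B insert.prems(5) S insert.hyps \<open>0 \<le> h\<close> by auto
  moreover have "sum x S \<le> sum w (A - B)"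
    using sum_diff[OF insert.prems(1) B(1), of w] B(2) insert.prems(5) insert.hyps by auto
  then obtain B' where B': "\<forall>c\<in>S. B' c \<subseteq> A - B \<and> sum w (B' c) \<le> x c \<and> x c - h \<le> sum w (B' c)" "disjoint_family_on B' S"
    using insert.IH[of "A - B"] insert.prems by auto
  ultimately show ?case
    using B insert.hyps by (intro exI[of _ "B'(c := B)"]) (auto simp: disjoint_family_on_def)
qed

text \<open>Starting from one non-trivial event, each product with its space multiplies the largest
  cell by \<open>r\<close>, the larger of the probabilities of the event and of its complement, and
  \<open>r < 1\<close>.\<close>

lemma admissible_fine_partition:
  assumes E: "admissible_family E" and "0 < e"
  obtains M g n where "M \<in> E" "g \<in> M \<rightarrow>\<^sub>M count_space UNIV" "\<And>x. x \<in> space M \<Longrightarrow> g x < (n::nat)"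
    "\<And>k. measure M {x \<in> space M. g x = k} \<le> e"
proof -
  obtain M0 A where M0: "M0 \<in> E" "A \<in> sets M0" "0 < measure M0 A" "measure M0 A < 1"
    using E by (auto simp: admissible_family_def)
  interpret M0: prob_space M0 using E M0 by (auto simp: admissible_family_def)
  define r where "r = max (measure M0 A) (1 - measure M0 A)"
  have r: "0 \<le> r" "r < 1" using M0 by (auto simp: r_def)
  define g0 :: "_ \<Rightarrow> nat" where "g0 x = (if x \<in> A then 0 else 1)" for x
  have g0 [measurable]: "g0 \<in> M0 \<rightarrow>\<^sub>M count_space UNIV" unfolding g0_def using M0 by measurable
  have g0_le: "measure M0 {x \<in> space M0. g0 x = k} \<le> r" for k
  proof -
    have "{x \<in> space M0. g0 x = k} = (if k = 0 then A else if k = 1 then space M0 - A else {})"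
      using sets.sets_into_space[OF M0(2)] by (auto simp: g0_def)
    then show ?thesis using M0 r by (auto simp: r_def M0.prob_compl)
  qed
  have "\<exists>M\<in>E. \<exists>g n. g \<in> M \<rightarrow>\<^sub>M count_space UNIV \<and> (\<forall>x\<in>space M. g x < (n::nat)) \<and>
    (\<forall>k. measure M {x \<in> space M. g x = k} \<le> r ^ m)" for m
  proof (induction m)
    case 0
    show ?case using M0 M0.prob_le_1
      by (intro bexI[OF _ M0(1)] exI[of _ "\<lambda>_. 0"] exI[of _ 1]) auto
  next
    case (Suc m)
    then obtain M g n where M: "M \<in> E" and g[measurable]: "g \<in> M \<rightarrow>\<^sub>M count_space UNIV"
      and n: "\<And>x. x \<in> space M \<Longrightarrow> g x < (n::nat)" and g_le: "\<And>k. measure M {x \<in> space M. g x = k} \<le> r ^ m" by blast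
    interpret M: prob_space M using E M by (auto simp: admissible_family_def)
    interpret MM: pair_prob_space M M0 ..
    obtain K where K: "K \<in> E" "measure_isomorphic (M \<Otimes>\<^sub>M M0) K"
      using E M M0 unfolding admissible_family_def by blast
    then obtain \<phi> \<psi> where \<phi>[measurable]: "\<phi> \<in> (M \<Otimes>\<^sub>M M0) \<rightarrow>\<^sub>M K" and \<psi>[measurable]: "\<psi> \<in> K \<rightarrow>\<^sub>M (M \<Otimes>\<^sub>M M0)"
      and inv: "\<And>x. x \<in> space (M \<Otimes>\<^sub>M M0) \<Longrightarrow> \<psi> (\<phi> x) = x" and d: "distr (M \<Otimes>\<^sub>M M0) K \<phi> = K"
      unfolding measure_isomorphic_def by blast
    \<comment> \<open>The pair of labels is coded in one number and decoded by \<open>div 2\<close>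
      and \<open>mod 2\<close>; \<psi> carries the space \<open>K\<close> of the family back to the
      product.\<close>
    define G where "G y = 2 * g (fst (\<psi> y)) + g0 (snd (\<psi> y))" for y
    have G [measurable]: "G \<in> K \<rightarrow>\<^sub>M count_space UNIV" unfolding G_def by measurable
    have "measure K {y \<in> space K. G y = k} \<le> r ^ Suc m" for k
    proof -
      have "measure K {y \<in> space K. G y = k} = measure (distr (M \<Otimes>\<^sub>M M0) K \<phi>) {y \<in> space K. G y = k}"
        by (simp only: d)
      also have "\<dots> = measure (M \<Otimes>\<^sub>M M0) (\<phi> -` {y \<in> space K. G y = k} \<inter> space (M \<Otimes>\<^sub>M M0))"
        by (rule measure_distr) measurable
      also have "\<phi> -` {y \<in> space K. G y = k} \<inter> space (M \<Otimes>\<^sub>M M0) =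
          {x \<in> space M. g x = k div 2} \<times> {x \<in> space M0. g0 x = k mod 2}"
        using measurable_space[OF \<phi>] inv
        by (auto simp: G_def space_pair_measure g0_def) presburger+
      also have "measure (M \<Otimes>\<^sub>M M0) \<dots> = measure M {x \<in> space M. g x = k div 2} * measure M0 {x \<in> space M0. g0 x = k mod 2}"
        by (simp add: measure_def M0.emeasure_pair_measure_Times enn2real_mult)
      also have "\<dots> \<le> r ^ m * r" by (intro mult_mono g_le g0_le) (use r in auto)
      finally show ?thesis by (simp add: mult.commute)
    qed
    moreover have "G y < 2 * n" if "y \<in> space K" for y
      using n[of "fst (\<psi> y)"] measurable_space[OF \<psi> that] by (auto simp: G_def g0_def space_pair_measure)
    ultimately show ?case using K(1) G by blast
  qed
  moreover obtain m where "r ^ m < e" using real_arch_pow_inv[OF \<open>0 < e\<close> r(2)] by blast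
  ultimately show ?thesis using that by (meson less_imp_le order_trans)
qed

text \<open>Cells of a fine partition are grouped so that every value receives slightly less than
  its target mass; all leftover cells go to one value \<open>d\<close>.\<close>

lemma admissible_approximates_law:
  fixes x :: "'c \<Rightarrow> real"
  assumes E: "admissible_family E" and S: "finite S" "\<And>c. c \<in> S \<Longrightarrow> 0 \<le> x c" "sum x S = 1" and "0 < e"
  obtains M f where "M \<in> E" "f \<in> M \<rightarrow>\<^sub>M count_space UNIV" "\<And>y. y \<in> space M \<Longrightarrow> f y \<in> S"
    "(\<Sum>c\<in>S. \<bar>measure M {y \<in> space M. f y = c} - x c\<bar>) \<le> e"
proof -
  obtain d where d: "d \<in> S" using S by fastforce
  \<comment> \<open>Each value other than \<open>d\<close> has error at most \<open>h\<close>. Both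
    laws have mass 1, so the error at \<open>d\<close> is at most the sum of the others, which gives
    the factor 2.\<close>
  define h where "h = e / (2 * card S)"
  have cS: "0 < card S" using S(1) d by (auto simp: card_gt_0_iff)
  have h: "0 < h" using \<open>0 < e\<close> cS by (auto simp: h_def)
  obtain M g n where M: "M \<in> E" and g[measurable]: "g \<in> M \<rightarrow>\<^sub>M count_space UNIV" and n: "\<And>y. y \<in> space M \<Longrightarrow> g y < (n::nat)"
    and gh: "\<And>k. measure M {y \<in> space M. g y = k} \<le> h"
    using admissible_fine_partition[OF E h] by metis
  interpret M: prob_space M using E M by (auto simp: admissible_family_def)
  define w where "w k = measure M {y \<in> space M. g y = k}" for k
  have meas: "measure M {y \<in> space M. g y \<in> B} = sum w B" if "B \<subseteq> {..<n}" for B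
  proof -
    have "measure M (\<Union>k\<in>B. {y \<in> space M. g y = k}) = sum w B"
      unfolding w_def
      by (rule M.finite_measure_finite_Union) (use that in \<open>auto simp: disjoint_family_on_def intro: finite_subset\<close>)
    moreover have "(\<Union>k\<in>B. {y \<in> space M. g y = k}) = {y \<in> space M. g y \<in> B}" by auto
    ultimately show ?thesis by simp
  qed
  have "sum w {..<n} = measure M {y \<in> space M. g y \<in> {..<n}}" by (rule meas[symmetric]) simp
  also have "{y \<in> space M. g y \<in> {..<n}} = space M" using n by auto
  finally have w1: "sum w {..<n} = 1" by (simp add: M.prob_space)
  have wn: "0 \<le> w k" and wh: "w k \<le> h" for k using gh by (auto simp: w_def)
  have "\<exists>B. (\<forall>c\<in>S. B c \<subseteq> {..<n} \<and> sum w (B c) \<le> x c \<and> x c - h \<le> sum w (B c)) \<and> disjoint_family_on B S"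
    by (rule subsets_of_weights) (use S wn wh w1 h in auto)
  then obtain B where B: "\<And>c. c \<in> S \<Longrightarrow> B c \<subseteq> {..<n}" "\<And>c. c \<in> S \<Longrightarrow> sum w (B c) \<le> x c"
    "\<And>c. c \<in> S \<Longrightarrow> x c - h \<le> sum w (B c)" "disjoint_family_on B S"
    by blast
  define F where "F k = (if \<exists>c\<in>S. k \<in> B c then (SOME c. c \<in> S \<and> k \<in> B c) else d)" for k
  have FB: "F k = c" if "k \<in> B c" "c \<in> S" for k c
  proof -
    have "(SOME c. c \<in> S \<and> k \<in> B c) \<in> S \<and> k \<in> B (SOME c. c \<in> S \<and> k \<in> B c)"
      by (rule someI[of _ c]) (use that in auto)
    then have "F k \<in> S" "k \<in> B (F k)" using that by (auto simp: F_def)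
    then show ?thesis using B(4) that by (auto simp: disjoint_family_on_def)
  qed
  have FS: "F k \<in> S" for k
    using FB d by (cases "\<exists>c\<in>S. k \<in> B c") (auto, auto simp: F_def)
  define f where "f = F \<circ> g"
  have f[measurable]: "f \<in> M \<rightarrow>\<^sub>M count_space UNIV" unfolding f_def by (rule measurable_comp[OF g]) simp
  have fS: "f y \<in> S" for y using FS by (simp add: f_def)
  define \<mu> where "\<mu> c = measure M {y \<in> space M. f y = c}" for c
  have "(\<Sum>c\<in>S. \<mu> c) = measure M (\<Union>c\<in>S. {y \<in> space M. f y = c})"
    unfolding \<mu>_def
    by (rule M.finite_measure_finite_Union[symmetric]) (use S in \<open>auto simp: disjoint_family_on_def\<close>)
  also have "(\<Union>c\<in>S. {y \<in> space M. f y = c}) = space M" using fS by auto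
  finally have \<mu>1: "sum \<mu> S = 1" by (simp add: M.prob_space)
  have near: "\<bar>\<mu> c - x c\<bar> \<le> h" if c: "c \<in> S" "c \<noteq> d" for c
  proof -
    have "F k = c \<longleftrightarrow> k \<in> B c" for k
    proof
      assume "F k = c"
      then obtain c' where "c' \<in> S" "k \<in> B c'" using c by (auto simp: F_def split: if_splits)
      with FB \<open>F k = c\<close> show "k \<in> B c" by auto
    qed (use FB c in auto)
    then have "{y \<in> space M. f y = c} = {y \<in> space M. g y \<in> B c}" by (auto simp: f_def)
    then have "\<mu> c = sum w (B c)" using meas[OF B(1)[OF c(1)]] by (simp add: \<mu>_def)
    then show ?thesis using B(2,3)[OF c(1)] h by auto
  qed
  have near': "(\<Sum>c\<in>S - {d}. \<bar>\<mu> c - x c\<bar>) \<le> card S * h"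
  proof -
    have "(\<Sum>c\<in>S - {d}. \<bar>\<mu> c - x c\<bar>) \<le> (\<Sum>c\<in>S - {d}. h)" by (rule sum_mono) (use near in auto)
    also have "\<dots> \<le> (\<Sum>c\<in>S. h)" by (rule sum_mono2) (use S h in auto)
    finally show ?thesis by simp
  qed
  have "\<mu> d - x d = - (\<Sum>c\<in>S - {d}. \<mu> c - x c)"
    using sum.remove[OF S(1) d, of "\<lambda>c. \<mu> c - x c"] \<mu>1 S(3) by (simp add: sum_subtractf)
  then have "\<bar>\<mu> d - x d\<bar> \<le> (\<Sum>c\<in>S - {d}. \<bar>\<mu> c - x c\<bar>)" by (simp add: sum_abs)
  then have "(\<Sum>c\<in>S. \<bar>\<mu> c - x c\<bar>) \<le> 2 * (card S * h)"
    using sum.remove[OF S(1) d, of "\<lambda>c. \<bar>\<mu> c - x c\<bar>"] near' by simp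
  also have "\<dots> = e" using cS by (simp add: h_def)
  finally show ?thesis using that[OF M f] fS by (simp add: \<mu>_def)
qed

section \<open>Controls\<close>

lemma space_control_space [simp]: "space (control_space t0 T U) = controls t0 T U"
  unfolding control_space_def by (rule space_measure_of) auto

lemma controls_measurable:
  "u \<in> controls t0 T U \<Longrightarrow> t0 \<le> a \<Longrightarrow> b \<le> T \<Longrightarrow> u \<in> borel_measurable (lebesgue_on {a..b})"
  by (rule measurable_subinterval[of u t0 T]) (auto simp: controls_def)

lemma controls_in: "u \<in> controls t0 T U \<Longrightarrow> t0 \<le> s \<Longrightarrow> s \<le> T \<Longrightarrow> u s \<in> U"
  by (auto simp: controls_def)

lemma restrict_controls:
  assumes "u \<in> borel_measurable (lebesgue_on {t0..T})" "\<And>s. t0 \<le> s \<Longrightarrow> s \<le> T \<Longrightarrow> u s \<in> U"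
  shows "restrict u {t0..T} \<in> controls t0 T U"
proof -
  have "restrict u {t0..T} \<in> borel_measurable (lebesgue_on {t0..T})"
    using assms(1) by (subst measurable_cong[of _ _ u]) auto
  then show ?thesis using assms(2) by (auto simp: controls_def)
qed

lemma L1_dist_self [simp]: "L1_dist t0 T f f = 0"
  by (simp add: L1_dist_def)

text \<open>The hypothesis asks for a Lipschitz bound up to any additive error. A payoff that is
  merely continuous admits such an affine modulus, which can be integrated against the L1 distance.
  Strict superlevel sets are then open.\<close>

lemma control_functional_measurable:
  assumes "\<And>e. 0 < e \<Longrightarrow> \<exists>K\<ge>0. \<forall>f\<in>controls t0 T U. \<forall>g\<in>controls t0 T U. \<bar>F f - F g\<bar> \<le> e + K * L1_dist t0 T f g"
  shows "F \<in> borel_measurable (control_space t0 T U)"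
proof (rule borel_measurableI_greater)
  fix y
  have "\<exists>e>0. \<forall>g\<in>controls t0 T U. L1_dist t0 T f g < e \<longrightarrow> y < F g"
    if f: "f \<in> controls t0 T U" "y < F f" for f
  proof -
    define d where "d = F f - y"
    have d: "0 < d" using f by (simp add: d_def)
    obtain K where K: "0 \<le> K" "\<And>g. g \<in> controls t0 T U \<Longrightarrow> \<bar>F f - F g\<bar> \<le> d / 2 + K * L1_dist t0 T f g"
      using assms[of "d / 2"] f(1) d by auto
    show ?thesis
    \<comment> \<open>Half of the gap \<open>d\<close> absorbs the additive error and half the
      Lipschitz term; \<open>K + 1\<close> keeps the radius defined when
      \<open>K = 0\<close>.\<close>
    proof (intro exI[of _ "d / (2 * (K + 1))"] conjI ballI impI)
      show "0 < d / (2 * (K + 1))" using d K by simp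
      fix g assume g: "g \<in> controls t0 T U" "L1_dist t0 T f g < d / (2 * (K + 1))"
      have "K * L1_dist t0 T f g \<le> K * (d / (2 * (K + 1)))" by (rule mult_left_mono) (use g K in auto)
      also have "\<dots> < (K + 1) * (d / (2 * (K + 1)))" by (rule mult_strict_right_mono) (use d K in auto)
      also have "\<dots> = d / 2" using K by (simp add: field_simps)
      finally have "\<bar>F f - F g\<bar> < d" using K(2)[OF g(1)] by linarith
      then show "y < F g" by (auto simp: d_def)
    qed
  qed
  then show "{x \<in> space (control_space t0 T U). y < F x} \<in> sets (control_space t0 T U)"
    unfolding space_control_space unfolding control_space_def
    by (subst sets_measure_of) (auto intro!: sigma_sets.Basic)
qed

section \<open>Continuity of the payoff in the controls\<close>

context payoff_data
begin

definition pay :: "'i \<Rightarrow> real \<Rightarrow> real \<Rightarrow> (real \<Rightarrow> 'u) \<Rightarrow> (real \<Rightarrow> 'v) \<Rightarrow> real" where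
  "pay i a b u v = LI a b (\<lambda>s. l i (s, u s, v s))"

lemma pay_integrable:
  assumes "u \<in> controls t0 T U" "v \<in> controls t0 T V" "0 \<le> t0" "t0 \<le> a" "b \<le> T"
  shows "integrable (lebesgue_on {a..b}) (\<lambda>s. l i (s, u s, v s))"
  by (rule l_integrable)
    (use controls_measurable[OF assms(1)] controls_measurable[OF assms(2)]
      controls_in[OF assms(1)] controls_in[OF assms(2)] assms in auto)

lemma pay_abs_le:
  assumes "u \<in> controls t0 T U" "v \<in> controls t0 T V" "0 \<le> t0" "t0 \<le> a" "a \<le> b" "b \<le> T"
  shows "\<bar>pay i a b u v\<bar> \<le> C * (b - a)"
  unfolding pay_def by (rule LI_abs_le) (use controls_in[OF assms(1)] controls_in[OF assms(2)] assms in \<open>auto intro!: l_bound\<close>)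

lemma pay_cong_AE:
  assumes "u \<in> controls t0 T U" "v \<in> controls t0 T V" "u' \<in> controls t0 T U" "v' \<in> controls t0 T V" "0 \<le> t0" "t0 \<le> a" "b \<le> T"
    "AE s in lebesgue_on {a..b}. u s = u' s" "AE s in lebesgue_on {a..b}. v s = v' s"
  shows "pay i a b u v = pay i a b u' v'"
  unfolding pay_def
  by (rule LI_cong_AE)
    (use assms(8,9) borel_measurable_integrable[OF pay_integrable] assms(1-7) in auto)

text \<open>Below the radius of uniform continuity the difference is at most \<open>e\<close>.
  Beyond it the crude bound \<open>2 * C\<close> is already linear in the displacement, with slope
  \<open>2 * C / d\<close>.\<close>

lemma l_Lipschitz_up_to:
  assumes "0 < e"
  obtains K where "0 \<le> K" "\<And>s u v u' v'. s \<in> {0..T} \<Longrightarrow> u \<in> U \<Longrightarrow> v \<in> V \<Longrightarrow> u' \<in> U \<Longrightarrow> v' \<in> V \<Longrightarrow>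
    \<bar>l i (s, u, v) - l i (s, u', v')\<bar> \<le> e + K * (norm (u - u') + norm (v - v'))"
proof -
  have "uniformly_continuous_on ({0..T} \<times> U \<times> V) (l i)"
    by (rule compact_uniformly_continuous[OF l_cont]) (use compact_U compact_V in \<open>auto intro!: compact_Times\<close>)
  then obtain d where d: "0 < d" "\<And>x y. x \<in> {0..T} \<times> U \<times> V \<Longrightarrow> y \<in> {0..T} \<times> U \<times> V \<Longrightarrow> dist y x < d \<Longrightarrow> dist (l i y) (l i x) < e"
    using assms unfolding uniformly_continuous_on_def by blast
  show ?thesis
  proof (rule that[of "2 * C / d"])
    show "0 \<le> 2 * C / d" using C_nonneg d by simp
    fix s u v u' v' assume *: "s \<in> {0..T}" "u \<in> U" "v \<in> V" "u' \<in> U" "v' \<in> V"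
    let ?n = "norm (u - u') + norm (v - v')"
    show "\<bar>l i (s, u, v) - l i (s, u', v')\<bar> \<le> e + 2 * C / d * ?n"
    proof (cases "?n < d")
      case True
      have "dist (s, u, v) (s, u', v') \<le> ?n"
        using norm_Pair_le[of "u - u'" "v - v'"] by (simp add: dist_norm norm_Pair)
      then have "dist (l i (s, u, v)) (l i (s, u', v')) < e" using True * by (intro d(2)) auto
      then show ?thesis using C_nonneg d by (simp add: dist_real_def add_increasing2 less_imp_le)
    next
      case False
      have "\<bar>l i (s, u, v) - l i (s, u', v')\<bar> \<le> 2 * C"
        using l_bound[of s u v i] l_bound[of s u' v' i] * by (simp add: abs_le_iff)
      also have "\<dots> = 2 * C / d * d" using d by simp
      also have "\<dots> \<le> 2 * C / d * ?n" by (rule mult_left_mono) (use False C_nonneg d in auto)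
      finally show ?thesis using assms by simp
    qed
  qed
qed

lemma L1_dist_integrable:
  fixes u u' :: "real \<Rightarrow> 'a::euclidean_space"
  assumes "u \<in> controls t0 T X" "u' \<in> controls t0 T X" "compact X"
  shows "integrable (lebesgue_on {t0..T}) (\<lambda>s. norm (u s - u' s))"
proof -
  obtain B where B: "\<And>x. x \<in> X \<Longrightarrow> norm x \<le> B" using assms(3) compact_imp_bounded bounded_iff by metis
  show ?thesis
  proof (rule integrable_interval[where C="2 * B"])
    have [measurable]: "u \<in> borel_measurable (lebesgue_on {t0..T})" "u' \<in> borel_measurable (lebesgue_on {t0..T})"
      using assms by (auto simp: controls_def)
    show "(\<lambda>s. norm (u s - u' s)) \<in> borel_measurable (lebesgue_on {t0..T})" by measurable
    fix s assume "s \<in> {t0..T}"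
    then have "norm (u s) \<le> B" "norm (u' s) \<le> B"
      using controls_in[OF assms(1)] controls_in[OF assms(2)] by (auto intro!: B)
    then show "\<bar>norm (u s - u' s)\<bar> \<le> 2 * B" using norm_triangle_ineq4[of "u s" "u' s"] by simp
  qed
qed

lemma pay_modulus:
  assumes "0 < e" "0 \<le> t0" "t0 \<le> a" "a \<le> b" "b \<le> T"
  shows "\<exists>K\<ge>0. \<forall>u\<in>controls t0 T U. \<forall>u'\<in>controls t0 T U. \<forall>v\<in>controls t0 T V. \<forall>v'\<in>controls t0 T V.
    \<bar>pay i a b u v - pay i a b u' v'\<bar> \<le> e + K * (L1_dist t0 T u u' + L1_dist t0 T v v')"
proof -
  define e' where "e' = e / (b - a + 1)"
  have e': "0 < e'" "e' * (b - a) \<le> e"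
    using assms by (auto simp: e'_def field_simps)
  obtain K where K: "0 \<le> K" "\<And>s u v u' v'. s \<in> {0..T} \<Longrightarrow> u \<in> U \<Longrightarrow> v \<in> V \<Longrightarrow> u' \<in> U \<Longrightarrow> v' \<in> V \<Longrightarrow>
    \<bar>l i (s, u, v) - l i (s, u', v')\<bar> \<le> e' + K * (norm (u - u') + norm (v - v'))"
    using l_Lipschitz_up_to[OF e'(1), of i] by metis
  show ?thesis
  proof (intro exI[of _ K] conjI ballI K(1))
    fix u u' v v' assume c: "u \<in> controls t0 T U" "u' \<in> controls t0 T U" "v \<in> controls t0 T V" "v' \<in> controls t0 T V"
    let ?g = "\<lambda>s. norm (u s - u' s) + norm (v s - v' s)"
    have gi: "integrable (lebesgue_on {t0..T}) ?g"
      by (intro Bochner_Integration.integrable_add L1_dist_integrable[OF c(1,2) compact_U] L1_dist_integrable[OF c(3,4) compact_V])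
    have gi': "integrable (lebesgue_on {a..b}) ?g" by (rule integrable_subinterval[OF gi]) (use assms in auto)
    note li = pay_integrable[OF _ _ assms(2,3,5)]
    have "LI t0 T ?g = LI t0 a ?g + (LI a b ?g + LI b T ?g)"
      using LI_split[OF gi, of a] LI_split[of a T ?g b] integrable_subinterval[OF gi, of a T] assms by simp
    moreover have "0 \<le> LI t0 a ?g" "0 \<le> LI b T ?g" by (auto intro!: Bochner_Integration.integral_nonneg)
    ultimately have "LI a b ?g \<le> LI t0 T ?g" by simp
    also have "\<dots> = L1_dist t0 T u u' + L1_dist t0 T v v'"
      unfolding L1_dist_def
      by (intro Bochner_Integration.integral_add L1_dist_integrable[OF c(1,2) compact_U] L1_dist_integrable[OF c(3,4) compact_V])
    finally have g_le: "LI a b ?g \<le> L1_dist t0 T u u' + L1_dist t0 T v v'" .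
    have "\<bar>pay i a b u v - pay i a b u' v'\<bar> = \<bar>LI a b (\<lambda>s. l i (s, u s, v s) - l i (s, u' s, v' s))\<bar>"
      unfolding pay_def using li c by simp
    also have "\<dots> \<le> LI a b (\<lambda>s. \<bar>l i (s, u s, v s) - l i (s, u' s, v' s)\<bar>)" by (rule integral_abs_bound)
    also have "\<dots> \<le> LI a b (\<lambda>s. e' + K * ?g s)"
    proof (rule LI_mono)
      show "integrable (lebesgue_on {a..b}) (\<lambda>s. \<bar>l i (s, u s, v s) - l i (s, u' s, v' s)\<bar>)"
        using li c by (intro integrable_abs Bochner_Integration.integrable_diff) auto
      show "integrable (lebesgue_on {a..b}) (\<lambda>s. e' + K * ?g s)"
        by (intro Bochner_Integration.integrable_add finite_measure.integrable_const[OF finite_measure_interval]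
            integrable_mult_right gi')
    qed (use controls_in[OF c(1)] controls_in[OF c(2)] controls_in[OF c(3)] controls_in[OF c(4)] assms in
        \<open>auto intro!: K(2)\<close>)
    also have "\<dots> = LI a b (\<lambda>_. e') + K * LI a b ?g"
      by (subst Bochner_Integration.integral_add[OF finite_measure.integrable_const[OF finite_measure_interval]
            integrable_mult_right[OF gi']]) (simp only: integral_mult_right_zero)
    also have "\<dots> \<le> e + K * (L1_dist t0 T u u' + L1_dist t0 T v v')"
      using mult_left_mono[OF g_le K(1)] e'(2) LI_const[OF assms(4), of e'] by linarith
    finally show "\<bar>pay i a b u v - pay i a b u' v'\<bar> \<le> e + K * (L1_dist t0 T u u' + L1_dist t0 T v v')" .
  qed
qed

lemma pay_measurable_v:
  assumes "0 \<le> t0" "t0 \<le> a" "a \<le> b" "b \<le> T" "u \<in> controls t0 T U"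
  shows "pay i a b u \<in> borel_measurable (control_space t0 T V)"
  by (rule control_functional_measurable) (use pay_modulus[OF _ assms(1-4), of _ i] assms(5) in fastforce)

lemma pay_measurable_u:
  assumes "0 \<le> t0" "t0 \<le> a" "a \<le> b" "b \<le> T" "v \<in> controls t0 T V"
  shows "(\<lambda>u. pay i a b u v) \<in> borel_measurable (control_space t0 T U)"
  by (rule control_functional_measurable) (use pay_modulus[OF _ assms(1-4), of _ i] assms(5) in fastforce)

end

section \<open>Random strategies and plays\<close>

lemma random_strategies_controls:
  assumes "(M, \<alpha>) \<in> random_strategies E t0 T V U" "\<omega> \<in> space M" "v \<in> controls t0 T V"
  shows "\<alpha> (\<omega>, v) \<in> controls t0 T U"
proof -
  have "\<alpha> \<in> M \<Otimes>\<^sub>M control_space t0 T V \<rightarrow>\<^sub>M control_space t0 T U" using assms(1) by (auto simp: random_strategies_def)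
  from measurable_space[OF this, of "(\<omega>, v)"] show ?thesis using assms by (simp add: space_pair_measure)
qed

text \<open>The delay clause for a single deterministic map, so that it can be stated for the
  composition of two strategies as well as for one strategy.\<close>

definition delayed :: "real \<Rightarrow> nat \<Rightarrow> (nat \<Rightarrow> real) \<Rightarrow> (real \<Rightarrow> 'b) set \<Rightarrow> ((real \<Rightarrow> 'b) \<Rightarrow> (real \<Rightarrow> 'a)) \<Rightarrow> bool" where
  "delayed t0 k \<tau> X F \<longleftrightarrow> (\<forall>v1\<in>X. \<forall>v2\<in>X. \<forall>j<k. (AE s in lebesgue_on {t0..\<tau> j}. v1 s = v2 s) \<longrightarrow>
    (AE s in lebesgue_on {t0..\<tau> (Suc j)}. F v1 s = F v2 s))"

lemma delayedD:
  assumes "delayed t0 k \<tau> X F" "v1 \<in> X" "v2 \<in> X" "j < k" "AE s in lebesgue_on {t0..\<tau> j}. v1 s = v2 s"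
  shows "AE s in lebesgue_on {t0..\<tau> (Suc j)}. F v1 s = F v2 s"
  using assms unfolding delayed_def by blast

lemma random_strategies_partition:
  assumes "(M, \<alpha>) \<in> random_strategies E t0 T V U"
  obtains k \<tau> where "\<tau> 0 = t0" "\<tau> k = T" "\<And>j. j < k \<Longrightarrow> \<tau> j < \<tau> (Suc j)"
    "\<And>\<omega>. \<omega> \<in> space M \<Longrightarrow> delayed t0 k \<tau> (controls t0 T V) (\<lambda>v. \<alpha> (\<omega>, v))"
  using assms unfolding random_strategies_def delayed_def by blast

text \<open>At an arbitrary time \<open>r\<close> the delay still yields plain nonanticipativity:
  the last partition point before \<open>r\<close> controls the answer up to the next one, which is
  past \<open>r\<close>.\<close>

lemma random_strategies_nonanticipative:
  assumes "(M, \<alpha>) \<in> random_strategies E t0 T V U" "\<omega> \<in> space M" "v1 \<in> controls t0 T V" "v2 \<in> controls t0 T V"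
    "r \<le> T" "AE s in lebesgue_on {t0..r}. v1 s = v2 s"
  shows "AE s in lebesgue_on {t0..r}. \<alpha> (\<omega>, v1) s = \<alpha> (\<omega>, v2) s"
proof -
  obtain k \<tau> where \<tau>: "\<tau> 0 = t0" "\<tau> k = T" "\<And>j. j < k \<Longrightarrow> \<tau> j < \<tau> (Suc j)"
    "\<And>\<omega>. \<omega> \<in> space M \<Longrightarrow> delayed t0 k \<tau> (controls t0 T V) (\<lambda>v. \<alpha> (\<omega>, v))"
    by (rule random_strategies_partition[OF assms(1)], rule that)
  define j where "j = (LEAST j. r \<le> \<tau> j)"
  have j: "r \<le> \<tau> j" "j \<le> k"
    using LeastI[of "\<lambda>j. r \<le> \<tau> j" k] Least_le[of "\<lambda>j. r \<le> \<tau> j" k] \<tau>(2) assms(5) by (auto simp: j_def)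
  show ?thesis
  proof (cases j)
    case 0
    then have "r \<le> t0" using j \<tau>(1) by simp
    then show ?thesis by (intro AE_interval_subset[OF AE_interval_singleton[where a=t0]]) auto
  next
    case (Suc m)
    then have "\<tau> m < r" using not_less_Least[of m "\<lambda>j. r \<le> \<tau> j"] by (auto simp: j_def)
    then have "AE s in lebesgue_on {t0..\<tau> m}. v1 s = v2 s" by (intro AE_interval_subset[OF assms(6)]) auto
    then have "AE s in lebesgue_on {t0..\<tau> (Suc m)}. \<alpha> (\<omega>, v1) s = \<alpha> (\<omega>, v2) s"
      using j Suc assms(2-4) by (intro delayedD[OF \<tau>(4)[OF assms(2)]]) auto
    then show ?thesis by (rule AE_interval_subset) (use j Suc in auto)
  qed
qed

text \<open>The relation under the choice operator of \<open>play\<close>, named so that existence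
  and uniqueness can be treated apart from the choice.\<close>

definition is_play :: "real \<Rightarrow> real \<Rightarrow> 'u::euclidean_space set \<Rightarrow> 'v::euclidean_space set \<Rightarrow>
   ('w \<times> (real \<Rightarrow> 'v) \<Rightarrow> (real \<Rightarrow> 'u)) \<Rightarrow> ('w \<times> (real \<Rightarrow> 'u) \<Rightarrow> (real \<Rightarrow> 'v)) \<Rightarrow>
   'w \<times> 'w \<Rightarrow> (real \<Rightarrow> 'u) \<Rightarrow> (real \<Rightarrow> 'v) \<Rightarrow> bool" where
  "is_play t0 T U V \<alpha> \<beta> \<omega> u v \<longleftrightarrow> u \<in> controls t0 T U \<and> v \<in> controls t0 T V \<and>
        (AE s in lebesgue_on {t0..T}. \<alpha> (fst \<omega>, v) s = u s) \<and>
        (AE s in lebesgue_on {t0..T}. \<beta> (snd \<omega>, u) s = v s)"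

lemma is_play_controls:
  assumes "is_play t0 T U V \<alpha> \<beta> \<omega> u v"
  shows "u \<in> controls t0 T U" "v \<in> controls t0 T V"
  using assms by (auto simp: is_play_def)

locale strategy_pair =
  fixes E :: "'w measure set" and t0 T :: real and U :: "'u::euclidean_space set" and V :: "'v::euclidean_space set"
    and M N :: "'w measure" and \<alpha> \<beta>
  assumes \<alpha>: "(M, \<alpha>) \<in> random_strategies E t0 T V U"
    and \<beta>: "(N, \<beta>) \<in> random_strategies E t0 T U V"
begin

text \<open>Plays are the fixed points of this map up to null sets, with \<open>u\<close> recovered
  as the answer of \<alpha>.\<close>

definition response :: "'w \<times> 'w \<Rightarrow> (real \<Rightarrow> 'v) \<Rightarrow> (real \<Rightarrow> 'v)" where
  "response \<omega> v = \<beta> (snd \<omega>, \<alpha> (fst \<omega>, v))"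

context
  fixes \<omega> :: "'w \<times> 'w" assumes \<omega>: "fst \<omega> \<in> space M" "snd \<omega> \<in> space N"
begin

lemma \<alpha>_controls: "v \<in> controls t0 T V \<Longrightarrow> \<alpha> (fst \<omega>, v) \<in> controls t0 T U"
  by (rule random_strategies_controls[OF \<alpha> \<omega>(1)])

lemma \<beta>_controls: "u \<in> controls t0 T U \<Longrightarrow> \<beta> (snd \<omega>, u) \<in> controls t0 T V"
  by (rule random_strategies_controls[OF \<beta> \<omega>(2)])

lemma response_controls: "v \<in> controls t0 T V \<Longrightarrow> response \<omega> v \<in> controls t0 T V"
  by (simp add: response_def \<alpha>_controls \<beta>_controls)

lemma iterate_controls: "v \<in> controls t0 T V \<Longrightarrow> (response \<omega> ^^ n) v \<in> controls t0 T V"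
  by (induction n) (auto intro: response_controls)

end

text \<open>The composition keeps the delay of \<beta> along the partition of \<beta>, while
  \<alpha> contributes nonanticipativity.\<close>

lemma response_partition:
  obtains k \<tau> where "\<tau> 0 = t0" "\<tau> k = T" "\<And>j. j < k \<Longrightarrow> \<tau> (Suc j) \<le> T"
    "\<And>\<omega>. fst \<omega> \<in> space M \<Longrightarrow> snd \<omega> \<in> space N \<Longrightarrow> delayed t0 k \<tau> (controls t0 T V) (response \<omega>)"
proof -
  obtain k \<tau> where \<tau>: "\<tau> 0 = t0" "\<tau> k = T" "\<And>j. j < k \<Longrightarrow> \<tau> j < \<tau> (Suc j)"
    "\<And>\<omega>. \<omega> \<in> space N \<Longrightarrow> delayed t0 k \<tau> (controls t0 T U) (\<lambda>u. \<beta> (\<omega>, u))"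
    by (rule random_strategies_partition[OF \<beta>], rule that)
  have le: "\<tau> j \<le> T" if "j \<le> k" for j
    using that
  proof (induction rule: inc_induct)
    case (step n)
    then show ?case using \<tau>(3)[of n] by auto
  qed (simp add: \<tau>(2))
  show ?thesis
  proof (rule that[of \<tau> k])
    fix \<omega> :: "'w \<times> 'w" assume \<omega>: "fst \<omega> \<in> space M" "snd \<omega> \<in> space N"
    show "delayed t0 k \<tau> (controls t0 T V) (response \<omega>)"
      unfolding delayed_def response_def
    proof (intro ballI allI impI)
      fix v1 v2 j
      assume v: "v1 \<in> controls t0 T V" "v2 \<in> controls t0 T V" "j < k" "AE s in lebesgue_on {t0..\<tau> j}. v1 s = v2 s"
      have "AE s in lebesgue_on {t0..\<tau> j}. \<alpha> (fst \<omega>, v1) s = \<alpha> (fst \<omega>, v2) s"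
        by (rule random_strategies_nonanticipative[OF \<alpha> \<omega>(1) v(1,2) le v(4)]) (use v in auto)
      then show "AE s in lebesgue_on {t0..\<tau> (Suc j)}.
          \<beta> (snd \<omega>, \<alpha> (fst \<omega>, v1)) s = \<beta> (snd \<omega>, \<alpha> (fst \<omega>, v2)) s"
        by (rule delayedD[OF \<tau>(4)[OF \<omega>(2)] \<alpha>_controls[OF \<omega> v(1)] \<alpha>_controls[OF \<omega> v(2)] v(3)])
    qed
  qed (use \<tau> le in auto)
qed

text \<open>Each application makes the iterate stationary on one more cell of the partition. The
  number of cells serves all outcomes and all starting controls at once, which is what makes the
  resulting play measurable.\<close>

lemma iterate_stable:
  obtains n where "\<And>\<omega> v. fst \<omega> \<in> space M \<Longrightarrow> snd \<omega> \<in> space N \<Longrightarrow> v \<in> controls t0 T V \<Longrightarrow>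
    AE s in lebesgue_on {t0..T}. response \<omega> ((response \<omega> ^^ n) v) s = (response \<omega> ^^ n) v s"
proof -
  obtain k \<tau> where \<tau>: "\<tau> 0 = t0" "\<tau> k = T" "\<And>j. j < k \<Longrightarrow> \<tau> (Suc j) \<le> T"
    "\<And>\<omega>. fst \<omega> \<in> space M \<Longrightarrow> snd \<omega> \<in> space N \<Longrightarrow> delayed t0 k \<tau> (controls t0 T V) (response \<omega>)"
    by (rule response_partition, rule that)
  have *: "AE s in lebesgue_on {t0..\<tau> j}. response \<omega> ((response \<omega> ^^ j) v) s = (response \<omega> ^^ j) v s"
    if "j \<le> k" and \<omega>: "fst \<omega> \<in> space M" "snd \<omega> \<in> space N" and v: "v \<in> controls t0 T V" for j \<omega> v
    using that(1)
  proof (induction j)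
    case 0
    show ?case unfolding \<tau>(1) by (rule AE_interval_singleton)
  next
    case (Suc j)
    have "AE s in lebesgue_on {t0..\<tau> (Suc j)}. response \<omega> (response \<omega> ((response \<omega> ^^ j) v)) s = response \<omega> ((response \<omega> ^^ j) v) s"
      using Suc v \<omega> iterate_controls[OF \<omega>] response_controls[OF \<omega>] by (intro delayedD[OF \<tau>(4)[OF \<omega>]]) auto
    then show ?case by simp
  qed
  show ?thesis by (rule that[of k]) (use *[OF order_refl] \<tau>(2) in auto)
qed

lemma is_play_iterate:
  obtains n where "\<And>\<omega> v. fst \<omega> \<in> space M \<Longrightarrow> snd \<omega> \<in> space N \<Longrightarrow> v \<in> controls t0 T V \<Longrightarrow>
    is_play t0 T U V \<alpha> \<beta> \<omega> (\<alpha> (fst \<omega>, (response \<omega> ^^ n) v)) ((response \<omega> ^^ n) v)"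
proof -
  obtain n where n: "\<And>\<omega> v. fst \<omega> \<in> space M \<Longrightarrow> snd \<omega> \<in> space N \<Longrightarrow> v \<in> controls t0 T V \<Longrightarrow>
    AE s in lebesgue_on {t0..T}. response \<omega> ((response \<omega> ^^ n) v) s = (response \<omega> ^^ n) v s"
    by (rule iterate_stable, rule that)
  show ?thesis
  proof (rule that[of n])
    fix \<omega> :: "'w \<times> 'w" and v assume \<omega>: "fst \<omega> \<in> space M" "snd \<omega> \<in> space N" and v: "v \<in> controls t0 T V"
    show "is_play t0 T U V \<alpha> \<beta> \<omega> (\<alpha> (fst \<omega>, (response \<omega> ^^ n) v)) ((response \<omega> ^^ n) v)"
      using n[OF \<omega> v] iterate_controls[OF \<omega> v] \<alpha>_controls[OF \<omega> iterate_controls[OF \<omega> v]]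
      unfolding is_play_def response_def by simp
  qed
qed

text \<open>Being a fixed finite composition of measurable strategies, the iterate provides a play
  that depends measurably on the outcome, which the choice in \<open>play\<close> does not
  display.\<close>

lemma iterate_measurable:
  assumes "v \<in> controls t0 T V"
  shows "(\<lambda>\<omega>. (response \<omega> ^^ n) v) \<in> M \<Otimes>\<^sub>M N \<rightarrow>\<^sub>M control_space t0 T V"
    "(\<lambda>\<omega>. \<alpha> (fst \<omega>, (response \<omega> ^^ n) v)) \<in> M \<Otimes>\<^sub>M N \<rightarrow>\<^sub>M control_space t0 T U"
proof -
  have [measurable]: "\<alpha> \<in> M \<Otimes>\<^sub>M control_space t0 T V \<rightarrow>\<^sub>M control_space t0 T U"
    "\<beta> \<in> N \<Otimes>\<^sub>M control_space t0 T U \<rightarrow>\<^sub>M control_space t0 T V"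
    using \<alpha> \<beta> by (auto simp: random_strategies_def)
  have *: "(\<lambda>\<omega>. \<alpha> (fst \<omega>, f \<omega>)) \<in> M \<Otimes>\<^sub>M N \<rightarrow>\<^sub>M control_space t0 T U"
    if [measurable]: "f \<in> M \<Otimes>\<^sub>M N \<rightarrow>\<^sub>M control_space t0 T V" for f
    by measurable
  show 1: "(\<lambda>\<omega>. (response \<omega> ^^ n) v) \<in> M \<Otimes>\<^sub>M N \<rightarrow>\<^sub>M control_space t0 T V" for n
  proof (induction n)
    case (Suc n)
    note [measurable] = *[OF Suc]
    have eq: "(response \<omega> ^^ Suc n) v = \<beta> (snd \<omega>, \<alpha> (fst \<omega>, (response \<omega> ^^ n) v))" for \<omega>
      by (simp add: response_def[of \<omega> "(response \<omega> ^^ n) v"])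
    show ?case unfolding eq by measurable
  qed (use assms in simp)
  show "(\<lambda>\<omega>. \<alpha> (fst \<omega>, (response \<omega> ^^ n) v)) \<in> M \<Otimes>\<^sub>M N \<rightarrow>\<^sub>M control_space t0 T U"
    by (rule *[OF 1])
qed

lemma is_play_exists:
  assumes "fst \<omega> \<in> space M" "snd \<omega> \<in> space N" "v \<in> controls t0 T V"
  shows "\<exists>u v. is_play t0 T U V \<alpha> \<beta> \<omega> u v"
  by (rule is_play_iterate) (use assms in blast)

context
  fixes \<omega> :: "'w \<times> 'w" assumes \<omega>: "fst \<omega> \<in> space M" "snd \<omega> \<in> space N"
begin

lemma response_fixpoint_unique:
  assumes "v1 \<in> controls t0 T V" "v2 \<in> controls t0 T V"
    "AE s in lebesgue_on {t0..T}. response \<omega> v1 s = v1 s" "AE s in lebesgue_on {t0..T}. response \<omega> v2 s = v2 s"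
  shows "AE s in lebesgue_on {t0..T}. v1 s = v2 s"
proof -
  obtain k \<tau> where \<tau>: "\<tau> 0 = t0" "\<tau> k = T" "\<And>j. j < k \<Longrightarrow> \<tau> (Suc j) \<le> T"
    "\<And>\<omega>. fst \<omega> \<in> space M \<Longrightarrow> snd \<omega> \<in> space N \<Longrightarrow> delayed t0 k \<tau> (controls t0 T V) (response \<omega>)"
    by (rule response_partition, rule that)
  have "AE s in lebesgue_on {t0..\<tau> j}. v1 s = v2 s" if "j \<le> k" for j
    using that
  proof (induction j)
    case 0
    show ?case unfolding \<tau>(1) by (rule AE_interval_singleton)
  next
    case (Suc j)
    have "AE s in lebesgue_on {t0..\<tau> (Suc j)}. response \<omega> v1 s = response \<omega> v2 s"
      using Suc assms \<omega> by (intro delayedD[OF \<tau>(4)[OF \<omega>]]) auto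
    moreover have "AE s in lebesgue_on {t0..\<tau> (Suc j)}. response \<omega> v1 s = v1 s" "AE s in lebesgue_on {t0..\<tau> (Suc j)}. response \<omega> v2 s = v2 s"
      using assms(3,4) \<tau>(3)[of j] Suc.prems by (auto intro: AE_interval_subset)
    ultimately show ?case by eventually_elim simp
  qed
  from this[of k] \<tau>(2) show ?thesis by auto
qed

lemma is_play_fixpoint:
  assumes "is_play t0 T U V \<alpha> \<beta> \<omega> u v"
  shows "AE s in lebesgue_on {t0..T}. response \<omega> v s = v s"
proof -
  have "AE s in lebesgue_on {t0..T}. \<beta> (snd \<omega>, \<alpha> (fst \<omega>, v)) s = \<beta> (snd \<omega>, u) s"
    by (rule random_strategies_nonanticipative[OF \<beta> \<omega>(2)])
      (use assms \<alpha>_controls[OF \<omega>] in \<open>auto simp: is_play_def\<close>)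
  moreover have "AE s in lebesgue_on {t0..T}. \<beta> (snd \<omega>, u) s = v s" using assms by (simp add: is_play_def)
  ultimately show ?thesis unfolding response_def by eventually_elim simp
qed

lemma is_play_unique:
  assumes "is_play t0 T U V \<alpha> \<beta> \<omega> u v" "is_play t0 T U V \<alpha> \<beta> \<omega> u' v'"
  shows "AE s in lebesgue_on {t0..T}. u s = u' s" "AE s in lebesgue_on {t0..T}. v s = v' s"
proof -
  show v: "AE s in lebesgue_on {t0..T}. v s = v' s"
    by (rule response_fixpoint_unique[OF is_play_controls(2)[OF assms(1)] is_play_controls(2)[OF assms(2)]
          is_play_fixpoint[OF assms(1)] is_play_fixpoint[OF assms(2)]])
  have "AE s in lebesgue_on {t0..T}. \<alpha> (fst \<omega>, v) s = \<alpha> (fst \<omega>, v') s"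
    by (rule random_strategies_nonanticipative[OF \<alpha> \<omega>(1) is_play_controls(2)[OF assms(1)]
          is_play_controls(2)[OF assms(2)] order_refl v])
  moreover have "AE s in lebesgue_on {t0..T}. \<alpha> (fst \<omega>, v) s = u s" "AE s in lebesgue_on {t0..T}. \<alpha> (fst \<omega>, v') s = u' s"
    using assms by (auto simp: is_play_def)
  ultimately show "AE s in lebesgue_on {t0..T}. u s = u' s" by eventually_elim simp
qed

lemma play_is_play:
  assumes "is_play t0 T U V \<alpha> \<beta> \<omega> u v"
  shows "is_play t0 T U V \<alpha> \<beta> \<omega> (fst (play t0 T U V \<alpha> \<beta> \<omega>)) (snd (play t0 T U V \<alpha> \<beta> \<omega>))"
  using someI[of "\<lambda>(u, v). is_play t0 T U V \<alpha> \<beta> \<omega> u v" "(u, v)"] assms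
  unfolding play_def is_play_def by (simp add: case_prod_unfold)

end

end

context payoff_data
begin

lemma const_control: "x \<in> X \<Longrightarrow> restrict (\<lambda>_. x) {t0..T} \<in> controls t0 T X"
  by (rule restrict_controls) auto

lemma controls_V_nonempty: "\<exists>v. v \<in> controls t0 T V"
  using V_ne const_control by blast

text \<open>Plays are unique almost everywhere, so the chosen one may be replaced by any convenient
  selection.\<close>

lemma expected_payoff_eq:
  assumes "(M, \<alpha>) \<in> random_strategies E t0 T V U" "(N, \<beta>) \<in> random_strategies E t0 T U V" "0 \<le> t0"
    "\<And>\<omega>. \<omega> \<in> space (M \<Otimes>\<^sub>M N) \<Longrightarrow> is_play t0 T U V \<alpha> \<beta> \<omega> (u \<omega>) (v \<omega>)"
  shows "expected_payoff t0 T U V (l i) (M, \<alpha>) (N, \<beta>) = (\<integral>\<omega>. pay i t0 T (u \<omega>) (v \<omega>) \<partial>(M \<Otimes>\<^sub>M N))"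
  unfolding expected_payoff_def fst_conv snd_conv
proof (rule Bochner_Integration.integral_cong[OF refl])
  fix \<omega> assume \<omega>: "\<omega> \<in> space (M \<Otimes>\<^sub>M N)"
  interpret strategy_pair E t0 T U V M N \<alpha> \<beta> by (rule strategy_pair.intro) fact+
  have \<omega>': "fst \<omega> \<in> space M" "snd \<omega> \<in> space N" using \<omega> by (auto simp: space_pair_measure)
  have p: "is_play t0 T U V \<alpha> \<beta> \<omega> (fst (play t0 T U V \<alpha> \<beta> \<omega>)) (snd (play t0 T U V \<alpha> \<beta> \<omega>))"
    by (rule play_is_play[OF \<omega>' assms(4)[OF \<omega>]])
  have "pay i t0 T (fst (play t0 T U V \<alpha> \<beta> \<omega>)) (snd (play t0 T U V \<alpha> \<beta> \<omega>)) = pay i t0 T (u \<omega>) (v \<omega>)"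
    by (intro pay_cong_AE[OF is_play_controls[OF p] is_play_controls[OF assms(4)[OF \<omega>]]]
        is_play_unique[OF \<omega>' p assms(4)[OF \<omega>]] assms(3) order_refl)
  then show "(case play t0 T U V \<alpha> \<beta> \<omega> of (u, v) \<Rightarrow> LI t0 T (\<lambda>s. l i (s, u s, v s))) = pay i t0 T (u \<omega>) (v \<omega>)"
    by (simp add: case_prod_unfold pay_def)
qed

lemma expected_payoff_abs_le:
  assumes E: "admissible_family E" and a: "a \<in> random_strategies E t0 T V U" "b \<in> random_strategies E t0 T U V" and t0: "0 \<le> t0" "t0 \<le> T"
  shows "\<bar>expected_payoff t0 T U V (l i) a b\<bar> \<le> C * (T - t0)"
proof -
  obtain M \<alpha> N \<beta> where ab: "a = (M, \<alpha>)" "b = (N, \<beta>)" by fastforce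
  interpret strategy_pair E t0 T U V M N \<alpha> \<beta> using a by (auto intro: strategy_pair.intro simp: ab)
  interpret M: prob_space M using a E by (auto simp: ab random_strategies_def admissible_family_def)
  interpret N: prob_space N using a E by (auto simp: ab random_strategies_def admissible_family_def)
  interpret MN: pair_prob_space M N ..
  obtain v0 where v0: "v0 \<in> controls t0 T V" using controls_V_nonempty by blast
  have "\<exists>u v. is_play t0 T U V \<alpha> \<beta> \<omega> u v" if "\<omega> \<in> space (M \<Otimes>\<^sub>M N)" for \<omega>
  proof -
    from that have "fst \<omega> \<in> space M" "snd \<omega> \<in> space N" by (auto simp: space_pair_measure)
    from is_play_exists[OF this v0] show ?thesis .
  qed
  then obtain u v where uv: "\<And>\<omega>. \<omega> \<in> space (M \<Otimes>\<^sub>M N) \<Longrightarrow> is_play t0 T U V \<alpha> \<beta> \<omega> (u \<omega>) (v \<omega>)" by metis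
  have eq: "expected_payoff t0 T U V (l i) a b = (\<integral>\<omega>. pay i t0 T (u \<omega>) (v \<omega>) \<partial>(M \<Otimes>\<^sub>M N))"
    unfolding ab by (rule expected_payoff_eq[OF \<alpha> \<beta> t0(1) uv])
  have bound: "\<bar>pay i t0 T (u \<omega>) (v \<omega>)\<bar> \<le> C * (T - t0)" if "\<omega> \<in> space (M \<Otimes>\<^sub>M N)" for \<omega>
    by (rule pay_abs_le[OF is_play_controls[OF uv[OF that]] t0(1) order_refl t0(2) order_refl])
  show ?thesis
  proof (cases "integrable (M \<Otimes>\<^sub>M N) (\<lambda>\<omega>. pay i t0 T (u \<omega>) (v \<omega>))")
    case True
    have "\<bar>\<integral>\<omega>. pay i t0 T (u \<omega>) (v \<omega>) \<partial>(M \<Otimes>\<^sub>M N)\<bar> \<le> (\<integral>\<omega>. \<bar>pay i t0 T (u \<omega>) (v \<omega>)\<bar> \<partial>(M \<Otimes>\<^sub>M N))"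
      by (rule integral_abs_bound)
    also have "\<dots> \<le> (\<integral>\<omega>. C * (T - t0) \<partial>(M \<Otimes>\<^sub>M N))"
      by (rule integral_mono) (use True bound in auto)
    finally show ?thesis unfolding eq by (simp add: MN.prob_space)
  next
    \<comment> \<open>The selection of plays carries no measurability here; if the integrand is not
      integrable, the expected payoff is 0 by convention and the bound still holds.\<close>
    case False
    then show ?thesis unfolding eq using C_nonneg t0 by (simp add: not_integrable_integral_eq)
  qed
qed

end

section \<open>The game value is at most the cost of a martingale measure\<close>

lemma open_loop_random_strategy:
  assumes "M \<in> E" "h \<in> M \<rightarrow>\<^sub>M control_space t0 T U" "t0 < T"
  shows "(M, \<lambda>(\<omega>, v). h \<omega>) \<in> random_strategies E t0 T V U"
proof -
  have "(\<lambda>x. h (fst x)) \<in> M \<Otimes>\<^sub>M control_space t0 T V \<rightarrow>\<^sub>M control_space t0 T U"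
    by (rule measurable_compose[OF measurable_fst assms(2)])
  then show ?thesis
    unfolding random_strategies_def using assms(1,3)
    by (auto simp: case_prod_unfold intro!: exI[of _ "Suc 0"] exI[of _ "\<lambda>j. if j = 0 then t0 else T"])
qed

lemma random_strategies_nonempty:
  assumes "admissible_family E" "t0 < T" "u \<in> controls t0 T U"
  shows "random_strategies E t0 T V U \<noteq> {}"
proof -
  obtain M where "M \<in> E" using assms(1) by (auto simp: admissible_family_def)
  moreover have "(\<lambda>_. u) \<in> M \<rightarrow>\<^sub>M control_space t0 T U" using assms(3) by simp
  ultimately show ?thesis using open_loop_random_strategy[OF _ _ assms(2)] by blast
qed

context payoff_data
begin

lemma controls_U_nonempty: "\<exists>u. u \<in> controls t0 T U"
  using U_ne const_control by blast

lemma weighted_payoff_abs_le: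
  assumes E: "admissible_family E" and "0 \<le> t0" "t0 \<le> T" "p \<in> prob_simplex"
    and "\<And>i. a i \<in> random_strategies E t0 T V U" "b \<in> random_strategies E t0 T U V"
  shows "\<bar>\<Sum>i\<in>UNIV. p $ i * expected_payoff t0 T U V (l i) (a i) b\<bar> \<le> C * (T - t0)"
  using weighted_diff_le[OF assms(4), of "\<lambda>i. expected_payoff t0 T U V (l i) (a i) b" "\<lambda>_. 0"]
    expected_payoff_abs_le[OF E assms(5,6,2,3)] by simp

lemma SUP_payoff_bdd_above:
  assumes E: "admissible_family E" and "0 \<le> t0" "t0 \<le> T" "p \<in> prob_simplex"
    and "\<And>i. a i \<in> random_strategies E t0 T V U"
  shows "bdd_above ((\<lambda>b. \<Sum>i\<in>UNIV. p $ i * expected_payoff t0 T U V (l i) (a i) b) ` random_strategies E t0 T U V)"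
  using weighted_payoff_abs_le[where a=a, OF assms] by (intro bdd_aboveI2[where M="C * (T - t0)"]) fastforce

lemma INF_SUP_payoff_bdd_below:
  assumes E: "admissible_family E" and t0: "0 \<le> t0" "t0 < T" and p: "p \<in> prob_simplex"
  shows "bdd_below ((\<lambda>a. SUP b\<in>random_strategies E t0 T U V. \<Sum>i\<in>UNIV. p $ i * expected_payoff t0 T U V (l i) (a i) b)
    ` {a. \<forall>i. a i \<in> random_strategies E t0 T V U})"
proof (rule bdd_belowI2[where m="- (C * (T - t0))"])
  fix a :: "'i \<Rightarrow> _" assume "a \<in> {a. \<forall>i. a i \<in> random_strategies E t0 T V U}"
  then have a: "\<And>i. a i \<in> random_strategies E t0 T V U" by auto
  obtain b where b: "b \<in> random_strategies E t0 T U V"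
    using random_strategies_nonempty[OF E t0(2), where V=U and U=V] controls_V_nonempty by blast
  have "- (C * (T - t0)) \<le> (\<Sum>i\<in>UNIV. p $ i * expected_payoff t0 T U V (l i) (a i) b)"
    using weighted_payoff_abs_le[where a=a, OF E t0(1) _ p a b] t0 by auto
  also have "\<dots> \<le> (SUP b\<in>random_strategies E t0 T U V. \<Sum>i\<in>UNIV. p $ i * expected_payoff t0 T U V (l i) (a i) b)"
    by (rule cSUP_upper[OF b SUP_payoff_bdd_above]) (use E t0 p a in auto)
  finally show "- (C * (T - t0)) \<le> \<dots>" .
qed

text \<open>Against a randomly drawn open-loop control the play is explicit, and the payoff is a
  finite average over the drawn index. In this form the law of the index can later be replaced by a
  nearby one.\<close>

lemma expected_payoff_open_loop:
  fixes f :: "'w \<Rightarrow> 'c" and uc :: "'c \<Rightarrow> real \<Rightarrow> 'u"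
  assumes E: "admissible_family E" and t0: "0 \<le> t0" "t0 < T" and M: "M \<in> E"
    and f: "f \<in> M \<rightarrow>\<^sub>M count_space UNIV" and S: "finite S" "\<And>y. y \<in> space M \<Longrightarrow> f y \<in> S"
    and uc: "\<And>c. uc c \<in> controls t0 T U" and \<beta>: "(N, \<beta>) \<in> random_strategies E t0 T U V"
  shows "expected_payoff t0 T U V (l i) (M, \<lambda>(\<omega>, v). uc (f \<omega>)) (N, \<beta>) =
    (\<Sum>c\<in>S. measure M {y \<in> space M. f y = c} * (\<integral>y. pay i t0 T (uc c) (\<beta> (y, uc c)) \<partial>N))"
    "\<And>c. integrable N (\<lambda>y. pay i t0 T (uc c) (\<beta> (y, uc c)))"
proof -
  interpret M: prob_space M using E M by (auto simp: admissible_family_def)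
  have N: "N \<in> E" and \<beta>_meas: "\<beta> \<in> N \<Otimes>\<^sub>M control_space t0 T U \<rightarrow>\<^sub>M control_space t0 T V"
    using \<beta> by (auto simp: random_strategies_def)
  interpret N: prob_space N using E N by (auto simp: admissible_family_def)
  interpret MN: pair_prob_space M N ..
  define J where "J c y = pay i t0 T (uc c) (\<beta> (y, uc c))" for c y
  have \<beta>_in: "\<beta> (y, uc c) \<in> controls t0 T V" if "y \<in> space N" for y c
    by (rule random_strategies_controls[OF \<beta> that uc])
  have J_meas [measurable]: "J c \<in> borel_measurable N" for c
  proof -
    have "(\<lambda>y. (y, uc c)) \<in> N \<rightarrow>\<^sub>M N \<Otimes>\<^sub>M control_space t0 T U"
      by (rule measurable_Pair2') (use uc in auto)
    then have "(\<lambda>y. \<beta> (y, uc c)) \<in> N \<rightarrow>\<^sub>M control_space t0 T V"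
      by (rule measurable_compose[OF _ \<beta>_meas])
    from measurable_compose[OF this pay_measurable_v[OF t0(1) order_refl _ order_refl uc[of c], of i]] t0
    show ?thesis by (simp add: J_def[abs_def])
  qed
  have J_le: "\<bar>J c y\<bar> \<le> C * (T - t0)" if "y \<in> space N" for c y
    unfolding J_def by (rule pay_abs_le[OF uc \<beta>_in[OF that]]) (use t0 in auto)
  show J_int: "integrable N (\<lambda>y. pay i t0 T (uc c) (\<beta> (y, uc c)))" for c
    unfolding J_def[symmetric]
    by (rule N.integrable_const_bound[where B="C * (T - t0)"]) (use J_le J_meas in \<open>auto intro!: AE_I2\<close>)
  have h: "(\<lambda>\<omega>. uc (f \<omega>)) \<in> M \<rightarrow>\<^sub>M control_space t0 T U"
    by (rule measurable_compose[OF f]) (use uc in auto)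
  have \<alpha>: "(M, \<lambda>(\<omega>, v). uc (f \<omega>)) \<in> random_strategies E t0 T V U"
    by (rule open_loop_random_strategy[OF M h t0(2)])
  have play: "is_play t0 T U V (\<lambda>(\<omega>, v). uc (f \<omega>)) \<beta> \<omega> (uc (f (fst \<omega>))) (\<beta> (snd \<omega>, uc (f (fst \<omega>))))"
    if "\<omega> \<in> space (M \<Otimes>\<^sub>M N)" for \<omega>
    using that uc \<beta>_in by (auto simp: is_play_def space_pair_measure)
  have fc [measurable]: "{y \<in> space M. f y = c} \<in> sets M" for c
    using measurable_sets[OF f, of "{c}"] by (simp add: vimage_def Int_def conj_commute)
  have int: "integrable (M \<Otimes>\<^sub>M N) (\<lambda>\<omega>. indicator {y \<in> space M. f y = c} (fst \<omega>) * J c (snd \<omega>))" for c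
  proof (rule MN.integrable_const_bound[where B="C * (T - t0)"])
    show "AE \<omega> in M \<Otimes>\<^sub>M N. norm (indicator {y \<in> space M. f y = c} (fst \<omega>) * J c (snd \<omega>)) \<le> C * (T - t0)"
      using J_le C_nonneg t0 by (intro AE_I2) (auto simp: space_pair_measure indicator_def)
  qed measurable
  have "expected_payoff t0 T U V (l i) (M, \<lambda>(\<omega>, v). uc (f \<omega>)) (N, \<beta>) = (\<integral>\<omega>. J (f (fst \<omega>)) (snd \<omega>) \<partial>(M \<Otimes>\<^sub>M N))"
    unfolding J_def by (rule expected_payoff_eq[OF \<alpha> \<beta> t0(1) play])
  also have "\<dots> = (\<integral>\<omega>. (\<Sum>c\<in>S. indicator {y \<in> space M. f y = c} (fst \<omega>) * J c (snd \<omega>)) \<partial>(M \<Otimes>\<^sub>M N))"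
  proof (rule Bochner_Integration.integral_cong[OF refl])
    fix \<omega> assume "\<omega> \<in> space (M \<Otimes>\<^sub>M N)"
    then have \<omega>: "fst \<omega> \<in> space M" by (auto simp: space_pair_measure)
    have "(\<Sum>c\<in>S. indicator {y \<in> space M. f y = c} (fst \<omega>) * J c (snd \<omega>)) =
      (\<Sum>c\<in>S. if c = f (fst \<omega>) then J c (snd \<omega>) else 0)"
      using \<omega> by (intro sum.cong) (auto simp: indicator_def)
    then show "J (f (fst \<omega>)) (snd \<omega>) = (\<Sum>c\<in>S. indicator {y \<in> space M. f y = c} (fst \<omega>) * J c (snd \<omega>))"
      using S \<omega> by simp
  qed
  also have "\<dots> = (\<Sum>c\<in>S. \<integral>\<omega>. indicator {y \<in> space M. f y = c} (fst \<omega>) * J c (snd \<omega>) \<partial>(M \<Otimes>\<^sub>M N))"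
    by (rule Bochner_Integration.integral_sum) (rule int)
  also have "\<dots> = (\<Sum>c\<in>S. measure M {y \<in> space M. f y = c} * (\<integral>y. J c y \<partial>N))"
    using MN.integral_fst'[OF int, symmetric] by simp
  finally show "expected_payoff t0 T U V (l i) (M, \<lambda>(\<omega>, v). uc (f \<omega>)) (N, \<beta>) =
    (\<Sum>c\<in>S. measure M {y \<in> space M. f y = c} * (\<integral>y. pay i t0 T (uc c) (\<beta> (y, uc c)) \<partial>N))"
    by (simp add: J_def)
qed

text \<open>Entry \<open>k\<close> is the rounded belief at the right end of cell \<open>k\<close>.
  It can be used from the start of that cell, because the signal is drawn before the play.\<close>

definition signal :: "real \<Rightarrow> nat \<Rightarrow> real \<Rightarrow> (real \<Rightarrow> real^'i) \<Rightarrow> nat list" where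
  "signal t0 N h w = map (\<lambda>k. net_index h (w (grid t0 T N (Suc k)))) [0..<N]"

definition signal_control :: "real \<Rightarrow> nat \<Rightarrow> (nat \<Rightarrow> nat \<Rightarrow> 'u) \<Rightarrow> nat list \<Rightarrow> real \<Rightarrow> 'u" where
  "signal_control t0 N uu c = restrict (\<lambda>s. uu (cell t0 T N s) (c ! cell t0 T N s)) {t0..T}"

lemma length_signal [simp]: "length (signal t0 N h w) = N"
  by (simp add: signal_def)

lemma signal_nth: "k < N \<Longrightarrow> signal t0 N h w ! k = net_index h (w (grid t0 T N (Suc k)))"
  by (simp add: signal_def)

lemma signal_control_controls:
  assumes "\<And>k n. uu k n \<in> U"
  shows "signal_control t0 N uu c \<in> controls t0 T U"
  unfolding signal_control_def
  by (rule restrict_controls) (auto intro: assms measurable_compose[OF cell_measurable])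

lemma signal_control_prefix:
  assumes "t0 < T" "k < N" "t0 \<le> s" "s < grid t0 T N (Suc k)" "take (Suc k) c = take (Suc k) c'"
  shows "signal_control t0 N uu c s = signal_control t0 N uu c' s"
proof -
  have "s < T" using grid_bounds(2)[of t0 T N "Suc k"] assms by auto
  then have "grid t0 T N (cell t0 T N s) < grid t0 T N (Suc k)" using cell_bounds[of t0 T N s] assms by auto
  then have "cell t0 T N s < Suc k"
    using grid_mono[of t0 T "Suc k" "cell t0 T N s" N] assms(1) by (force simp: not_less[symmetric])
  then have "c ! cell t0 T N s = c' ! cell t0 T N s" using assms(5) by (metis nth_take)
  then show ?thesis by (simp add: signal_control_def)
qed

text \<open>The opponent is nonanticipative and sees the signal only through the control. Entries
  used on later cells therefore cannot influence the payoff on cell \<open>k\<close>.\<close>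

lemma reply_prefix:
  assumes \<beta>: "(M, \<beta>) \<in> random_strategies E t0 T U V" "y \<in> space M" and t0: "0 \<le> t0" "t0 < T" and k: "k < N"
    and c: "take (Suc k) c = take (Suc k) c'" and uu: "\<And>k n. uu k n \<in> U"
  shows "pay i (grid t0 T N k) (grid t0 T N (Suc k)) (signal_control t0 N uu c) (\<beta> (y, signal_control t0 N uu c)) =
    pay i (grid t0 T N k) (grid t0 T N (Suc k)) (signal_control t0 N uu c') (\<beta> (y, signal_control t0 N uu c'))"
proof -
  note u = signal_control_controls[of uu, OF uu]
  have g: "t0 \<le> grid t0 T N k" "grid t0 T N (Suc k) \<le> T"
    using grid_bounds[of t0 T N k] grid_bounds[of t0 T N "Suc k"] t0 k by auto
  have eq: "AE s in lebesgue_on {t0..grid t0 T N (Suc k)}. signal_control t0 N uu c s = signal_control t0 N uu c' s"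
    using AE_interval_neq[of "grid t0 T N (Suc k)" t0 "grid t0 T N (Suc k)"] unfolding AE_interval_iff
    by eventually_elim (use signal_control_prefix[OF t0(2) k _ _ c] in auto)
  then have "AE s in lebesgue_on {t0..grid t0 T N (Suc k)}. \<beta> (y, signal_control t0 N uu c) s = \<beta> (y, signal_control t0 N uu c') s"
    by (rule random_strategies_nonanticipative[OF \<beta> u u g(2)])
  then show ?thesis using eq g t0
    by (intro pay_cong_AE[OF u random_strategies_controls[OF \<beta> u] u random_strategies_controls[OF \<beta> u]])
      (auto intro: AE_interval_subset)
qed

text \<open>Entry \<open>j\<close> is read at grid point \<open>j + 1\<close>, so the first
  \<open>n\<close> entries are known at grid point \<open>n\<close>.\<close>

lemma signal_sets:
  assumes "t0 \<le> T" "n \<le> N"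
  shows "{w \<in> paths T t0. take n (signal t0 N h w) = d} \<in> sets (path_filtration T t0 (grid t0 T N n))"
proof (cases "length d = n")
  case True
  let ?F = "path_filtration T t0 (grid t0 T N n) :: (real \<Rightarrow> real^'i) measure"
  have "{w \<in> space ?F. \<forall>j\<in>{..<n}. net_index h (w (grid t0 T N (Suc j))) = d ! j} \<in> sets ?F"
  proof (rule sets.sets_Collect_finite_All)
    fix j assume "j \<in> {..<n}"
    then have [measurable]: "(\<lambda>w. w (grid t0 T N (Suc j))) \<in> ?F \<rightarrow>\<^sub>M borel"
      using assms by (intro path_filtration_eval grid_mono) auto
    show "{w \<in> space ?F. net_index h (w (grid t0 T N (Suc j))) = d ! j} \<in> sets ?F"
      by measurable
  qed simp
  also have "{w \<in> space ?F. \<forall>j\<in>{..<n}. net_index h (w (grid t0 T N (Suc j))) = d ! j} =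
      {w \<in> paths T t0. take n (signal t0 N h w) = d}"
    using True assms(2) by (auto simp: list_eq_iff_nth_eq signal_nth)
  finally show ?thesis .
next
  case False
  moreover have "length (take n (signal t0 N h w)) = n" for w using assms(2) by simp
  ultimately have eq: "{w \<in> paths T t0. take n (signal t0 N h w) = d} = {}" by blast
  show ?thesis unfolding eq by simp
qed

lemma integral_signal:
  assumes P: "P \<in> martingale_measures T t0 p0" and t0: "t0 \<le> T" and n: "n \<le> N" and S: "finite S"
    "\<And>w. w \<in> paths T t0 \<Longrightarrow> take n (signal t0 N h w) \<in> S"
  shows "integrable P (\<lambda>w. w r $ i * \<Gamma> (take n (signal t0 N h w)))"
    "(\<integral>w. w r $ i * \<Gamma> (take n (signal t0 N h w)) \<partial>P) =
      (\<Sum>d\<in>S. (\<integral>w. indicator {w \<in> paths T t0. take n (signal t0 N h w) = d} w * w r $ i \<partial>P) * \<Gamma> d :: real)"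
proof -
  interpret path_measure P T t0 by (rule martingale_measures_path_measure[OF P])
  define A where "A d = {w \<in> paths T t0. take n (signal t0 N h w) = d}" for d
  have A: "A d \<in> sets P" for d
    unfolding A_def sets_P using signal_sets[OF t0 n] sets_path_filtration_subset by blast
  have eq: "w r $ i * \<Gamma> (take n (signal t0 N h w)) = (\<Sum>d\<in>S. indicator (A d) w * w r $ i * \<Gamma> d)"
    if "w \<in> space P" for w
  proof -
    have "(\<Sum>d\<in>S. indicator (A d) w * w r $ i * \<Gamma> d) = (\<Sum>d\<in>S. if d = take n (signal t0 N h w) then w r $ i * \<Gamma> d else 0)"
      using that by (intro sum.cong) (auto simp: A_def space_P indicator_def)
    then show ?thesis using S that by (simp add: space_P)
  qed
  have int: "integrable P (\<lambda>w. indicator (A d) w * w r $ i)" for d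
    by (rule integrable_bounded[where B=1]) (use A coord_abs in \<open>auto simp: indicator_def\<close>)
  have "integrable P (\<lambda>w. \<Sum>d\<in>S. indicator (A d) w * w r $ i * \<Gamma> d)"
    using int by (intro Bochner_Integration.integrable_sum integrable_mult_left)
  then show "integrable P (\<lambda>w. w r $ i * \<Gamma> (take n (signal t0 N h w)))"
    using eq by (simp cong: Bochner_Integration.integrable_cong)
  have "(\<integral>w. w r $ i * \<Gamma> (take n (signal t0 N h w)) \<partial>P) = (\<integral>w. (\<Sum>d\<in>S. indicator (A d) w * w r $ i * \<Gamma> d) \<partial>P)"
    by (rule Bochner_Integration.integral_cong[OF refl eq])
  also have "\<dots> = (\<Sum>d\<in>S. (\<integral>w. indicator (A d) w * w r $ i \<partial>P) * \<Gamma> d)"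
    using int by (subst Bochner_Integration.integral_sum) auto
  finally show "(\<integral>w. w r $ i * \<Gamma> (take n (signal t0 N h w)) \<partial>P) =
      (\<Sum>d\<in>S. (\<integral>w. indicator {w \<in> paths T t0. take n (signal t0 N h w) = d} w * w r $ i \<partial>P) * \<Gamma> d)"
    by (simp add: A_def)
qed

text \<open>Since the terminal belief is almost surely a vertex, \<open>w T $ i\<close> is the
  indicator of type \<open>i\<close>. A quantity known at the right end of cell \<open>k\<close> is
  weighted equally by this indicator and by the current belief in \<open>i\<close>.\<close>

lemma signal_martingale:
  fixes \<Gamma> :: "nat list \<Rightarrow> real"
  assumes P: "P \<in> martingale_measures T t0 p0" and t0: "t0 \<le> T" and k: "k < N" and S: "finite S"
    "\<And>w. w \<in> paths T t0 \<Longrightarrow> signal t0 N h w \<in> S"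
    and \<Gamma>: "\<And>c c'. take (Suc k) c = take (Suc k) c' \<Longrightarrow> \<Gamma> c = \<Gamma> c'"
  shows "(\<integral>w. w T $ i * \<Gamma> (signal t0 N h w) \<partial>P) = (\<integral>w. w (grid t0 T N (Suc k)) $ i * \<Gamma> (signal t0 N h w) \<partial>P)"
proof -
  have n: "Suc k \<le> N" using k by simp
  have \<Gamma>': "\<Gamma> (signal t0 N h w) = \<Gamma> (take (Suc k) (signal t0 N h w))" for w by (rule \<Gamma>) simp
  have S': "finite (take (Suc k) ` S)" "\<And>w. w \<in> paths T t0 \<Longrightarrow> take (Suc k) (signal t0 N h w) \<in> take (Suc k) ` S"
    using S by auto
  have eq: "(\<integral>w. w r $ i * \<Gamma> (take (Suc k) (signal t0 N h w)) \<partial>P) =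
      (\<Sum>d\<in>take (Suc k) ` S. (\<integral>w. indicator {w \<in> paths T t0. take (Suc k) (signal t0 N h w) = d} w * w r $ i \<partial>P) * \<Gamma> d)" for r
    by (rule integral_signal(2)[OF P t0 n S'])
  have "0 < N" using n by simp
  have "(\<integral>w. w T $ i * \<Gamma> (take (Suc k) (signal t0 N h w)) \<partial>P) =
      (\<integral>w. w (grid t0 T N (Suc k)) $ i * \<Gamma> (take (Suc k) (signal t0 N h w)) \<partial>P)"
    unfolding eq using martingale_measures_indicator[OF P grid_bounds(2)[OF t0 \<open>0 < N\<close> n] signal_sets[OF t0 n]]
    by (intro sum.cong arg_cong2[where f="(*)"]) auto
  then show ?thesis by (simp only: \<Gamma>'[symmetric])
qed

text \<open>An action is chosen once per cell and rounding class, for a representative belief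
  \<open>q'\<close> at the left end of the cell. The constant 7 collects 1 for near optimality, 1
  for time and 2 for belief in the averaged payoff, and the same 1 and 2 in the Hamiltonian; two
  beliefs of one class are at distance at most \<open>2 * h\<close>.\<close>

lemma near_optimal_actions:
  assumes "0 < e" "0 \<le> t0" "t0 < T"
    and d: "time_step e d"
    and N: "0 < N" "(T - t0) / real N < d" and h: "0 < h" "Lip * h \<le> e"
  obtains uu where "\<And>k n. uu k n \<in> U"
    "\<And>k q s v. k < N \<Longrightarrow> q \<in> prob_simplex \<Longrightarrow> grid t0 T N k \<le> s \<Longrightarrow> s \<le> grid t0 T N (Suc k) \<Longrightarrow> v \<in> V \<Longrightarrow>
      mean q s (uu k (net_index h q)) v \<le> H s q + 7 * e"
proof -
  have g: "grid t0 T N k \<in> {0..T}" if "k \<le> N" for k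
    using grid_bounds[of t0 T N k] assms(2,3) N(1) that by auto
  \<comment> \<open>For an index that no belief is rounded to, the requirement is vacuous and any
    action will do.\<close>
  define Q where "Q k n u \<longleftrightarrow> (k < N \<longrightarrow> (\<exists>q\<in>prob_simplex :: (real^'i) set. net_index h q = n) \<longrightarrow>
    (\<exists>q\<in>prob_simplex. net_index h q = n \<and> (\<forall>v\<in>V. mean q (grid t0 T N k) u v \<le> H (grid t0 T N k) q + e)))" for k n u
  have "\<exists>u\<in>U. k < N \<longrightarrow> (\<exists>q\<in>prob_simplex :: (real^'i) set. net_index h q = n) \<longrightarrow>
    (\<exists>q\<in>prob_simplex. net_index h q = n \<and> (\<forall>v\<in>V. mean q (grid t0 T N k) u v \<le> H (grid t0 T N k) q + e))" for k n
  proof (cases "k < N \<and> (\<exists>q\<in>prob_simplex :: (real^'i) set. net_index h q = n)")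
    case True
    then obtain q :: "real^'i" where q: "q \<in> prob_simplex" "net_index h q = n" by blast
    then obtain u where "u \<in> U" "\<forall>v\<in>V. mean q (grid t0 T N k) u v \<le> H (grid t0 T N k) q + e"
      using H_near_optimal_u[OF q(1) g assms(1), of k] True by auto
    with q show ?thesis by blast
  qed (use U_ne in blast)
  then have "\<forall>k n. \<exists>u. u \<in> U \<and> Q k n u" unfolding Q_def by blast
  then obtain uu where uu': "\<And>k n. uu k n \<in> U" "\<And>k n. Q k n (uu k n)" by metis
  have uu2: "\<exists>q\<in>prob_simplex. net_index h q = n \<and> (\<forall>v\<in>V. mean q (grid t0 T N k) (uu k n) v \<le> H (grid t0 T N k) q + e)"
    if "k < N" "q \<in> prob_simplex" "net_index h q = n" for k n and q :: "real^'i"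
    using uu'(2)[of k n] that unfolding Q_def by blast
  note uu = uu'(1) uu2
  show ?thesis
  proof (rule that[OF uu(1)])
    fix k s v and q :: "real^'i" assume k: "k < N" and q: "q \<in> prob_simplex" and s: "grid t0 T N k \<le> s" "s \<le> grid t0 T N (Suc k)" and v: "v \<in> V"
    let ?t = "grid t0 T N k" and ?u = "uu k (net_index h q)"
    obtain q' where q': "q' \<in> prob_simplex" "net_index h q' = net_index h q" "mean q' ?t ?u v \<le> H ?t q' + e"
      using uu(2)[OF k q refl] v by blast
    have t: "?t \<in> {0..T}" "s \<in> {0..T}" using g[of k] g[of "Suc k"] k s by auto
    have st: "\<bar>s - ?t\<bar> < d" "\<bar>?t - s\<bar> < d" using s N(2) by (auto simp: grid_Suc)
    have "norm (q - q') \<le> dist q (dense_seq (net_index h q)) + dist q' (dense_seq (net_index h q'))"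
      unfolding q'(2) dist_norm[symmetric] by (rule dist_triangle2)
    also have "\<dots> \<le> 2 * h" using net_index[OF h(1), of q] net_index[OF h(1), of q'] by simp
    finally have "Lip * norm (q - q') \<le> Lip * (2 * h)" by (rule mult_left_mono) (rule Lip_nonneg)
    then have L: "Lip * norm (q - q') \<le> 2 * e" using h(2) by simp
    have "\<bar>mean q s ?u v - mean q ?t ?u v\<bar> \<le> e" by (rule time_step_mean[OF d q t(2,1) st(1) uu(1) v])
    moreover have "\<bar>mean q ?t ?u v - mean q' ?t ?u v\<bar> \<le> 2 * e" using mean_diff_le[OF t(1) uu(1) v, where p=q and q=q'] L by (rule order_trans)
    moreover have "\<bar>H ?t q - H ?t q'\<bar> \<le> 2 * e" using H_Lipschitz[OF q q'(1) t(1)] L by (rule order_trans)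
    moreover have "\<bar>H s q - H ?t q\<bar> \<le> e" by (rule time_step_H[OF d q t(2,1) st(1)])
    ultimately show "mean q s ?u v \<le> H s q + 7 * e" using q'(3) by linarith
  qed
qed

text \<open>The opponent's outcome \<open>y\<close> is fixed. The weights are the joint masses of
  type and signal, so the left side is the average payoff without any division by prior
  probabilities. It is split into cells, on each of which the indicator of the type gives way to the
  belief shown there; the action used is nearly optimal for exactly this belief.\<close>

lemma revealed_cost_le:
  assumes P: "P \<in> martingale_measures T t0 p0" and t0: "0 \<le> t0" "t0 < T" and N: "0 < N"
    and S: "finite S" "\<And>w. w \<in> paths T t0 \<Longrightarrow> signal t0 N h w \<in> S"
    and uu: "\<And>k n. uu k n \<in> U"
      "\<And>k q s v. k < N \<Longrightarrow> q \<in> prob_simplex \<Longrightarrow> grid t0 T N k \<le> s \<Longrightarrow> s \<le> grid t0 T N (Suc k) \<Longrightarrow> v \<in> V \<Longrightarrow>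
      mean q s (uu k (net_index h q)) v \<le> H s q + e"
    and \<beta>: "(M, \<beta>) \<in> random_strategies E t0 T U V" "y \<in> space M"
  defines "uc \<equiv> signal_control t0 N uu"
  shows "(\<Sum>i\<in>UNIV. \<Sum>c\<in>S. (\<integral>w. indicator {w \<in> paths T t0. signal t0 N h w = c} w * w T $ i \<partial>P) *
      pay i t0 T (uc c) (\<beta> (y, uc c))) \<le> (\<integral>w. hsum t0 N w \<partial>P) + e * (T - t0)"
proof -
  interpret path_measure P T t0 by (rule martingale_measures_path_measure[OF P])
  have t0': "t0 \<le> T" using t0 by simp
  define g where "g k = grid t0 T N k" for k
  define G where "G k i c = pay i (g k) (g (Suc k)) (uc c) (\<beta> (y, uc c))" for k i c
  have uc: "uc c \<in> controls t0 T U" for c unfolding uc_def by (rule signal_control_controls[OF uu(1)])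
  have vc: "\<beta> (y, uc c) \<in> controls t0 T V" for c by (rule random_strategies_controls[OF \<beta> uc])
  have gb: "t0 \<le> g k" "g k \<le> g (Suc k)" "g (Suc k) \<le> T" if "k < N" for k
    using grid_bounds[of t0 T N] grid_mono[of t0 T k "Suc k" N] that t0 by (auto simp: g_def)
  have pay_sum: "pay i t0 T (uc c) (\<beta> (y, uc c)) = (\<Sum>k<N. G k i c)" for i c
    using LI_grid[OF pay_integrable[OF uc vc t0(1) order_refl order_refl] t0' N order_refl] N
    by (simp add: pay_def G_def g_def)
  have S': "\<And>w. w \<in> paths T t0 \<Longrightarrow> take N (signal t0 N h w) \<in> S" using S(2) by simp
  have int: "integrable P (\<lambda>w. w r $ i * G k i (signal t0 N h w))" for r i k
    using integral_signal(1)[OF P t0' order_refl S(1) S', of r i "G k i"] by simp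
  have "(\<Sum>i\<in>UNIV. \<Sum>c\<in>S. (\<integral>w. indicator {w \<in> paths T t0. signal t0 N h w = c} w * w T $ i \<partial>P) *
      pay i t0 T (uc c) (\<beta> (y, uc c))) =
    (\<Sum>i\<in>UNIV. \<Sum>k<N. \<Sum>c\<in>S. (\<integral>w. indicator {w \<in> paths T t0. signal t0 N h w = c} w * w T $ i \<partial>P) * G k i c)"
    unfolding pay_sum sum_distrib_left by (intro sum.cong refl sum.swap)
  also have "\<dots> = (\<Sum>i\<in>UNIV. \<Sum>k<N. \<integral>w. w T $ i * G k i (signal t0 N h w) \<partial>P)"
    using integral_signal(2)[OF P t0' order_refl S(1) S'] by simp
  \<comment> \<open>On cell \<open>k\<close> the reply is a function of the first
    \<open>k + 1\<close> signal entries, as the martingale argument requires.\<close>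
  also have "\<dots> = (\<Sum>i\<in>UNIV. \<Sum>k<N. \<integral>w. w (g (Suc k)) $ i * G k i (signal t0 N h w) \<partial>P)"
  proof (intro sum.cong refl)
    fix i k assume "k \<in> {..<N}"
    then have k: "k < N" by simp
    show "(\<integral>w. w T $ i * G k i (signal t0 N h w) \<partial>P) = (\<integral>w. w (g (Suc k)) $ i * G k i (signal t0 N h w) \<partial>P)"
      unfolding g_def
      by (rule signal_martingale[OF P t0' k S])
        (auto simp: G_def g_def uc_def intro!: reply_prefix[OF \<beta> t0 k _ uu(1)])
  qed
  also have "\<dots> = (\<integral>w. (\<Sum>k<N. \<Sum>i\<in>UNIV. w (g (Suc k)) $ i * G k i (signal t0 N h w)) \<partial>P)"
    using int by (subst sum.swap) (simp add: Bochner_Integration.integral_sum Bochner_Integration.integrable_sum)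
  also have "\<dots> \<le> (\<integral>w. hsum t0 N w + e * (T - t0) \<partial>P)"
  proof (rule integral_mono)
    show "integrable P (\<lambda>w. \<Sum>k<N. \<Sum>i\<in>UNIV. w (g (Suc k)) $ i * G k i (signal t0 N h w))"
      using int by (intro Bochner_Integration.integrable_sum)
    have "integrable P (hsum t0 N)"
      by (rule integrable_bounded[where B="C * (T - t0)"])
        (use measurable_P[OF hsum_measurable[OF t0(1) t0' N]] hsum_abs_le t0 t0' N in auto)
    then show "integrable P (\<lambda>w. hsum t0 N w + e * (T - t0))" by simp
    fix w assume "w \<in> space P"
    then have w: "w \<in> paths T t0" by (simp add: space_P)
    define c where "c = signal t0 N h w"
    have "(\<Sum>i\<in>UNIV. w (g (Suc k)) $ i * G k i c) \<le> LI (g k) (g (Suc k)) (\<lambda>s. H s (w (g (Suc k)))) + e * (g (Suc k) - g k)"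
      if k: "k < N" for k
    proof -
      let ?q = "w (g (Suc k))"
      have q: "?q \<in> prob_simplex" by (rule paths_simplex[OF w])
      note li = pay_integrable[OF uc vc t0(1) gb(1)[OF k] gb(3)[OF k], of _ c c]
      have Hi: "integrable (lebesgue_on {g k..g (Suc k)}) (\<lambda>s. H s ?q)"
        by (rule H_path_integrable) (use q gb[OF k] t0 in auto)
      have mi: "integrable (lebesgue_on {g k..g (Suc k)}) (\<lambda>s. mean ?q s (uc c s) (\<beta> (y, uc c) s))"
        unfolding mean_def using li by (intro Bochner_Integration.integrable_sum integrable_mult_right)
      have ui: "(\<lambda>s. mean ?q s (uu k (net_index h ?q)) (\<beta> (y, uc c) s)) \<in> borel_measurable (lebesgue_on {g k..g (Suc k)})"
        unfolding mean_def
        by (intro borel_measurable_sum borel_measurable_times borel_measurable_const l_measurable)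
          (use uu(1) controls_measurable[OF vc gb(1)[OF k] gb(3)[OF k]] controls_in[OF vc] gb[OF k] t0 in auto)
      have "(\<Sum>i\<in>UNIV. ?q $ i * G k i c) = LI (g k) (g (Suc k)) (\<lambda>s. mean ?q s (uc c s) (\<beta> (y, uc c) s))"
        unfolding mean_def G_def pay_def using li by (subst Bochner_Integration.integral_sum) auto
      also have "\<dots> = LI (g k) (g (Suc k)) (\<lambda>s. mean ?q s (uu k (net_index h ?q)) (\<beta> (y, uc c) s))"
      proof (rule LI_cong_AE[OF borel_measurable_integrable[OF mi] ui])
        show "AE s in lebesgue_on {g k..g (Suc k)}. mean ?q s (uc c s) (\<beta> (y, uc c) s) = mean ?q s (uu k (net_index h ?q)) (\<beta> (y, uc c) s)"
          using AE_interval_neq[of "g (Suc k)" "g k" "g (Suc k)"] unfolding AE_interval_iff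
        proof eventually_elim
          case (elim s)
          show ?case
          proof
            assume s: "s \<in> {g k..g (Suc k)}"
            with elim have "grid t0 T N k \<le> s" "s < grid t0 T N (Suc k)" by (auto simp: g_def)
            then have "cell t0 T N s = k" using t0 N k by (intro cell_eq) auto
            then have "uc c s = uu k (net_index h ?q)"
              using s gb[OF k] k by (auto simp: uc_def signal_control_def c_def signal_nth g_def)
            then show "mean ?q s (uc c s) (\<beta> (y, uc c) s) = mean ?q s (uu k (net_index h ?q)) (\<beta> (y, uc c) s)" by simp
          qed
        qed
      qed
      also have "\<dots> \<le> LI (g k) (g (Suc k)) (\<lambda>s. H s ?q + e)"
      proof (rule LI_mono)
        have "\<bar>mean ?q s (uu k (net_index h ?q)) (\<beta> (y, uc c) s)\<bar> \<le> C" if "s \<in> {g k..g (Suc k)}" for s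
          using that gb[OF k] t0 by (intro mean_abs_le q uu(1) controls_in[OF vc]) auto
        then show "integrable (lebesgue_on {g k..g (Suc k)}) (\<lambda>s. mean ?q s (uu k (net_index h ?q)) (\<beta> (y, uc c) s))"
          by (rule integrable_interval[OF ui])
        show "integrable (lebesgue_on {g k..g (Suc k)}) (\<lambda>s. H s ?q + e)"
          by (intro Bochner_Integration.integrable_add Hi finite_measure.integrable_const[OF finite_measure_interval])
        fix s assume s: "s \<in> {g k..g (Suc k)}"
        then show "mean ?q s (uu k (net_index h ?q)) (\<beta> (y, uc c) s) \<le> H s ?q + e"
          using gb[OF k] by (intro uu(2) k q controls_in[OF vc]) (auto simp: g_def)
      qed
      also have "\<dots> = LI (g k) (g (Suc k)) (\<lambda>s. H s ?q) + e * (g (Suc k) - g k)"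
        by (subst Bochner_Integration.integral_add[OF Hi finite_measure.integrable_const[OF finite_measure_interval]])
          (simp only: LI_const[OF gb(2)[OF k]])
      finally show ?thesis .
    qed
    then have "(\<Sum>k<N. \<Sum>i\<in>UNIV. w (g (Suc k)) $ i * G k i c) \<le>
        (\<Sum>k<N. LI (g k) (g (Suc k)) (\<lambda>s. H s (w (g (Suc k)))) + e * (g (Suc k) - g k))"
      by (intro sum_mono) auto
    also have "\<dots> = hsum t0 N w + e * (T - t0)"
      using N by (simp add: sum.distrib sum_distrib_left[symmetric] sum_lessThan_telescope hsum_def g_def)
    finally show "(\<Sum>k<N. \<Sum>i\<in>UNIV. w (g (Suc k)) $ i * G k i (signal t0 N h w)) \<le> hsum t0 N w + e * (T - t0)"
      by (simp add: c_def)
  qed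
  also have "\<dots> = (\<integral>w. hsum t0 N w \<partial>P) + e * (T - t0)"
  proof -
    have "integrable P (hsum t0 N)"
      by (rule integrable_bounded[where B="C * (T - t0)"])
        (use measurable_P[OF hsum_measurable[OF t0(1) t0' N]] hsum_abs_le t0 t0' N in auto)
    then show ?thesis by (simp add: prob_space)
  qed
  finally show ?thesis .
qed

lemma game_value_le_martingale:
  assumes E: "admissible_family E" and t0: "0 \<le> t0" "t0 < T" and p0: "p0 \<in> prob_simplex"
    and P: "P \<in> martingale_measures T t0 p0"
  shows "game_value E T U V l t0 p0 \<le> (\<integral>w. hint t0 w \<partial>P)"
proof (rule field_le_epsilon)
  fix e' :: real assume "0 < e'"
  interpret path_measure P T t0 by (rule martingale_measures_path_measure[OF P])
  have t0': "t0 \<le> T" using t0 by simp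
  \<comment> \<open>The budget: one \<open>e\<close> for the cost on the grid, one for the simulated
    laws, and \<open>7 * e\<close> per unit of time for the actions.\<close>
  define e where "e = e' / (2 + 7 * (T - t0))"
  have e: "0 < e" using \<open>0 < e'\<close> t0 by (simp add: e_def)
  have e_eq: "e + 7 * e * (T - t0) + e = e'"
  proof -
    have "e * (2 + 7 * (T - t0)) = e'" using t0 by (simp add: e_def)
    then show ?thesis by (simp add: algebra_simps)
  qed
  obtain d where d: "time_step e d" by (rule time_step_exists[OF e])
  then have d0: "0 < d" by (simp add: time_step_def)
  define h where "h = e / (Lip + 1)"
  have h: "0 < h" "Lip * h \<le> e"
    using e Lip_nonneg by (auto simp: h_def field_simps)
  have "(\<lambda>N. \<integral>w. hsum t0 (Suc N) w \<partial>P) \<longlonglongrightarrow> (\<integral>w. hint t0 w \<partial>P)"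
  proof (rule integral_dominated_convergence[where w="\<lambda>_. C * (T - t0)"])
    show "hint t0 \<in> borel_measurable P" by (rule measurable_P[OF hint_measurable[OF t0(1) t0']])
    show "hsum t0 (Suc N) \<in> borel_measurable P" for N by (rule measurable_P[OF hsum_measurable[OF t0(1) t0']]) simp
    show "AE w in P. (\<lambda>N. hsum t0 (Suc N) w) \<longlonglongrightarrow> hint t0 w"
      by (rule AE_I2) (use hsum_tendsto t0 in \<open>auto simp: space_P\<close>)
    show "AE w in P. norm (hsum t0 (Suc N) w) \<le> C * (T - t0)" for N
      by (rule AE_I2) (use hsum_abs_le t0 t0' in \<open>auto simp: space_P\<close>)
  qed simp
  then have "\<forall>\<^sub>F N in sequentially. (\<integral>w. hsum t0 (Suc N) w \<partial>P) < (\<integral>w. hint t0 w \<partial>P) + e"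
    using e by (intro order_tendstoD(2)) auto
  moreover have "(\<lambda>N. (T - t0) / real (Suc N)) \<longlonglongrightarrow> 0"
    using tendsto_mult[OF tendsto_const LIMSEQ_inverse_real_of_nat, of "T - t0"] by (simp add: divide_inverse)
  then have "\<forall>\<^sub>F N in sequentially. (T - t0) / real (Suc N) < d"
    using d0 by (intro order_tendstoD(2))
  ultimately have "\<forall>\<^sub>F N in sequentially. (\<integral>w. hsum t0 (Suc N) w \<partial>P) < (\<integral>w. hint t0 w \<partial>P) + e \<and> (T - t0) / real (Suc N) < d"
    by (rule eventually_conj)
  from eventually_happens'[OF sequentially_bot this] obtain N' where N': "(\<integral>w. hsum t0 (Suc N') w \<partial>P) < (\<integral>w. hint t0 w \<partial>P) + e" "(T - t0) / real (Suc N') < d"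
    by blast
  define N where "N = Suc N'"
  have N: "0 < N" "(T - t0) / real N < d" "(\<integral>w. hsum t0 N w \<partial>P) \<le> (\<integral>w. hint t0 w \<partial>P) + e"
    using N' by (auto simp: N_def)
  obtain m where m: "\<And>x. x \<in> (prob_simplex :: (real^'i) set) \<Longrightarrow> net_index h x < m"
    by (rule net_index_bounded[OF compact_prob_simplex h(1)], rule that)
  define S where "S = {c. set c \<subseteq> {..<m} \<and> length c = N}"
  have S: "finite S" "\<And>w. w \<in> paths T t0 \<Longrightarrow> signal t0 N h w \<in> S"
    using finite_lists_length_eq[of "{..<m}" N] m by (auto simp: S_def signal_def paths_simplex)
  obtain uu where uu: "\<And>k n. uu k n \<in> U"
    "\<And>k q s v. k < N \<Longrightarrow> q \<in> prob_simplex \<Longrightarrow> grid t0 T N k \<le> s \<Longrightarrow> s \<le> grid t0 T N (Suc k) \<Longrightarrow> v \<in> V \<Longrightarrow>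
      mean q s (uu k (net_index h q)) v \<le> H s q + 7 * e"
    by (rule near_optimal_actions[OF e t0 d N(1,2) h], rule that)
  define uc where "uc = signal_control t0 N uu"
  have uc: "uc c \<in> controls t0 T U" for c unfolding uc_def by (rule signal_control_controls[OF uu(1)])
  define A where "A c = {w \<in> paths T t0. signal t0 N h w = c}" for c
  have A: "A c \<in> sets P" for c
    using signal_sets[OF t0' order_refl, of N h c] sets_path_filtration_subset by (auto simp: A_def sets_P)
  \<comment> \<open>The terminal belief is a vertex, so this is the joint probability of type
    \<open>i\<close> and signal \<open>c\<close>.\<close>
  define \<mu> where "\<mu> i c = (\<integral>w. indicator (A c) w * w T $ i \<partial>P)" for i c
  have \<mu>_nonneg: "0 \<le> \<mu> i c" for i c
    unfolding \<mu>_def by (intro Bochner_Integration.integral_nonneg) (auto simp: space_P coord_bounds)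
  have S': "\<And>w. w \<in> paths T t0 \<Longrightarrow> take N (signal t0 N h w) \<in> S" using S(2) by simp
  have \<mu>_sum: "(\<Sum>c\<in>S. \<mu> i c) = p0 $ i" for i
    using integral_signal(2)[OF P t0' order_refl S(1) S', of T i "\<lambda>_. 1"] martingale_measures_mean[OF P, of T i]
    by (simp add: \<mu>_def A_def)
  have S_ne: "S \<noteq> {}"
  proof -
    obtain w where "w \<in> space P" using not_empty by blast
    then show ?thesis using S(2)[of w] by (auto simp: space_P)
  qed
  then obtain c0 where c0: "c0 \<in> S" by blast
  \<comment> \<open>The conditional law of the signal given the type. A type of probability zero
    gets a point mass, since its strategy must still be some genuine random strategy.\<close>
  define x where "x i c = (if p0 $ i = 0 then (if c = c0 then 1 else 0) else \<mu> i c / p0 $ i)" for i c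
  have p0_nonneg: "0 \<le> p0 $ i" for i by (rule prob_simplex_nonneg[OF p0])
  have x_nonneg: "0 \<le> x i c" for i c using \<mu>_nonneg p0_nonneg by (simp add: x_def)
  have x_sum: "(\<Sum>c\<in>S. x i c) = 1" for i
    using S(1) c0 \<mu>_sum[of i] by (cases "p0 $ i = 0") (auto simp: x_def sum_divide_distrib[symmetric])
  have px: "p0 $ i * x i c = \<mu> i c" if "c \<in> S" for i c
  proof (cases "p0 $ i = 0")
    case True
    then have "(\<Sum>c\<in>S. \<mu> i c) = 0" using \<mu>_sum by simp
    then have "\<mu> i c = 0" using that S(1) \<mu>_nonneg by (simp add: sum_nonneg_eq_0_iff)
    then show ?thesis using True by simp
  qed (simp add: x_def)
  define B where "B = C * (T - t0)"
  have B: "0 \<le> B" using C_nonneg t0 by (simp add: B_def)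
  define e2 where "e2 = e / (B + 1)"
  \<comment> \<open>A total variation error \<open>e2\<close> changes an average of payoffs bounded
    by \<open>B\<close> by at most \<open>e\<close>.\<close>
  have e2: "0 < e2" "e2 * B \<le> e" using e B by (auto simp: e2_def field_simps)
  define R where "R i z \<longleftrightarrow> fst z \<in> E \<and> snd z \<in> fst z \<rightarrow>\<^sub>M count_space UNIV \<and> (\<forall>y\<in>space (fst z). snd z y \<in> S) \<and>
    (\<Sum>c\<in>S. \<bar>measure (fst z) {y \<in> space (fst z). snd z y = c} - x i c\<bar>) \<le> e2" for i z
  have "\<exists>z. R i z" for i
  proof (rule admissible_approximates_law[OF E S(1) x_nonneg x_sum e2(1), of i])
    fix M f assume "M \<in> E" "f \<in> M \<rightarrow>\<^sub>M count_space UNIV" "\<And>y. y \<in> space M \<Longrightarrow> f y \<in> S"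
      "(\<Sum>c\<in>S. \<bar>measure M {y \<in> space M. f y = c} - x i c\<bar>) \<le> e2"
    then show ?thesis unfolding R_def by (intro exI[of _ "(M, f)"]) simp
  qed
  then obtain z where z: "\<And>i. R i (z i)" using choice[of R] by blast
  define M where "M i = fst (z i)" for i
  define f where "f i = snd (z i)" for i
  have M: "\<And>i. M i \<in> E" and f: "\<And>i. f i \<in> M i \<rightarrow>\<^sub>M count_space UNIV"
    "\<And>i y. y \<in> space (M i) \<Longrightarrow> f i y \<in> S"
    and fx: "\<And>i. (\<Sum>c\<in>S. \<bar>measure (M i) {y \<in> space (M i). f i y = c} - x i c\<bar>) \<le> e2"
    using z unfolding R_def M_def f_def by blast+
  define a where "a i = (M i, \<lambda>(\<omega>, v::real \<Rightarrow> 'v). uc (f i \<omega>))" for i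
  have a: "a i \<in> random_strategies E t0 T V U" for i
    unfolding a_def
    by (rule open_loop_random_strategy[OF M measurable_compose[OF f(1)] t0(2)]) (use uc in auto)
  have bound: "(\<Sum>i\<in>UNIV. p0 $ i * expected_payoff t0 T U V (l i) (a i) b) \<le> (\<integral>w. hint t0 w \<partial>P) + e'"
    if b: "b \<in> random_strategies E t0 T U V" for b
  proof -
    obtain M' \<beta> where b_eq: "b = (M', \<beta>)" by fastforce
    have \<beta>: "(M', \<beta>) \<in> random_strategies E t0 T U V" using b b_eq by simp
    interpret M': prob_space M' using E \<beta> by (auto simp: random_strategies_def admissible_family_def)
    define J where "J i c y = pay i t0 T (uc c) (\<beta> (y, uc c))" for i c y
    have J_le: "\<bar>J i c y\<bar> \<le> B" if "y \<in> space M'" for i c y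
      unfolding J_def B_def
      by (rule pay_abs_le[OF uc random_strategies_controls[OF \<beta> that uc] t0(1) order_refl t0' order_refl])
    have J_int: "integrable M' (J i c)" for i c
      unfolding J_def[abs_def] by (rule expected_payoff_open_loop(2)[OF E t0 M f(1) S(1) f(2) uc \<beta>])
    define JJ where "JJ i c = (\<integral>y. J i c y \<partial>M')" for i c
    have JJ_le: "\<bar>JJ i c\<bar> \<le> B" for i c
    proof -
      have "\<bar>JJ i c\<bar> \<le> (\<integral>y. \<bar>J i c y\<bar> \<partial>M')" unfolding JJ_def by (rule integral_abs_bound)
      also have "\<dots> \<le> (\<integral>y. B \<partial>M')" by (rule integral_mono) (use J_int J_le in auto)
      finally show ?thesis by (simp add: M'.prob_space)
    qed
    have pay_le: "expected_payoff t0 T U V (l i) (a i) b \<le> (\<Sum>c\<in>S. x i c * JJ i c) + e" for i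
    proof -
      define \<nu> where "\<nu> c = measure (M i) {y \<in> space (M i). f i y = c}" for c
      have "expected_payoff t0 T U V (l i) (a i) b = (\<Sum>c\<in>S. \<nu> c * JJ i c)"
        unfolding a_def b_eq \<nu>_def JJ_def J_def
        by (rule expected_payoff_open_loop(1)[OF E t0 M f(1) S(1) f(2) uc \<beta>])
      also have "\<dots> = (\<Sum>c\<in>S. x i c * JJ i c) + (\<Sum>c\<in>S. (\<nu> c - x i c) * JJ i c)"
        by (simp add: sum.distrib[symmetric] algebra_simps)
      also have "(\<Sum>c\<in>S. (\<nu> c - x i c) * JJ i c) \<le> (\<Sum>c\<in>S. \<bar>\<nu> c - x i c\<bar> * B)"
      proof (rule sum_mono)
        fix c
        have "(\<nu> c - x i c) * JJ i c \<le> \<bar>\<nu> c - x i c\<bar> * \<bar>JJ i c\<bar>" by (metis abs_ge_self abs_mult)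
        also have "\<dots> \<le> \<bar>\<nu> c - x i c\<bar> * B" by (rule mult_left_mono[OF JJ_le]) simp
        finally show "(\<nu> c - x i c) * JJ i c \<le> \<bar>\<nu> c - x i c\<bar> * B" .
      qed
      also have "\<dots> \<le> e2 * B"
        unfolding sum_distrib_right[symmetric] using fx[of i] B by (intro mult_right_mono) (auto simp: \<nu>_def)
      finally show ?thesis using e2(2) by simp
    qed
    have "(\<Sum>i\<in>UNIV. p0 $ i * expected_payoff t0 T U V (l i) (a i) b) \<le>
        (\<Sum>i\<in>UNIV. p0 $ i * ((\<Sum>c\<in>S. x i c * JJ i c) + e))"
      using pay_le p0_nonneg by (intro sum_mono mult_left_mono)
    also have "\<dots> = (\<Sum>i\<in>UNIV. \<Sum>c\<in>S. \<mu> i c * JJ i c) + e"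
      using px prob_simplex_sum[OF p0]
      by (simp add: distrib_left sum.distrib sum_distrib_right[symmetric] sum_distrib_left mult.assoc[symmetric])
    also have "(\<Sum>i\<in>UNIV. \<Sum>c\<in>S. \<mu> i c * JJ i c) = (\<integral>y. (\<Sum>i\<in>UNIV. \<Sum>c\<in>S. \<mu> i c * J i c y) \<partial>M')"
      unfolding JJ_def using J_int by (simp add: Bochner_Integration.integral_sum Bochner_Integration.integrable_sum)
    also have "\<dots> \<le> (\<integral>y. (\<integral>w. hsum t0 N w \<partial>P) + 7 * e * (T - t0) \<partial>M')"
    proof (rule integral_mono)
      show "integrable M' (\<lambda>y. \<Sum>i\<in>UNIV. \<Sum>c\<in>S. \<mu> i c * J i c y)"
        using J_int by (intro Bochner_Integration.integrable_sum integrable_mult_right)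
      fix y assume y: "y \<in> space M'"
      have "(\<Sum>i\<in>UNIV. \<Sum>c\<in>S. (\<integral>w. indicator {w \<in> paths T t0. signal t0 N h w = c} w * w T $ i \<partial>P) *
          pay i t0 T (signal_control t0 N uu c) (\<beta> (y, signal_control t0 N uu c))) \<le> (\<integral>w. hsum t0 N w \<partial>P) + 7 * e * (T - t0)"
        by (rule revealed_cost_le[OF P t0 N(1) S uu \<beta> y])
      then show "(\<Sum>i\<in>UNIV. \<Sum>c\<in>S. \<mu> i c * J i c y) \<le> (\<integral>w. hsum t0 N w \<partial>P) + 7 * e * (T - t0)"
        by (simp add: \<mu>_def A_def J_def uc_def)
    qed simp
    also have "\<dots> = (\<integral>w. hsum t0 N w \<partial>P) + 7 * e * (T - t0)" by (simp add: M'.prob_space)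
    finally show ?thesis using N(3) e_eq by linarith
  qed
  have "game_value E T U V l t0 p0 \<le> (SUP b\<in>random_strategies E t0 T U V. \<Sum>i\<in>UNIV. p0 $ i * expected_payoff t0 T U V (l i) (a i) b)"
    unfolding game_value_def using t0(2) INF_SUP_payoff_bdd_below[OF E t0 p0] a
    by (simp only: if_True) (rule cINF_lower, auto)
  also have "\<dots> \<le> (\<integral>w. hint t0 w \<partial>P) + e'"
  proof (rule cSUP_least[OF _ bound])
    show "random_strategies E t0 T U V \<noteq> {}"
      using random_strategies_nonempty[OF E t0(2), where V=U and U=V] controls_V_nonempty by blast
  qed
  finally show "game_value E T U V l t0 p0 \<le> (\<integral>w. hint t0 w \<partial>P) + e'" .
qed

end

section \<open>A regularized potential\<close>

text \<open>The convex conjugate of \<open>W\<close> plus \<open>d\<close> times the squared norm,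
  restricted to \<open>Q\<close>. The potential is nonpositive at \<open>x\<close> exactly when the
  linear function \<open>x\<close> lies below this regularized function on \<open>Q\<close>. Strong
  convexity makes the conjugate differentiable with Lipschitz gradient, the gradient being the
  maximizing \<open>q\<close>.\<close>

definition pot :: "(real^'i::finite) set \<Rightarrow> real \<Rightarrow> (real^'i \<Rightarrow> real) \<Rightarrow> real^'i \<Rightarrow> real" where
  "pot Q d W x = (SUP q\<in>Q. x \<bullet> q - W q - d * (norm q)\<^sup>2)"

context
  fixes Q :: "(real^'i::finite) set" and d B :: real
  assumes Q: "convex Q" "Q \<noteq> {}" "\<And>q. q \<in> Q \<Longrightarrow> norm q \<le> 1" and d: "0 < d"
begin

context
  fixes W assumes W: "\<And>q. q \<in> Q \<Longrightarrow> \<bar>W q\<bar> \<le> B"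
begin

lemma pot_bdd: "bdd_above ((\<lambda>q. x \<bullet> q - W q - d * (norm q)\<^sup>2) ` Q)"
proof (rule bdd_aboveI2)
  fix q assume q: "q \<in> Q"
  have "x \<bullet> q \<le> norm x * norm q" by (rule norm_cauchy_schwarz)
  also have "\<dots> \<le> norm x * 1" by (rule mult_left_mono[OF Q(3)[OF q]]) simp
  finally show "x \<bullet> q - W q - d * (norm q)\<^sup>2 \<le> norm x + B"
    using W[OF q] mult_nonneg_nonneg[OF less_imp_le[OF d] zero_le_power2[of "norm q"]] by linarith
qed

lemma pot_upper: "q \<in> Q \<Longrightarrow> x \<bullet> q - W q - d * (norm q)\<^sup>2 \<le> pot Q d W x"
  unfolding pot_def by (rule cSUP_upper[OF _ pot_bdd])

lemma pot_least: "(\<And>q. q \<in> Q \<Longrightarrow> x \<bullet> q - W q - d * (norm q)\<^sup>2 \<le> c) \<Longrightarrow> pot Q d W x \<le> c"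
  unfolding pot_def by (rule cSUP_least[OF Q(2)])

lemma pot_near: "0 < e \<Longrightarrow> \<exists>q\<in>Q. pot Q d W x - e < x \<bullet> q - W q - d * (norm q)\<^sup>2"
  unfolding pot_def using less_cSUP_iff[OF Q(2) pot_bdd, of "(SUP q\<in>Q. x \<bullet> q - W q - d * (norm q)\<^sup>2) - e" x] by auto

lemma pot_Lipschitz: "pot Q d W x \<le> pot Q d W y + norm (x - y)"
proof (rule pot_least)
  fix q assume q: "q \<in> Q"
  have "(x - y) \<bullet> q \<le> norm (x - y) * norm q" by (rule norm_cauchy_schwarz)
  also have "\<dots> \<le> norm (x - y) * 1" by (rule mult_left_mono[OF Q(3)[OF q]]) simp
  finally show "x \<bullet> q - W q - d * (norm q)\<^sup>2 \<le> pot Q d W y + norm (x - y)"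
    using pot_upper[OF q, of y] by (simp add: inner_diff_left)
qed

end

text \<open>The quadratic term makes near maximizers of the potential almost stable: moving the state by
  \<open>- h\<close> changes the potential by \<open>- h \<bullet> q\<close> up to an error of second order in \<open>h\<close>.\<close>

lemma pot_move:
  assumes W: "convex_on Q W" "\<And>q. q \<in> Q \<Longrightarrow> \<bar>W q\<bar> \<le> B"
    and q: "q \<in> Q" "pot Q d W x - e \<le> x \<bullet> q - W q - d * (norm q)\<^sup>2"
  shows "pot Q d W (x - h) \<le> pot Q d W x + e - h \<bullet> q + (norm h)\<^sup>2 / (2 * d)"
proof (rule pot_least[OF W(2)])
  fix r assume r: "r \<in> Q"
  \<comment> \<open>Strong concavity is used at the midpoint: if both \<open>r\<close> and
    \<open>q\<close> were nearly maximal and far apart, their midpoint would beat the supremum.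
    Hence \<open>r\<close> loses at least \<open>d * (norm (r - q))\<^sup>2 / 2\<close>, up to
    \<open>e\<close>.\<close>
  define m where "m = (1/2) *\<^sub>R r + (1/2) *\<^sub>R q"
  define G where "G q = x \<bullet> q - W q - d * (norm q)\<^sup>2" for q
  have m: "m \<in> Q" unfolding m_def by (rule convexD[OF Q(1) r q(1)]) auto
  have Wm: "W m \<le> W r / 2 + W q / 2"
    using convex_onD[OF W(1), of "1/2" r q] r q(1) by (simp add: m_def)
  have nm: "(norm m)\<^sup>2 = (norm r)\<^sup>2 / 2 + (norm q)\<^sup>2 / 2 - (norm (r - q))\<^sup>2 / 4"
    by (simp add: m_def power2_norm_eq_inner inner_add inner_diff inner_commute field_simps)
  have "G r / 2 + G q / 2 + d * (norm (r - q))\<^sup>2 / 4 \<le> G m"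
  proof -
    have xm: "x \<bullet> m = x \<bullet> r / 2 + x \<bullet> q / 2" by (simp add: m_def inner_add)
    have "d * (norm m)\<^sup>2 = d * (norm r)\<^sup>2 / 2 + d * (norm q)\<^sup>2 / 2 - d * (norm (r - q))\<^sup>2 / 4"
      unfolding nm by (simp add: algebra_simps)
    then show ?thesis using Wm xm unfolding G_def diff_divide_distrib by linarith
  qed
  moreover have "G m \<le> pot Q d W x" unfolding G_def by (rule pot_upper[OF W(2) m])
  moreover have "pot Q d W x - e \<le> G q" using q(2) by (simp add: G_def)
  ultimately have Gr: "G r \<le> pot Q d W x + e - d * (norm (r - q))\<^sup>2 / 2" by linarith
  have "- (h \<bullet> (r - q)) \<le> norm h * norm (r - q)" using norm_cauchy_schwarz[of "- h" "r - q"] by simp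
  \<comment> \<open>Young's inequality, weighted so that its second term is exactly the loss from
    strong concavity.\<close>
  also have "\<dots> \<le> (norm h)\<^sup>2 / (2 * d) + d * (norm (r - q))\<^sup>2 / 2"
  proof -
    have "0 \<le> (norm h - d * norm (r - q))\<^sup>2 / (2 * d)" using d by simp
    also have "\<dots> = (norm h)\<^sup>2 / (2 * d) + d * (norm (r - q))\<^sup>2 / 2 - norm h * norm (r - q)"
      using d by (simp add: power2_eq_square field_simps)
    finally show ?thesis by simp
  qed
  finally have "- (h \<bullet> r) \<le> - (h \<bullet> q) + (norm h)\<^sup>2 / (2 * d) + d * (norm (r - q))\<^sup>2 / 2"
    by (simp add: inner_diff_right)
  moreover have "(x - h) \<bullet> r - W r - d * (norm r)\<^sup>2 = G r - h \<bullet> r" by (simp add: G_def inner_diff_left)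
  ultimately show "(x - h) \<bullet> r - W r - d * (norm r)\<^sup>2 \<le> pot Q d W x + e - h \<bullet> q + (norm h)\<^sup>2 / (2 * d)"
    using Gr by linarith
qed

text \<open>One cell of the tracking argument. The direction \<open>q\<close> is computed from a
  rounded state \<open>y\<close>, not from \<open>x\<close>: exchanging the two costs
  \<open>e\<close> twice, and near maximality of \<open>q\<close> costs \<open>e\<close> twice more.
  What \<open>q\<close> collects, \<open>h \<bullet> q\<close>, pays for the decrease from
  \<open>W\<close> to \<open>W'\<close>.\<close>

lemma pot_step:
  assumes W: "\<And>q. q \<in> Q \<Longrightarrow> \<bar>W q\<bar> \<le> B" and W': "convex_on Q W'" "\<And>q. q \<in> Q \<Longrightarrow> \<bar>W' q\<bar> \<le> B"
    and g: "\<And>q. q \<in> Q \<Longrightarrow> W q \<le> g q + W' q"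
    and q: "q \<in> Q" "pot Q d W' y - e \<le> y \<bullet> q - W' q - d * (norm q)\<^sup>2"
    and xy: "norm (x - y) \<le> e" and h: "g q - e' \<le> h \<bullet> q"
  shows "pot Q d W' (x - h) \<le> pot Q d W x + 4 * e + e' + (norm h)\<^sup>2 / (2 * d)"
proof -
  have "pot Q d W' (x - h) \<le> pot Q d W' (y - h) + e"
    using pot_Lipschitz[where W=W' and x="x - h" and y="y - h", OF W'(2)] xy by simp
  moreover have "pot Q d W' (y - h) \<le> pot Q d W' y + e - h \<bullet> q + (norm h)\<^sup>2 / (2 * d)"
    by (rule pot_move[OF W' q])
  moreover have "y \<bullet> q - W q - d * (norm q)\<^sup>2 \<le> pot Q d W y" by (rule pot_upper[where W=W, OF W q(1)])
  moreover have "pot Q d W y \<le> pot Q d W x + e"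
    using pot_Lipschitz[where W=W and x=y and y=x, OF W] xy by (simp add: norm_minus_commute)
  ultimately show ?thesis using q(2) g[OF q(1)] h by linarith
qed

end

text \<open>The smallest face of the simplex containing \<open>p\<close>: the beliefs that do not
  charge types excluded by \<open>p\<close>.\<close>

definition face :: "real^'i::finite \<Rightarrow> (real^'i) set" where
  "face p = {q \<in> prob_simplex. \<forall>i. p $ i = 0 \<longrightarrow> q $ i = 0}"

lemma convex_face: "convex (face p)"
proof -
  have "convex {q. \<forall>i. p $ i = 0 \<longrightarrow> q $ i = 0}" by (auto simp: convex_def)
  then have "convex (prob_simplex \<inter> {q. \<forall>i. p $ i = 0 \<longrightarrow> q $ i = 0})"
    by (rule convex_Int[OF convex_prob_simplex])
  then show ?thesis by (simp add: face_def Int_def)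
qed

lemma face_simplex: "q \<in> face p \<Longrightarrow> q \<in> prob_simplex"
  by (simp add: face_def)

text \<open>On its face of the simplex, \<open>p\<close> is a relative interior point, whence a supporting hyperplane
  exists there without any semicontinuity of \<open>W\<close>.\<close>

lemma convex_face_minorant:
  fixes p :: "real^'i::finite"
  assumes p: "p \<in> prob_simplex" and W: "convex_on (face p) W" and e: "0 < e"
  obtains a where "\<And>q. q \<in> face p \<Longrightarrow> a \<bullet> q \<le> W q" "W p - e \<le> a \<bullet> p"
proof -
  define S where "S = epigraph (face p) W"
  have pf: "p \<in> face p" using p by (simp add: face_def)
  have inS: "(q, y) \<in> S \<longleftrightarrow> q \<in> face p \<and> W q \<le> y" for q y by (simp add: S_def epigraph_def)
  have S: "convex S" unfolding S_def using W convex_face by (simp add: convex_epigraph)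
  have "(p, W p) \<in> S" using pf by (simp add: inS)
  then have "S \<noteq> {}" by auto
  moreover have "(p, W p - e) \<notin> S" using e by (simp add: inS)
  ultimately obtain bc \<gamma> where hull: "(p, W p - e) + bc \<in> affine hull (insert (p, W p - e) S)"
    and bc: "bc \<noteq> 0" "bc \<bullet> (p, W p - e) \<le> \<gamma>" "\<And>x. x \<in> S \<Longrightarrow> \<gamma> \<le> bc \<bullet> x"
    using separating_hyperplane_set_point_inaff[OF S] by (metis (no_types, lifting))
  obtain b c where bc_eq: "bc = (b, c)" by fastforce
  \<comment> \<open>An affine set containing the epigraph and the point below it. The separating
    normal is parallel to their affine hull, so its part \<open>b\<close> has coordinate sum 0 and
    vanishes off the support of \<open>p\<close>.\<close>
  define A where "A = {x :: (real^'i) \<times> real. (\<Sum>i\<in>UNIV. fst x $ i) = 1 \<and> (\<forall>i. p $ i = 0 \<longrightarrow> fst x $ i = 0)}"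
  have "affine A"
    unfolding affine_def A_def by (auto simp: sum.distrib sum_distrib_left[symmetric])
  moreover have "insert (p, W p - e) S \<subseteq> A"
    using pf by (auto simp: A_def inS face_def prob_simplex_def)
  ultimately have "affine hull (insert (p, W p - e) S) \<subseteq> A" by (rule hull_minimal[rotated])
  then have "(p + b, W p - e + c) \<in> A" using hull by (auto simp: bc_eq)
  then have b: "(\<Sum>i\<in>UNIV. b $ i) = 0" "\<And>i. p $ i = 0 \<Longrightarrow> b $ i = 0"
    using prob_simplex_sum[OF p] by (auto simp: A_def sum.distrib)
  have sep: "b \<bullet> p + c * (W p - e) \<le> b \<bullet> q + c * y" if "q \<in> face p" "W q \<le> y" for q y
    using bc(2) bc(3)[of "(q, y)"] that by (simp add: inS bc_eq)
  have "0 \<le> c * e" using sep[OF pf order_refl] by (simp add: right_diff_distrib)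
  then have c0: "0 \<le> c" using e by (simp add: zero_le_mult_iff)
  \<comment> \<open>With \<open>c = 0\<close> the hyperplane would be vertical and \<open>b\<close>
    a nonzero direction inside the face. A small move from \<open>p\<close> against \<open>b\<close>
    stays in the face and violates the separation.\<close>
  have c: "0 < c"
  proof (rule ccontr)
    assume "\<not> 0 < c"
    then have c: "c = 0" using c0 by simp
    then have b0: "b \<noteq> 0" using bc(1) bc_eq by (simp add: zero_prod_def)
    define m where "m = Min ((\<lambda>i. p $ i) ` {i. p $ i \<noteq> 0})"
    have ne: "{i. p $ i \<noteq> 0} \<noteq> {}" using b0 b(2) by (auto simp: vec_eq_iff)
    have "m \<in> (\<lambda>i. p $ i) ` {i. p $ i \<noteq> 0}" unfolding m_def by (rule Min_in) (use ne in auto)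
    then have "0 < m" using prob_simplex_nonneg[OF p] by (auto simp: less_le)
    moreover have "m \<le> p $ i" if "p $ i \<noteq> 0" for i
      unfolding m_def by (rule Min_le) (use that in auto)
    ultimately have m: "0 < m" "\<And>i. p $ i \<noteq> 0 \<Longrightarrow> m \<le> p $ i" by auto
    \<comment> \<open>The step has length \<open>m\<close>, the least positive coordinate of
      \<open>p\<close>, so no coordinate becomes negative.\<close>
    define t where "t = m / norm b"
    have t: "0 < t" using m b0 by (simp add: t_def)
    have "0 \<le> p $ i - t * b $ i" for i
    proof (cases "p $ i = 0")
      case False
      have "t * b $ i \<le> t * norm b" using t component_le_norm_cart[of b i] by (intro mult_left_mono) auto
      also have "\<dots> = m" using b0 by (simp add: t_def)
      finally show ?thesis using m(2)[OF False] by simp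
    qed (simp add: b(2))
    then have "p - t *\<^sub>R b \<in> face p"
      using b prob_simplex_sum[OF p] by (auto simp: face_def prob_simplex_def sum_subtractf sum_distrib_left[symmetric])
    from sep[OF this order_refl] have "t * (b \<bullet> b) \<le> 0" by (simp add: c inner_diff_right)
    moreover have "0 < t * (b \<bullet> b)" using t b0 by simp
    ultimately show False by simp
  qed
  \<comment> \<open>The hyperplane is affine in \<open>q\<close>. On the simplex its constant term
    can be spread over the coordinates, since they sum to 1, which makes it linear.\<close>
  define \<kappa> where "\<kappa> = (b \<bullet> p) / c + W p - e"
  define a where "a = (\<chi> i. \<kappa> - b $ i / c)"
  have a: "a \<bullet> q = \<kappa> - (b \<bullet> q) / c" if "q \<in> prob_simplex" for q
    using prob_simplex_sum[OF that]
    by (simp add: a_def inner_vec_def left_diff_distrib sum_subtractf sum_distrib_left[symmetric] sum_divide_distrib)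
  show ?thesis
  proof (rule that[of a])
    fix q assume q: "q \<in> face p"
    have "(b \<bullet> p + c * (W p - e)) / c \<le> (b \<bullet> q + c * W q) / c"
      by (rule divide_right_mono[OF sep[OF q order_refl] c0])
    then show "a \<bullet> q \<le> W q" using c by (simp add: a[OF face_simplex[OF q]] \<kappa>_def add_divide_distrib)
  qed (simp add: a[OF p] \<kappa>_def)
qed

section \<open>The game value is at least the minimal martingale cost\<close>

text \<open>The uninformed player holds a vector of payoffs that remain to be guaranteed, subtracts from it
  the payoffs collected on each cell of the grid, and chooses the next action from the approximate
  value of this vector.\<close>

locale tracking = payoff_data T U V l C Lip
  for T :: real and U :: "'u::euclidean_space set" and V :: "'v::euclidean_space set"
    and l :: "'i::finite \<Rightarrow> real \<times> 'u \<times> 'v \<Rightarrow> real" and C Lip :: real +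
  fixes t0 h :: real and N :: nat and sel :: "nat \<Rightarrow> nat \<Rightarrow> 'v" and a0 :: "real^'i"
  assumes t0: "0 \<le> t0" "t0 < T" and N: "0 < N" and sel: "\<And>k n. sel k n \<in> V"
begin

abbreviation g :: "nat \<Rightarrow> real" where
  "g \<equiv> grid t0 T N"

definition gain :: "nat \<Rightarrow> nat \<Rightarrow> (real \<Rightarrow> 'u) \<Rightarrow> real^'i" where
  "gain k n u = (\<chi> i. pay i (g k) (g (Suc k)) u (restrict (\<lambda>_. sel k n) {t0..T}))"

primrec X :: "nat \<Rightarrow> (real \<Rightarrow> 'u) \<Rightarrow> real^'i" where
  "X 0 u = a0"
| "X (Suc k) u = X k u - gain k (net_index h (X k u)) u"

definition answer :: "(real \<Rightarrow> 'u) \<Rightarrow> real \<Rightarrow> 'v" where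
  "answer u = restrict (\<lambda>s. sel (cell t0 T N s) (net_index h (X (cell t0 T N s) u))) {t0..T}"

lemma g_bounds: "k < N \<Longrightarrow> t0 \<le> g k" "k < N \<Longrightarrow> g k \<le> g (Suc k)" "k < N \<Longrightarrow> g (Suc k) \<le> T"
  using grid_bounds[of t0 T N] grid_mono[of t0 T k "Suc k" N] t0 by auto

lemma answer_controls: "answer u \<in> controls t0 T V"
  unfolding answer_def
  by (rule restrict_controls) (auto intro: sel measurable_compose[OF cell_measurable])

text \<open>The action on a cell depends on the past through a natural number only, so the gain is
  pieced together from countably many measurable functionals of the control.\<close>

lemma X_measurable: "k \<le> N \<Longrightarrow> X k \<in> borel_measurable (control_space t0 T U)"
proof (induction k)
  case (Suc k)
  then have k: "k < N" and IH: "X k \<in> borel_measurable (control_space t0 T U)" by auto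
  have "gain k n \<in> borel_measurable (control_space t0 T U)" for n
  proof (rule borel_measurable_euclidean_space[THEN iffD2], rule ballI)
    fix b :: "real^'i" assume "b \<in> Basis"
    then obtain i x where "x \<in> Basis" and b: "b = axis i (x :: real)" unfolding Basis_vec_def by blast
    then have b: "b = axis i 1" by simp
    have "(\<lambda>u. pay i (g k) (g (Suc k)) u (restrict (\<lambda>_. sel k n) {t0..T})) \<in> borel_measurable (control_space t0 T U)"
      by (rule pay_measurable_u[OF t0(1) g_bounds[OF k] const_control[OF sel]])
    then show "(\<lambda>u. gain k n u \<bullet> b) \<in> borel_measurable (control_space t0 T U)"
      by (simp add: b gain_def inner_axis)
  qed
  then have "(\<lambda>u. gain k (net_index h (X k u)) u) \<in> borel_measurable (control_space t0 T U)"
    by (rule measurable_compose_countable) (rule measurable_compose[OF IH net_index_measurable])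
  then show ?case using IH by simp
next
  case 0
  have "X 0 = (\<lambda>_. a0)" by (rule ext) simp
  then show ?case by simp
qed

text \<open>The answer factors through the list of rounded states. Lists of naturals are countable,
  so only the events fixing this list have to be measurable.\<close>

lemma answer_measurable: "answer \<in> control_space t0 T U \<rightarrow>\<^sub>M control_space t0 T V"
proof -
  define \<nu> where "\<nu> u = map (\<lambda>k. net_index h (X k u)) [0..<N]" for u
  have "\<nu> \<in> control_space t0 T U \<rightarrow>\<^sub>M count_space UNIV"
    unfolding measurable_count_space_eq2_countable
  proof (intro conjI ballI)
    fix d :: "nat list"
    have "{u \<in> space (control_space t0 T U). \<forall>j\<in>{..<N}. net_index h (X j u) = d ! j} \<in> sets (control_space t0 T U)"
    proof (rule sets.sets_Collect_finite_All)
      fix j assume "j \<in> {..<N}"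
      then have [measurable]: "X j \<in> borel_measurable (control_space t0 T U)" by (intro X_measurable) simp
      show "{u \<in> space (control_space t0 T U). net_index h (X j u) = d ! j} \<in> sets (control_space t0 T U)"
        by measurable
    qed simp
    moreover have "length d = N \<Longrightarrow> \<nu> u = d \<longleftrightarrow> (\<forall>j\<in>{..<N}. net_index h (X j u) = d ! j)" for u
      by (simp add: \<nu>_def list_eq_iff_nth_eq Ball_def)
    then have "\<nu> -` {d} \<inter> space (control_space t0 T U) =
        {u \<in> space (control_space t0 T U). \<forall>j\<in>{..<N}. net_index h (X j u) = d ! j}" if "length d = N"
      using that by blast
    moreover have "\<nu> -` {d} \<inter> space (control_space t0 T U) = {}" if "length d \<noteq> N"
      using that by (force simp: \<nu>_def)
    ultimately show "\<nu> -` {d} \<inter> space (control_space t0 T U) \<in> sets (control_space t0 T U)"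
      by (cases "length d = N") (simp_all only: sets.empty_sets simp_thms)
  qed auto
  moreover have "(\<lambda>\<nu>. restrict (\<lambda>s. sel (cell t0 T N s) (\<nu> ! cell t0 T N s)) {t0..T}) \<in> count_space UNIV \<rightarrow>\<^sub>M control_space t0 T V"
    by (auto intro!: restrict_controls sel measurable_compose[OF cell_measurable])
  ultimately have "(\<lambda>u. restrict (\<lambda>s. sel (cell t0 T N s) (\<nu> u ! cell t0 T N s)) {t0..T}) \<in> control_space t0 T U \<rightarrow>\<^sub>M control_space t0 T V"
    by (rule measurable_compose)
  moreover have "answer = (\<lambda>u. restrict (\<lambda>s. sel (cell t0 T N s) (\<nu> u ! cell t0 T N s)) {t0..T})"
    by (intro ext) (simp add: answer_def \<nu>_def cell_less[OF N] restrict_def)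
  ultimately show ?thesis by (simp only:)
qed

lemma X_cong:
  assumes u: "u \<in> controls t0 T U" "u' \<in> controls t0 T U"
  shows "k \<le> N \<Longrightarrow> AE s in lebesgue_on {t0..g k}. u s = u' s \<Longrightarrow> X k u = X k u'"
proof (induction k)
  case (Suc k)
  then have k: "k < N" by simp
  have "X k u = X k u'"
    by (rule Suc.IH) (use k g_bounds[OF k] in \<open>auto intro: AE_interval_subset[OF Suc.prems(2)]\<close>)
  moreover have "gain k n u = gain k n u'" for n
    unfolding gain_def vec_eq_iff vec_lambda_beta
  proof
    fix i
    have "AE s in lebesgue_on {g k..g (Suc k)}. u s = u' s"
      by (rule AE_interval_subset[OF Suc.prems(2)]) (use g_bounds[OF k] in auto)
    then show "pay i (g k) (g (Suc k)) u (restrict (\<lambda>_. sel k n) {t0..T}) = pay i (g k) (g (Suc k)) u' (restrict (\<lambda>_. sel k n) {t0..T})"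
      by (rule pay_cong_AE[OF u(1) const_control[OF sel] u(2) const_control[OF sel] t0(1) g_bounds(1,3)[OF k]]) simp
  qed
  ultimately show ?case by simp
qed simp

text \<open>On cell \<open>j\<close> the action is determined by the state at its left end, hence by
  the control before that cell: one cell of delay.\<close>

lemma answer_delay:
  assumes u: "u \<in> controls t0 T U" "u' \<in> controls t0 T U" and j: "j < N" and eq: "AE s in lebesgue_on {t0..g j}. u s = u' s"
  shows "AE s in lebesgue_on {t0..g (Suc j)}. answer u s = answer u' s"
proof -
  have *: "answer u s = answer u' s" if s: "t0 \<le> s" "s < g (Suc j)" for s
  proof -
    have "s < T" using s g_bounds[OF j] by simp
    then have "g (cell t0 T N s) < g (Suc j)" using cell_bounds[of t0 T N s] t0 N s by auto
    then have "cell t0 T N s \<le> j"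
      using grid_mono[of t0 T "Suc j" "cell t0 T N s" N] t0 by (force simp: not_less[symmetric])
    moreover from this have "g (cell t0 T N s) \<le> g j" using t0 by (intro grid_mono) auto
    then have "AE s in lebesgue_on {t0..g (cell t0 T N s)}. u s = u' s"
      by (intro AE_interval_subset[OF eq]) auto
    ultimately have "X (cell t0 T N s) u = X (cell t0 T N s) u'" using j by (intro X_cong[OF u]) auto
    then show ?thesis by (simp add: answer_def)
  qed
  show ?thesis
    using AE_interval_neq[of "g (Suc j)" t0 "g (Suc j)"] unfolding AE_interval_iff
    by eventually_elim (auto intro!: * simp: less_le)
qed

lemma answer_strategy:
  assumes "M \<in> E"
  shows "(M, \<lambda>(\<omega>, u). answer u) \<in> random_strategies E t0 T U V"
proof -
  have "(\<lambda>x. answer (snd x)) \<in> M \<Otimes>\<^sub>M control_space t0 T U \<rightarrow>\<^sub>M control_space t0 T V"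
    by (rule measurable_compose[OF measurable_snd answer_measurable])
  moreover have "\<forall>j<N. g j < g (Suc j)" using t0 N by (auto intro: grid_strict_mono)
  moreover have "\<forall>\<omega>\<in>space M. \<forall>v1\<in>controls t0 T U. \<forall>v2\<in>controls t0 T U. \<forall>j<N.
     (AE s in lebesgue_on {t0..g j}. v1 s = v2 s) \<longrightarrow> (AE s in lebesgue_on {t0..g (Suc j)}. answer v1 s = answer v2 s)"
    using answer_delay by blast
  ultimately show ?thesis
    unfolding random_strategies_def using assms N
    by (auto simp: case_prod_unfold intro!: exI[of _ N] exI[of _ g])
qed

lemma X_component: "m \<le> N \<Longrightarrow> X m u $ i = a0 $ i - (\<Sum>k<m. gain k (net_index h (X k u)) u $ i)"
  by (induction m) auto

text \<open>Exact accounting for every type at once and against every control: what has left the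
  tracked vector is what has been paid.\<close>

lemma pay_answer:
  assumes u: "u \<in> controls t0 T U"
  shows "pay i t0 T u (answer u) = a0 $ i - X N u $ i"
proof -
  have "integrable (lebesgue_on {t0..T}) (\<lambda>s. l i (s, u s, answer u s))"
    by (rule pay_integrable[OF u answer_controls t0(1) order_refl order_refl])
  from LI_grid[OF this less_imp_le[OF t0(2)] N order_refl]
  have "pay i t0 T u (answer u) = (\<Sum>k<N. pay i (g k) (g (Suc k)) u (answer u))"
    using N by (simp add: pay_def)
  also have "\<dots> = (\<Sum>k<N. gain k (net_index h (X k u)) u $ i)"
  proof (rule sum.cong[OF refl])
    fix k assume "k \<in> {..<N}"
    then have k: "k < N" by simp
    have "AE s in lebesgue_on {g k..g (Suc k)}. answer u s = restrict (\<lambda>_. sel k (net_index h (X k u))) {t0..T} s"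
      using AE_interval_neq[of "g (Suc k)" "g k" "g (Suc k)"] unfolding AE_interval_iff
    proof eventually_elim
      case (elim s)
      show ?case
      proof
        assume s: "s \<in> {g k..g (Suc k)}"
        with elim have "g k \<le> s" "s < g (Suc k)" by auto
        then have "cell t0 T N s = k" using t0 N k by (intro cell_eq) auto
        then show "answer u s = restrict (\<lambda>_. sel k (net_index h (X k u))) {t0..T} s" by (simp add: answer_def)
      qed
    qed
    then show "pay i (g k) (g (Suc k)) u (answer u) = gain k (net_index h (X k u)) u $ i"
      unfolding gain_def vec_lambda_beta
      by (intro pay_cong_AE[OF u answer_controls u const_control[OF sel] t0(1) g_bounds(1,3)[OF k]]) auto
  qed
  finally show ?thesis by (simp add: X_component)
qed

text \<open>The guarantee holds along every control and so integrates over any strategy of the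
  opponent. Integrability of the payoff is the reason for using the measurable play obtained by
  iteration.\<close>

lemma expected_payoff_answer:
  assumes E: "admissible_family E" and a: "a \<in> random_strategies E t0 T V U" and N': "N' \<in> E"
    and c: "\<And>u. u \<in> controls t0 T U \<Longrightarrow> c \<le> a0 $ i - X N u $ i"
  shows "c \<le> expected_payoff t0 T U V (l i) a (N', \<lambda>(\<omega>, u). answer u)"
proof -
  obtain M \<alpha> where a_eq: "a = (M, \<alpha>)" by fastforce
  have \<alpha>: "(M, \<alpha>) \<in> random_strategies E t0 T V U" using a a_eq by simp
  have \<beta>: "(N', \<lambda>(\<omega>, u). answer u) \<in> random_strategies E t0 T U V" by (rule answer_strategy[OF N'])
  interpret sp: strategy_pair E t0 T U V M N' \<alpha> "\<lambda>(\<omega>, u). answer u" by (rule strategy_pair.intro[OF \<alpha> \<beta>])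
  interpret M: prob_space M using E \<alpha> by (auto simp: random_strategies_def admissible_family_def)
  interpret N': prob_space N' using E N' by (auto simp: admissible_family_def)
  interpret MN: pair_prob_space M N' ..
  obtain v0 where v0: "v0 \<in> controls t0 T V" using controls_V_nonempty by blast
  obtain n where n: "\<And>\<omega> v. fst \<omega> \<in> space M \<Longrightarrow> snd \<omega> \<in> space N' \<Longrightarrow> v \<in> controls t0 T V \<Longrightarrow>
    is_play t0 T U V \<alpha> (\<lambda>(\<omega>, u). answer u) \<omega> (\<alpha> (fst \<omega>, (sp.response \<omega> ^^ n) v)) ((sp.response \<omega> ^^ n) v)"
    by (rule sp.is_play_iterate, rule that)
  define v where "v \<omega> = (sp.response \<omega> ^^ n) v0" for \<omega>
  define u where "u \<omega> = \<alpha> (fst \<omega>, v \<omega>)" for \<omega>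
  have play: "is_play t0 T U V \<alpha> (\<lambda>(\<omega>, u). answer u) \<omega> (u \<omega>) (v \<omega>)" if "\<omega> \<in> space (M \<Otimes>\<^sub>M N')" for \<omega>
    unfolding u_def v_def by (rule n) (use that v0 in \<open>auto simp: space_pair_measure\<close>)
  have "expected_payoff t0 T U V (l i) a (N', \<lambda>(\<omega>, u). answer u) = (\<integral>\<omega>. pay i t0 T (u \<omega>) (v \<omega>) \<partial>(M \<Otimes>\<^sub>M N'))"
    unfolding a_eq by (rule expected_payoff_eq[OF \<alpha> \<beta> t0(1) play])
  also have "\<dots> = (\<integral>\<omega>. a0 $ i - X N (u \<omega>) $ i \<partial>(M \<Otimes>\<^sub>M N'))"
  proof (rule Bochner_Integration.integral_cong[OF refl])
    fix \<omega> assume \<omega>: "\<omega> \<in> space (M \<Otimes>\<^sub>M N')"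
    note uv = is_play_controls[OF play[OF \<omega>]]
    have "pay i t0 T (u \<omega>) (v \<omega>) = pay i t0 T (u \<omega>) (answer (u \<omega>))"
      by (rule pay_cong_AE[OF uv uv(1) answer_controls t0(1) order_refl order_refl])
        (use play[OF \<omega>] in \<open>auto simp: is_play_def eq_commute\<close>)
    then show "pay i t0 T (u \<omega>) (v \<omega>) = a0 $ i - X N (u \<omega>) $ i" by (simp add: pay_answer[OF uv(1)])
  qed
  also have "\<dots> \<ge> (\<integral>\<omega>. c \<partial>(M \<Otimes>\<^sub>M N'))"
  proof (rule integral_mono)
    have "u \<in> M \<Otimes>\<^sub>M N' \<rightarrow>\<^sub>M control_space t0 T U"
      unfolding u_def[abs_def] v_def by (rule sp.iterate_measurable(2)[OF v0])
    then have "(\<lambda>\<omega>. X N (u \<omega>) $ i) \<in> borel_measurable (M \<Otimes>\<^sub>M N')"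
      by (intro borel_measurable_vec_nth measurable_compose[OF _ X_measurable[OF order_refl]])
    moreover have "\<bar>a0 $ i - X N (u \<omega>) $ i\<bar> \<le> C * (T - t0)" if "\<omega> \<in> space (M \<Otimes>\<^sub>M N')" for \<omega>
      using pay_abs_le[OF is_play_controls(1)[OF play[OF that]] answer_controls t0(1) order_refl _ order_refl, of i "u \<omega>"] t0
      by (simp add: pay_answer[OF is_play_controls(1)[OF play[OF that]]])
    ultimately show "integrable (M \<Otimes>\<^sub>M N') (\<lambda>\<omega>. a0 $ i - X N (u \<omega>) $ i)"
      by (intro MN.integrable_const_bound[where B="C * (T - t0)"]) (auto intro!: AE_I2)
    fix \<omega> assume "\<omega> \<in> space (M \<Otimes>\<^sub>M N')"
    from is_play_controls(1)[OF play[OF this]] show "c \<le> a0 $ i - X N (u \<omega>) $ i" by (rule c)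
  qed simp
  finally show ?thesis by (simp add: MN.prob_space)
qed

end

section \<open>The guarantee of the uninformed player\<close>

context payoff_data
begin

lemma W_le_game_value:
  assumes isaacs: "isaacs_condition T U V l" and E: "admissible_family E"
    and t0: "0 \<le> t0" "t0 < T" and p0: "p0 \<in> prob_simplex"
  shows "W t0 p0 \<le> game_value E T U V l t0 p0"
proof (rule field_le_epsilon)
  fix e' :: real assume "0 < e'"
  have t0': "t0 \<le> T" using t0 by simp
  \<comment> \<open>One \<open>e\<close> each for the affine minorant, the rounding of the state,
    the second-order terms and the quadratic regularization at a vertex. On every cell
    \<open>3 * e\<close> per unit of time pays for the near-optimal action and for freezing time in
    the payoff and in the Hamiltonian.\<close>
  define e where "e = e' / (4 + 3 * (T - t0))"
  have e: "0 < e" using \<open>0 < e'\<close> t0 by (simp add: e_def)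
  have e_eq: "4 * e + 3 * e * (T - t0) = e'"
  proof -
    have "e * (4 + 3 * (T - t0)) = e'" using t0 by (simp add: e_def)
    then show ?thesis by (simp add: algebra_simps)
  qed
  obtain d where d: "time_step e d" by (rule time_step_exists[OF e])
  then have d0: "0 < d" by (simp add: time_step_def)
  \<comment> \<open>The first bound makes the mesh smaller than \<open>d\<close>; the second makes
    the \<open>N\<close> second-order errors sum to at most \<open>e\<close>.\<close>
  obtain N where N': "max ((T - t0) / d) ((Lip * (T - t0))\<^sup>2 / (2 * e) / e) < real N" using reals_Archimedean2 by blast
  have "0 < (T - t0) / d" using t0 d0 by simp
  then have N: "0 < N" using N' by (intro Nat.gr0I) auto
  define D where "D = (T - t0) / real N"
  have D: "0 < D" "D < d" "real N * D = T - t0"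
    using N N' t0 d0 by (auto simp: D_def field_simps)
  have D2: "real N * ((Lip * D)\<^sup>2 / (2 * e)) \<le> e"
  proof -
    have "real N * ((Lip * D)\<^sup>2 / (2 * e)) = (Lip * (T - t0))\<^sup>2 / (2 * e) / real N"
      using N by (simp add: D_def power2_eq_square mult.commute mult.left_commute)
    also have "\<dots> \<le> e" using N' N e by (simp add: field_simps)
    finally show ?thesis .
  qed
  \<comment> \<open>Rounding costs \<open>4 * h\<close> per cell, hence \<open>e\<close> over all
    cells.\<close>
  define h where "h = e / (4 * real N)"
  have h: "0 < h" "real N * (4 * h) = e" using e N by (auto simp: h_def)
  define g where "g k = grid t0 T N k" for k
  have gb: "t0 \<le> g k" "g k \<le> T" if "k \<le> N" for k
    using grid_bounds[OF t0' N that] by (auto simp: g_def)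
  have gS: "g (Suc k) = g k + D" for k by (simp add: g_def D_def grid_Suc)
  define Q where "Q = face p0"
  have p0Q: "p0 \<in> Q" using p0 by (simp add: Q_def face_def)
  have QS: "q \<in> prob_simplex" if "q \<in> Q" for q using that by (simp add: Q_def face_def)
  have Q: "convex Q" "Q \<noteq> {}" "\<And>q. q \<in> Q \<Longrightarrow> norm q \<le> 1"
    using p0Q convex_face prob_simplex_norm QS by (auto simp: Q_def)
  define B where "B = C * (T - t0)"
  have WB: "\<bar>W (g k) q\<bar> \<le> B" if "k \<le> N" "q \<in> Q" for k q
  proof -
    have "\<bar>W (g k) q\<bar> \<le> C * (T - g k)" using gb[OF that(1)] t0 QS[OF that(2)] by (intro W_abs_le) auto
    also have "\<dots> \<le> B" unfolding B_def using gb[OF that(1)] C_nonneg by (intro mult_left_mono) auto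
    finally show ?thesis .
  qed
  have Wc: "convex_on Q (W (g k))" if "k \<le> N" for k
    by (rule convex_on_subset[OF W_convex]) (use gb[OF that] t0 QS Q(1) in auto)
  obtain a0 where a0: "\<And>q. q \<in> Q \<Longrightarrow> a0 \<bullet> q \<le> W t0 q" "W t0 p0 - e \<le> a0 \<bullet> p0"
    using convex_face_minorant[OF p0 _ e, of "W t0"] Wc[of 0] by (auto simp: Q_def g_def)
  \<comment> \<open>A near maximizer of the potential for the end of cell \<open>k\<close>, one for
    each rounded state. The tolerance \<open>e\<close> also serves as the regularization
    parameter.\<close>
  have "\<exists>q\<in>Q. k < N \<longrightarrow> pot Q e (W (g (Suc k))) (dense_seq n) - h \<le> dense_seq n \<bullet> q - W (g (Suc k)) q - e * (norm q)\<^sup>2" for k n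
  proof (cases "k < N")
    case True
    then have "Suc k \<le> N" by simp
    from pot_near[where W="W (g (Suc k))" and B=B, OF Q e WB[OF this] h(1)] show ?thesis
      by (meson less_imp_le)
  qed (use Q(2) in auto)
  then obtain qq where qq: "\<And>k n. qq k n \<in> Q"
    "\<And>k n. k < N \<Longrightarrow> pot Q e (W (g (Suc k))) (dense_seq n) - h \<le> dense_seq n \<bullet> qq k n - W (g (Suc k)) (qq k n) - e * (norm (qq k n))\<^sup>2"
    by metis
  \<comment> \<open>The action is chosen as if the belief were the near maximizer; this
    \<open>q\<close> is a device of the potential and not a posterior of the type.\<close>
  have "\<exists>v\<in>V. k < N \<longrightarrow> (\<forall>u\<in>U. H (g k) (qq k n) - e \<le> mean (qq k n) (g k) u v)" for k n
  proof (cases "k < N")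
    case True
    then have "g k \<in> {0..T}" using gb[of k] t0 by auto
    from H_near_optimal_v[OF QS[OF qq(1)] this isaacs e] show ?thesis by blast
  qed (use V_ne in auto)
  then obtain sv where sv: "\<And>k n. sv k n \<in> V"
    "\<And>k n u. k < N \<Longrightarrow> u \<in> U \<Longrightarrow> H (g k) (qq k n) - e \<le> mean (qq k n) (g k) u (sv k n)"
    by metis
  interpret tracking T U V l C Lip t0 h N sv a0
    by unfold_locales (use t0 N sv in auto)
  define err where "err = 4 * h + 3 * e * D + (Lip * D)\<^sup>2 / (2 * e)"
  have step: "pot Q e (W (g (Suc k))) (X (Suc k) u) \<le> pot Q e (W (g k)) (X k u) + err"
    if k: "k < N" and u: "u \<in> controls t0 T U" for k u
  proof -
    define n where "n = net_index h (X k u)"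
    let ?v = "restrict (\<lambda>_. sv k n) {t0..T}"
    have v: "?v \<in> controls t0 T V" by (rule const_control[OF sv(1)])
    have kb: "t0 \<le> g k" "g k \<le> g (Suc k)" "g (Suc k) \<le> T" using gb[of k] gb[of "Suc k"] k D by (auto simp: gS)
    have gain_abs: "\<bar>gain k n u $ i\<bar> \<le> C * D" for i
      using pay_abs_le[OF u v t0(1) kb, of i] by (simp add: gain_def g_def[symmetric] gS)
    have "norm (gain k n u) \<le> (\<Sum>i\<in>UNIV. \<bar>gain k n u $ i\<bar>)" by (rule norm_le_l1_cart)
    also have "\<dots> \<le> (\<Sum>i\<in>(UNIV :: 'i set). C * D)" by (rule sum_mono) (rule gain_abs)
    also have "\<dots> = Lip * D" by (simp add: Lip_eq)
    finally have gain_norm: "(norm (gain k n u))\<^sup>2 / (2 * e) \<le> (Lip * D)\<^sup>2 / (2 * e)"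
      using e by (intro divide_right_mono power_mono) auto
    have qS: "qq k n \<in> prob_simplex" by (rule QS[OF qq(1)])
    have Hi: "integrable (lebesgue_on {g k..g (Suc k)}) (\<lambda>s. H s (qq k n))"
      by (rule H_path_integrable) (use qS kb t0 in auto)
    note li = pay_integrable[OF u v t0(1) kb(1,3)]
    have ci: "integrable (lebesgue_on {g k..g (Suc k)}) (\<lambda>_. 3 * e)"
      by (rule finite_measure.integrable_const[OF finite_measure_interval])
    have "LI (g k) (g (Suc k)) (\<lambda>s. H s (qq k n)) - 3 * e * D = LI (g k) (g (Suc k)) (\<lambda>s. H s (qq k n) - 3 * e)"
      by (subst Bochner_Integration.integral_diff[OF Hi ci]) (simp only: LI_const[OF kb(2)], simp add: gS)
    also have "\<dots> \<le> LI (g k) (g (Suc k)) (\<lambda>s. mean (qq k n) s (u s) (?v s))"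
    proof (rule LI_mono)
      show "integrable (lebesgue_on {g k..g (Suc k)}) (\<lambda>s. H s (qq k n) - 3 * e)"
        by (rule Bochner_Integration.integrable_diff[OF Hi ci])
      show "integrable (lebesgue_on {g k..g (Suc k)}) (\<lambda>s. mean (qq k n) s (u s) (?v s))"
        unfolding mean_def by (intro Bochner_Integration.integrable_sum integrable_mult_right li)
      fix s assume s: "s \<in> {g k..g (Suc k)}"
      have us: "u s \<in> U" using s kb by (intro controls_in[OF u]) auto
      have vs: "?v s = sv k n" using s kb by auto
      have st: "s \<in> {0..T}" "g k \<in> {0..T}" "\<bar>s - g k\<bar> < d" using s kb t0 D by (auto simp: gS)
      have "\<bar>mean (qq k n) s (u s) (sv k n) - mean (qq k n) (g k) (u s) (sv k n)\<bar> \<le> e"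
        by (rule time_step_mean[OF d qS st us sv(1)])
      moreover have "\<bar>H s (qq k n) - H (g k) (qq k n)\<bar> \<le> e" by (rule time_step_H[OF d qS st])
      ultimately show "H s (qq k n) - 3 * e \<le> mean (qq k n) s (u s) (?v s)"
        using sv(2)[OF k us, of n] unfolding vs by linarith
    qed
    also have "\<dots> = gain k n u \<bullet> qq k n"
      unfolding mean_def using li
      by (subst Bochner_Integration.integral_sum)
        (auto simp: gain_def inner_vec_def pay_def g_def mult.commute)
    finally have hq: "LI (g k) (g (Suc k)) (\<lambda>s. H s (qq k n)) - 3 * e * D \<le> gain k n u \<bullet> qq k n" .
    have "pot Q e (W (g (Suc k))) (X k u - gain k n u) \<le>
        pot Q e (W (g k)) (X k u) + 4 * h + 3 * e * D + (norm (gain k n u))\<^sup>2 / (2 * e)"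
    proof (rule pot_step[where Q=Q and W="W (g k)" and W'="W (g (Suc k))" and B=B and q="qq k n" and y="dense_seq n"
          and g="\<lambda>q. LI (g k) (g (Suc k)) (\<lambda>s. H s q)", OF Q e _ _ _ _ qq(1) qq(2)[OF k] _ hq])
      show "W (g k) q \<le> LI (g k) (g (Suc k)) (\<lambda>s. H s q) + W (g (Suc k)) q" if "q \<in> Q" for q
        using kb t0 by (intro W_step QS[OF that]) auto
      show "norm (X k u - dense_seq n) \<le> h"
        using net_index[OF h(1), of "X k u"] by (simp add: n_def dist_norm)
    qed (use k WB Wc in auto)
    then show ?thesis using gain_norm by (simp add: err_def n_def)
  qed
  have track: "pot Q e (W (g k)) (X k u) \<le> real k * err" if "k \<le> N" and u: "u \<in> controls t0 T U" for k u
    using that(1)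
  proof (induction k)
    case 0
    \<comment> \<open>The initial vector is a minorant of \<open>W t0\<close> on the face, so the
      potential starts at or below 0.\<close>
    have "pot Q e (W t0) a0 \<le> 0"
    proof (rule pot_least[where B=B, OF Q e])
      show "\<bar>W t0 q\<bar> \<le> B" if "q \<in> Q" for q using WB[of 0 q] that by (simp add: g_def)
      show "a0 \<bullet> q - W t0 q - e * (norm q)\<^sup>2 \<le> 0" if "q \<in> Q" for q
        using a0(1)[OF that] mult_nonneg_nonneg[OF less_imp_le[OF e] zero_le_power2[of "norm q"]] by linarith
    qed
    then show ?case by (simp add: g_def)
  next
    case (Suc k)
    then show ?case using step[of k u] u by (simp add: algebra_simps)
  qed
  have Nerr: "real N * err \<le> 2 * e + 3 * e * (T - t0)"
  proof -
    have "real N * err = real N * (4 * h) + 3 * e * (real N * D) + real N * ((Lip * D)\<^sup>2 / (2 * e))"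
      by (simp add: err_def algebra_simps)
    then show ?thesis using h(2) D(3) D2 by simp
  qed
  define \<delta> where "\<delta> = 3 * e + 3 * e * (T - t0)"
  have guarantee: "a0 $ i - \<delta> \<le> a0 $ i - X N u $ i" if i: "p0 $ i \<noteq> 0" and u: "u \<in> controls t0 T U" for i u
  proof -
    \<comment> \<open>Testing the final potential with a vertex, where \<open>W\<close> vanishes and
      the quadratic term equals \<open>e\<close>, bounds each remaining coordinate by the
      accumulated error.\<close>
    have ax: "axis i 1 \<in> Q" using i axis_in_prob_simplex[of i] by (auto simp: Q_def face_def) (auto simp: axis_def)
    have "X N u \<bullet> axis i 1 - W (g N) (axis i 1) - e * (norm (axis i 1 :: real^'i))\<^sup>2 \<le> pot Q e (W (g N)) (X N u)"
      by (rule pot_upper[where B=B, OF Q e WB[OF order_refl] ax])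
    moreover have "W (g N) (axis i 1) = 0" using N by (simp add: g_def W_terminal axis_in_prob_simplex)
    ultimately have "X N u $ i - e \<le> pot Q e (W (g N)) (X N u)" by (simp add: inner_axis)
    then show ?thesis using track[OF order_refl u] Nerr by (simp add: \<delta>_def)
  qed
  obtain M where M: "M \<in> E" using E by (auto simp: admissible_family_def)
  define b where "b = (M, \<lambda>(\<omega> :: 'a, u). answer u)"
  have b: "b \<in> random_strategies E t0 T U V" unfolding b_def by (rule answer_strategy[OF M])
  have "W t0 p0 - e' \<le> game_value E T U V l t0 p0"
    unfolding game_value_def using t0(2)
  proof (simp only: if_True, intro cINF_greatest)
    have "random_strategies E t0 T V U \<noteq> {}"
      using random_strategies_nonempty[OF E t0(2), where V=V and U=U] controls_U_nonempty by blast
    then show "{a. \<forall>i. a i \<in> random_strategies E t0 T V U} \<noteq> {}" by auto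
    fix a :: "'i \<Rightarrow> _" assume "a \<in> {a. \<forall>i. a i \<in> random_strategies E t0 T V U}"
    then have a: "\<And>i. a i \<in> random_strategies E t0 T V U" by auto
    have "W t0 p0 - e' \<le> a0 \<bullet> p0 - \<delta>" using a0(2) e_eq unfolding \<delta>_def by linarith
    also have "\<dots> = (\<Sum>i\<in>UNIV. p0 $ i * (a0 $ i - \<delta>))"
      using prob_simplex_sum[OF p0]
      by (simp add: inner_vec_def right_diff_distrib sum_subtractf sum_distrib_left[symmetric] mult.commute)
    also have "\<dots> \<le> (\<Sum>i\<in>UNIV. p0 $ i * expected_payoff t0 T U V (l i) (a i) b)"
    proof (rule sum_mono)
      fix i
      show "p0 $ i * (a0 $ i - \<delta>) \<le> p0 $ i * expected_payoff t0 T U V (l i) (a i) b"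
      \<comment> \<open>Vertices of types with probability zero lie outside the face and yield no
        guarantee, but these types have weight zero in the sum.\<close>
      proof (cases "p0 $ i = 0")
        case False
        show ?thesis unfolding b_def
          by (intro mult_left_mono expected_payoff_answer[OF E a M] guarantee[OF False] prob_simplex_nonneg[OF p0])
      qed simp
    qed
    also have "\<dots> \<le> (SUP b\<in>random_strategies E t0 T U V. \<Sum>i\<in>UNIV. p0 $ i * expected_payoff t0 T U V (l i) (a i) b)"
      by (rule cSUP_upper[OF b SUP_payoff_bdd_above[OF E t0(1) t0' p0 a]])
    finally show "W t0 p0 - e' \<le> \<dots>" .
  qed
  then show "W t0 p0 \<le> game_value E T U V l t0 p0 + e'" by simp
qed

end

theorem theorem2p1:
  fixes T t0 :: real
    and U :: "'u::euclidean_space set"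
    and V :: "'v::euclidean_space set"
    and l :: "'i::finite \<Rightarrow> real \<times> 'u \<times> 'v \<Rightarrow> real"
    and E :: "'w measure set"
    and p0 :: "real ^ 'i"
  assumes "CARD('i) \<ge> 2"
    and "T > 0"
    and "compact U" and "U \<noteq> {}"
    and "compact V" and "V \<noteq> {}"
    and "\<And>i. continuous_on ({0..T} \<times> U \<times> V) (l i)"
    and "isaacs_condition T U V l"
    and "admissible_family E"
    and "t0 \<in> {0..T}"
    and "p0 \<in> prob_simplex"
  shows "game_value E T U V l t0 p0 =
    (INF P\<in>martingale_measures T t0 p0.
       LINT w|P. (LINT s|lebesgue_on {t0..T}. hamiltonian U V l s (w s)))"
proof -
  have "compact ({0..T} \<times> U \<times> V)" using assms by (intro compact_Times) auto
  then have "bounded (l i ` ({0..T} \<times> U \<times> V))" for i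
    using assms(7) by (intro compact_imp_bounded compact_continuous_image)
  then have "\<exists>B. \<forall>x\<in>{0..T} \<times> U \<times> V. \<bar>l i x\<bar> \<le> B" for i
    by (simp add: bounded_iff)
  then obtain B where B: "\<And>i x. x \<in> {0..T} \<times> U \<times> V \<Longrightarrow> \<bar>l i x\<bar> \<le> B i" by metis
  define C where "C = Max (range B)"
  have C: "\<bar>l i (s, u, v)\<bar> \<le> C" if "s \<in> {0..T}" "u \<in> U" "v \<in> V" for i s u v
  proof -
    have "B i \<le> C" unfolding C_def by (rule Max_ge) auto
    with B[of "(s, u, v)" i] that show ?thesis by auto
  qed
  interpret payoff_data T U V l C "C * real CARD('i)"
    by unfold_locales (use assms C in auto)
  have t0: "0 \<le> t0" "t0 \<le> T" using assms(10) by auto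
  have RHS: "(INF P\<in>martingale_measures T t0 p0. LINT w|P. (LINT s|lebesgue_on {t0..T}. hamiltonian U V l s (w s))) = W t0 p0"
    by (simp add: W_def hint_def)
  show ?thesis
  proof (cases "t0 < T")
    case True
    have "game_value E T U V l t0 p0 \<le> W t0 p0"
      unfolding W_def
      by (intro cINF_greatest martingale_measures_nonempty[OF assms(11) t0(2)]
          game_value_le_martingale[OF assms(9) t0(1) True assms(11)])
    moreover have "W t0 p0 \<le> game_value E T U V l t0 p0"
      by (rule W_le_game_value[OF assms(8,9) t0(1) True assms(11)])
    ultimately show ?thesis unfolding RHS by simp
  next
    case False
    \<comment> \<open>At the final time the game value is 0 by definition, and the martingale cost
      is 0 because it is bounded by \<open>C * (T - t0)\<close>.\<close>
    then have "t0 = T" using t0 by simp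
    then show ?thesis unfolding RHS by (simp add: game_value_def W_terminal[OF assms(11)])
  qed
qed

end
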